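(* Let $(x_1,\dots,x_n)$ be a finite sequence of random variables in a noncommutative probability space $(\mathcal{A},\phi)$. If $(x_1,\dots,x_n)$ is boolean exchangeable, then it is boolean spreadable. If $(x_1,\dots,x_n)$ is quantum exchangeable, then it is quantum spreadable.
   Context: A noncommutative probability space $(\mathcal{A},\phi)$ is a unital complex algebra with a linear functional $\phi$, $\phi(1)=1$. $\mathbb{C}\langle X_1,\dots,X_n\rangle$ is the algebra of noncommutative polynomials; $\mu_{x_1,\dots,x_n}(p)=\phi(p(x_1,\dots,x_n))$. **Exchangeability.** $A_s(n)$ (Wang's quantum permutation group) is the universal unital $C^*$-algebra generated by orthogonal projections $u_{i,j}$ ($1\le i,j\le n$) with $u_{i,k}u_{i,l}=0=u_{k,i}u_{l,i}$ for $k\ne l$ and $\sum_ku_{i,k}=1=\sum_ku_{k,i}$ for all $i$. $B_s(n)$ is the universal unital $C^*$-algebra generated by orthogonal projections $u_{i,j}$ ($1\le i,j\le n$) and a projection $\mathbf{P}$ with $u_{i,k}u_{i,l}=0=u_{k,i}u_{l,i}$ for $k\neq l$ and $\sum_{k=1}^nu_{k,i}\mathbf{P}=\mathbf{P}$ for all $i$. **Spreadability.** For $k<n$, $A_i(n,k)$ is the universal unital $C^*$-algebra generated by orthogonal projections $u_{i,j}$ ($1\le i\le n$, $1\le j\le k$) with $\sum_{i=1}^nu_{i,j}=1$ for all $j$ and $u_{i,j}u_{i',j'}=0$ if $j<j'$ and $i\ge i'$. $B_i(n,k)$ is the universal unital $C^*$-algebra generated by orthogonal projections $u_{i,j}$ ($1\le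 i\le n$, $1\le j\le k$) and a projection $\mathbf{P}$ with $\sum_{i=1}^nu_{i,j}\mathbf{P}=\mathbf{P}$ for all $j$ and $u_{i,j}u_{i',j'}=0$ if $j<j'$ and $i\ge i'$. For $C$ any of these algebras (with $k=n$ for $A_s(n),B_s(n)$) let $\alpha_C:\mathbb{C}\langle X_1,\dots,X_k\rangle\to\mathbb{C}\langle X_1,\dots,X_n\rangle\otimes C$ be the unital homomorphism with $X_j\mapsto\sum_{i=1}^nX_i\otimes u_{i,j}$. The sequence $(x_1,\dots,x_n)$ is: - quantum exchangeable if $\mu_{x_1,\dots,x_n}(p)1_C=(\mu_{x_1,\dots,x_n}\otimes id)(\alpha_C(p))$ for all $p\in\mathbb{C}\langle X_1,\dots,X_n\rangle$, $C=A_s(n)$; - quantum spreadable if the same identity holds for all $p\in\mathbb{C}\langle X_1,\dots,X_k\rangle$ with $C=A_i(n,k)$, for all $k=1,\dots,n-1$; - boolean exchangeable if $\mu_{x_1,\dots,x_n}(p)\mathbf{P}=\mathbf{P}[(\mu_{x_1,\dots,x_n}\otimes id)(\alpha_C(p))]\mathbf{P}$ for all $p\in\mathbb{C}\langle X_1,\dots,X_n\rangle$, $C=B_s(n)$; - boolean spreadable if the latter identity holds for all $p\in\mathbb{C}\langle X_1,\dots,X_k\rangle$ with $C=B_i(n,k)$, for all $k=1,\dots,n-1$. *)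

theory Defs
  imports Complex_Main "HOL-Algebra.Module"
begin

section \<open>Unital complex algebras and C*-algebras\<close>

text \<open>The record \<^type>\<open>module\<close> of \<open>HOL-Algebra\<close> carries all the operations of an algebra; its
  locale \<open>algebra\<close> is not used because it demands commutativity.\<close>

locale complex_algebra = ring A for A :: "(complex, 'a, 'm) module_scheme" (structure) +
  assumes smult_closed [simp, intro]: "x \<in> carrier A \<Longrightarrow> a \<odot> x \<in> carrier A"
    and smult_l_distr: "x \<in> carrier A \<Longrightarrow> (a + b) \<odot> x = a \<odot> x \<oplus> b \<odot> x"
    and smult_r_distr: "x \<in> carrier A \<Longrightarrow> y \<in> carrier A \<Longrightarrow> a \<odot> (x \<oplus> y) = a \<odot> x \<oplus> a \<odot> y"
    and smult_assoc: "x \<in> carrier A \<Longrightarrow> (a * b) \<odot> x = a \<odot> (b \<odot> x)"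
    and smult_one [simp]: "x \<in> carrier A \<Longrightarrow> 1 \<odot> x = x"
    and smult_mult_l: "x \<in> carrier A \<Longrightarrow> y \<in> carrier A \<Longrightarrow> (a \<odot> x) \<otimes> y = a \<odot> (x \<otimes> y)"
    and smult_mult_r: "x \<in> carrier A \<Longrightarrow> y \<in> carrier A \<Longrightarrow> x \<otimes> (a \<odot> y) = a \<odot> (x \<otimes> y)"

locale nc_probability_space = complex_algebra A
  for A :: "(complex, 'a, 'm) module_scheme" (structure) +
  fixes \<phi> :: "'a \<Rightarrow> complex"
  assumes functional_add: "x \<in> carrier A \<Longrightarrow> y \<in> carrier A \<Longrightarrow> \<phi> (x \<oplus> y) = \<phi> x + \<phi> y"
    and functional_smult: "x \<in> carrier A \<Longrightarrow> \<phi> (a \<odot> x) = a * \<phi> x"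
    and functional_one: "\<phi> \<one> = 1"

record 'a star_alg = "(complex, 'a) module" +
  star :: "'a \<Rightarrow> 'a"

record 'a cstar_alg = "'a star_alg" +
  cnorm :: "'a \<Rightarrow> real"

locale star_algebra = complex_algebra A for A :: "('a, 'm) star_alg_scheme" (structure) +
  assumes star_closed [simp, intro]: "x \<in> carrier A \<Longrightarrow> star A x \<in> carrier A"
    and star_star [simp]: "x \<in> carrier A \<Longrightarrow> star A (star A x) = x"
    and star_add: "x \<in> carrier A \<Longrightarrow> y \<in> carrier A \<Longrightarrow> star A (x \<oplus> y) = star A x \<oplus> star A y"
    and star_smult: "x \<in> carrier A \<Longrightarrow> star A (a \<odot> x) = cnj a \<odot> star A x"
    and star_mult: "x \<in> carrier A \<Longrightarrow> y \<in> carrier A \<Longrightarrow> star A (x \<otimes> y) = star A y \<otimes> star A x"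

definition cstar_seminorm :: "('a, 'm) star_alg_scheme \<Rightarrow> ('a \<Rightarrow> real) \<Rightarrow> bool" where
  "cstar_seminorm A \<nu> \<longleftrightarrow>
     (\<forall>x\<in>carrier A. 0 \<le> \<nu> x) \<and>
     (\<forall>x\<in>carrier A. \<forall>a. \<nu> (a \<odot>\<^bsub>A\<^esub> x) = cmod a * \<nu> x) \<and>
     (\<forall>x\<in>carrier A. \<forall>y\<in>carrier A. \<nu> (x \<oplus>\<^bsub>A\<^esub> y) \<le> \<nu> x + \<nu> y) \<and>
     (\<forall>x\<in>carrier A. \<forall>y\<in>carrier A. \<nu> (x \<otimes>\<^bsub>A\<^esub> y) \<le> \<nu> x * \<nu> y) \<and>
     (\<forall>x\<in>carrier A. \<nu> (star A x \<otimes>\<^bsub>A\<^esub> x) = (\<nu> x)\<^sup>2)"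

definition cauchy_in :: "('a, 'm) star_alg_scheme \<Rightarrow> ('a \<Rightarrow> real) \<Rightarrow> (nat \<Rightarrow> 'a) \<Rightarrow> bool" where
  "cauchy_in A \<nu> s \<longleftrightarrow> (\<forall>m. s m \<in> carrier A) \<and>
     (\<forall>e>0. \<exists>N. \<forall>m\<ge>N. \<forall>k\<ge>N. \<nu> (s m \<ominus>\<^bsub>A\<^esub> s k) < e)"

locale unital_cstar_algebra = star_algebra A for A :: "('a, 'm) cstar_alg_scheme" (structure) +
  assumes cstar_norm: "cstar_seminorm A (cnorm A)"
    and norm_definite: "x \<in> carrier A \<Longrightarrow> cnorm A x = 0 \<Longrightarrow> x = \<zero>"
    and complete: "cauchy_in A (cnorm A) s \<Longrightarrow>
      \<exists>x\<in>carrier A. (\<lambda>m. cnorm A (s m \<ominus> x)) \<longlonglongrightarrow> 0"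

definition unital_star_hom ::
    "('a, 'm) star_alg_scheme \<Rightarrow> ('b, 'k) star_alg_scheme \<Rightarrow> ('a \<Rightarrow> 'b) \<Rightarrow> bool" where
  "unital_star_hom A B h \<longleftrightarrow>
     h \<in> carrier A \<rightarrow> carrier B \<and> h \<one>\<^bsub>A\<^esub> = \<one>\<^bsub>B\<^esub> \<and>
     (\<forall>x\<in>carrier A. \<forall>y\<in>carrier A. h (x \<oplus>\<^bsub>A\<^esub> y) = h x \<oplus>\<^bsub>B\<^esub> h y) \<and>
     (\<forall>x\<in>carrier A. \<forall>y\<in>carrier A. h (x \<otimes>\<^bsub>A\<^esub> y) = h x \<otimes>\<^bsub>B\<^esub> h y) \<and>
     (\<forall>x\<in>carrier A. \<forall>a. h (a \<odot>\<^bsub>A\<^esub> x) = a \<odot>\<^bsub>B\<^esub> h x) \<and>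
     (\<forall>x\<in>carrier A. h (star A x) = star B (h x))"

text \<open>Separated completion of a *-algebra with respect to a C*-seminorm: Cauchy sequences modulo
  null sequences.\<close>

definition cauchy_class ::
    "('a, 'm) star_alg_scheme \<Rightarrow> ('a \<Rightarrow> real) \<Rightarrow> (nat \<Rightarrow> 'a) \<Rightarrow> (nat \<Rightarrow> 'a) set" where
  "cauchy_class A \<nu> s = {t. cauchy_in A \<nu> t \<and> (\<lambda>m. \<nu> (s m \<ominus>\<^bsub>A\<^esub> t m)) \<longlonglongrightarrow> 0}"

definition cstar_completion ::
    "('a, 'm) star_alg_scheme \<Rightarrow> ('a \<Rightarrow> real) \<Rightarrow> (nat \<Rightarrow> 'a) set cstar_alg" where
  "cstar_completion A \<nu> =
    \<lparr> carrier = cauchy_class A \<nu> ` {s. cauchy_in A \<nu> s},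
      mult = (\<lambda>S T. \<Union>s\<in>S. \<Union>t\<in>T. cauchy_class A \<nu> (\<lambda>m. s m \<otimes>\<^bsub>A\<^esub> t m)),
      one = cauchy_class A \<nu> (\<lambda>m. \<one>\<^bsub>A\<^esub>),
      zero = cauchy_class A \<nu> (\<lambda>m. \<zero>\<^bsub>A\<^esub>),
      add = (\<lambda>S T. \<Union>s\<in>S. \<Union>t\<in>T. cauchy_class A \<nu> (\<lambda>m. s m \<oplus>\<^bsub>A\<^esub> t m)),
      smult = (\<lambda>a S. \<Union>s\<in>S. cauchy_class A \<nu> (\<lambda>m. a \<odot>\<^bsub>A\<^esub> s m)),
      star = (\<lambda>S. \<Union>s\<in>S. cauchy_class A \<nu> (\<lambda>m. star A (s m))),
      cnorm = (\<lambda>S. THE r. \<forall>s\<in>S. (\<lambda>m. \<nu> (s m)) \<longlonglongrightarrow> r) \<rparr>"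


section \<open>Noncommutative polynomials\<close>

definition complex_alg :: "(complex, complex) module" where
  "complex_alg = \<lparr> carrier = UNIV, mult = (*), one = 1, zero = 0, add = (+), smult = (*) \<rparr>"

text \<open>\<open>nc_poly V C\<close> is the algebra of finitely supported \<open>C\<close>-valued functions on the words over \<open>V\<close>,
  with the variables commuting with the coefficients. For \<open>C\<close> the complex numbers this is the
  algebra of noncommutative polynomials in the variables \<open>V\<close>. As the words form a basis of the
  latter, its algebraic tensor product with \<open>C\<close> is \<open>nc_poly V C\<close>, the elementary tensor of \<open>p\<close> and
  \<open>c\<close> being the function \<open>w \<mapsto> p w \<cdot> c\<close>.\<close>

definition nc_poly :: "'v set \<Rightarrow> (complex, 'c, 'm) module_scheme \<Rightarrow> (complex, 'v list \<Rightarrow> 'c) module" where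
  "nc_poly V C =
    \<lparr> carrier = {f. (\<forall>w. f w \<in> carrier C) \<and> finite {w. f w \<noteq> \<zero>\<^bsub>C\<^esub>} \<and>
                    {w. f w \<noteq> \<zero>\<^bsub>C\<^esub>} \<subseteq> lists V},
      mult = (\<lambda>f g w. \<Oplus>\<^bsub>C\<^esub>k\<in>{..length w}. f (take k w) \<otimes>\<^bsub>C\<^esub> g (drop k w)),
      one = (\<lambda>w. if w = [] then \<one>\<^bsub>C\<^esub> else \<zero>\<^bsub>C\<^esub>),
      zero = (\<lambda>w. \<zero>\<^bsub>C\<^esub>),
      add = (\<lambda>f g w. f w \<oplus>\<^bsub>C\<^esub> g w),
      smult = (\<lambda>a f w. a \<odot>\<^bsub>C\<^esub> f w) \<rparr>"

abbreviation nc_polynomials :: "'v set \<Rightarrow> (complex, 'v list \<Rightarrow> complex) module" where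
  "nc_polynomials V \<equiv> nc_poly V complex_alg"

definition monomial :: "'v list \<Rightarrow> 'v list \<Rightarrow> complex" where
  "monomial v = (\<lambda>w. if w = v then 1 else 0)"

definition elem_tensor ::
    "(complex, 'c, 'm) module_scheme \<Rightarrow> ('v list \<Rightarrow> complex) \<Rightarrow> 'c \<Rightarrow> 'v list \<Rightarrow> 'c" where
  "elem_tensor C p c = (\<lambda>w. p w \<odot>\<^bsub>C\<^esub> c)"

definition tensor_id ::
    "(complex, 'c, 'm) module_scheme \<Rightarrow> (('v list \<Rightarrow> complex) \<Rightarrow> complex) \<Rightarrow> ('v list \<Rightarrow> 'c) \<Rightarrow> 'c" where
  "tensor_id C \<mu> f = (\<Oplus>\<^bsub>C\<^esub>w\<in>{w. f w \<noteq> \<zero>\<^bsub>C\<^esub>}. \<mu> (monomial w) \<odot>\<^bsub>C\<^esub> f w)"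

definition word_prod :: "(complex, 'a, 'm) module_scheme \<Rightarrow> ('v \<Rightarrow> 'a) \<Rightarrow> 'v list \<Rightarrow> 'a" where
  "word_prod A x w = foldr (\<lambda>v y. x v \<otimes>\<^bsub>A\<^esub> y) w \<one>\<^bsub>A\<^esub>"

definition poly_eval ::
    "(complex, 'a, 'm) module_scheme \<Rightarrow> ('v \<Rightarrow> 'a) \<Rightarrow> ('v list \<Rightarrow> complex) \<Rightarrow> 'a" where
  "poly_eval A x p = (\<Oplus>\<^bsub>A\<^esub>w\<in>{w. p w \<noteq> 0}. p w \<odot>\<^bsub>A\<^esub> word_prod A x w)"

definition joint_distribution ::
    "(complex, 'a, 'm) module_scheme \<Rightarrow> ('a \<Rightarrow> complex) \<Rightarrow> ('v \<Rightarrow> 'a) \<Rightarrow> ('v list \<Rightarrow> complex) \<Rightarrow> complex" where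
  "joint_distribution A \<phi> x p = \<phi> (poly_eval A x p)"


section \<open>Universal unital C*-algebras\<close>

text \<open>The free unital *-algebra on \<open>G\<close>: the letter \<open>(g, False)\<close> stands for the generator \<open>g\<close>, the
  letter \<open>(g, True)\<close> for its adjoint.\<close>

definition free_star :: "'g set \<Rightarrow> (('g \<times> bool) list \<Rightarrow> complex) star_alg" where
  "free_star G = module.extend (nc_polynomials (G \<times> UNIV))
     (star_alg.fields (\<lambda>p w. cnj (p (map (apsnd Not) (rev w)))))"

definition free_gen :: "'g \<Rightarrow> ('g \<times> bool) list \<Rightarrow> complex" where
  "free_gen g = monomial [(g, False)]"

text \<open>Relations are pairs of elements of the free *-algebra that are to become equal. The universal
  unital C*-algebra is the separated completion of the free *-algebra with respect to the largest
  C*-seminorm compatible with the relations; that seminorm is finite as soon as the relations bound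
  the norms of the generators, for instance if they force them to be projections. That this object is a
  unital C*-algebra with the universal property is proved in the locale \<open>bounded_presentation\<close>
  below.\<close>

type_synonym 'g relations = "((('g \<times> bool) list \<Rightarrow> complex) \<times> (('g \<times> bool) list \<Rightarrow> complex)) set"

definition compatible_seminorms ::
    "'g set \<Rightarrow> 'g relations \<Rightarrow> ((('g \<times> bool) list \<Rightarrow> complex) \<Rightarrow> real) set" where
  "compatible_seminorms G R =
     {\<rho>. cstar_seminorm (free_star G) \<rho> \<and> (\<forall>(l, r)\<in>R. \<rho> (l \<ominus>\<^bsub>free_star G\<^esub> r) = 0)}"

definition universal_seminorm ::
    "'g set \<Rightarrow> 'g relations \<Rightarrow> (('g \<times> bool) list \<Rightarrow> complex) \<Rightarrow> real" where
  "universal_seminorm G R p = (SUP \<rho>\<in>compatible_seminorms G R. \<rho> p)"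

definition universal_cstar ::
    "'g set \<Rightarrow> 'g relations \<Rightarrow> (nat \<Rightarrow> ('g \<times> bool) list \<Rightarrow> complex) set cstar_alg" where
  "universal_cstar G R = cstar_completion (free_star G) (universal_seminorm G R)"

definition universal_gen ::
    "'g set \<Rightarrow> 'g relations \<Rightarrow> 'g \<Rightarrow> (nat \<Rightarrow> ('g \<times> bool) list \<Rightarrow> complex) set" where
  "universal_gen G R g = cauchy_class (free_star G) (universal_seminorm G R) (\<lambda>m. free_gen g)"

definition projection_relations :: "'g set \<Rightarrow> 'g relations" where
  "projection_relations G =
     {(free_gen g \<otimes>\<^bsub>free_star G\<^esub> free_gen g, free_gen g) | g. g \<in> G} \<union>
     {(star (free_star G) (free_gen g), free_gen g) | g. g \<in> G}"


section \<open>Quantum families of permutations and increasing sequences\<close>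

datatype qgen = Ugen nat nat | Pgen

type_synonym qalg = "(nat \<Rightarrow> (qgen \<times> bool) list \<Rightarrow> complex) set"

abbreviation (input) fU :: "nat \<Rightarrow> nat \<Rightarrow> (qgen \<times> bool) list \<Rightarrow> complex" where
  "fU i j \<equiv> free_gen (Ugen i j)"

abbreviation (input) fP :: "(qgen \<times> bool) list \<Rightarrow> complex" where
  "fP \<equiv> free_gen Pgen"

definition A_s_gens :: "nat \<Rightarrow> qgen set" where
  "A_s_gens n = {Ugen i j | i j. i \<in> {1..n} \<and> j \<in> {1..n}}"

definition A_s_rels :: "nat \<Rightarrow> qgen relations" where
  "A_s_rels n = (let F = free_star (A_s_gens n) in
     projection_relations (A_s_gens n) \<union>
     {(fU i k \<otimes>\<^bsub>F\<^esub> fU i l, \<zero>\<^bsub>F\<^esub>) | i k l. i \<in> {1..n} \<and> k \<in> {1..n} \<and> l \<in> {1..n} \<and> k \<noteq> l} \<union>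
     {(fU k i \<otimes>\<^bsub>F\<^esub> fU l i, \<zero>\<^bsub>F\<^esub>) | i k l. i \<in> {1..n} \<and> k \<in> {1..n} \<and> l \<in> {1..n} \<and> k \<noteq> l} \<union>
     {(\<Oplus>\<^bsub>F\<^esub>k\<in>{1..n}. fU i k, \<one>\<^bsub>F\<^esub>) | i. i \<in> {1..n}} \<union>
     {(\<Oplus>\<^bsub>F\<^esub>k\<in>{1..n}. fU k i, \<one>\<^bsub>F\<^esub>) | i. i \<in> {1..n}})"

definition B_s_gens :: "nat \<Rightarrow> qgen set" where
  "B_s_gens n = insert Pgen {Ugen i j | i j. i \<in> {1..n} \<and> j \<in> {1..n}}"

definition B_s_rels :: "nat \<Rightarrow> qgen relations" where
  "B_s_rels n = (let F = free_star (B_s_gens n) in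
     projection_relations (B_s_gens n) \<union>
     {(fU i k \<otimes>\<^bsub>F\<^esub> fU i l, \<zero>\<^bsub>F\<^esub>) | i k l. i \<in> {1..n} \<and> k \<in> {1..n} \<and> l \<in> {1..n} \<and> k \<noteq> l} \<union>
     {(fU k i \<otimes>\<^bsub>F\<^esub> fU l i, \<zero>\<^bsub>F\<^esub>) | i k l. i \<in> {1..n} \<and> k \<in> {1..n} \<and> l \<in> {1..n} \<and> k \<noteq> l} \<union>
     {(\<Oplus>\<^bsub>F\<^esub>k\<in>{1..n}. fU k i \<otimes>\<^bsub>F\<^esub> fP, fP) | i. i \<in> {1..n}})"

definition A_i_gens :: "nat \<Rightarrow> nat \<Rightarrow> qgen set" where
  "A_i_gens n k = {Ugen i j | i j. i \<in> {1..n} \<and> j \<in> {1..k}}"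

definition A_i_rels :: "nat \<Rightarrow> nat \<Rightarrow> qgen relations" where
  "A_i_rels n k = (let F = free_star (A_i_gens n k) in
     projection_relations (A_i_gens n k) \<union>
     {(\<Oplus>\<^bsub>F\<^esub>i\<in>{1..n}. fU i j, \<one>\<^bsub>F\<^esub>) | j. j \<in> {1..k}} \<union>
     {(fU i j \<otimes>\<^bsub>F\<^esub> fU i' j', \<zero>\<^bsub>F\<^esub>) | i j i' j'. i \<in> {1..n} \<and> i' \<in> {1..n} \<and>
        j \<in> {1..k} \<and> j' \<in> {1..k} \<and> j < j' \<and> i' \<le> i})"

definition B_i_gens :: "nat \<Rightarrow> nat \<Rightarrow> qgen set" where
  "B_i_gens n k = insert Pgen {Ugen i j | i j. i \<in> {1..n} \<and> j \<in> {1..k}}"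

definition B_i_rels :: "nat \<Rightarrow> nat \<Rightarrow> qgen relations" where
  "B_i_rels n k = (let F = free_star (B_i_gens n k) in
     projection_relations (B_i_gens n k) \<union>
     {(\<Oplus>\<^bsub>F\<^esub>i\<in>{1..n}. fU i j \<otimes>\<^bsub>F\<^esub> fP, fP) | j. j \<in> {1..k}} \<union>
     {(fU i j \<otimes>\<^bsub>F\<^esub> fU i' j', \<zero>\<^bsub>F\<^esub>) | i j i' j'. i \<in> {1..n} \<and> i' \<in> {1..n} \<and>
        j \<in> {1..k} \<and> j' \<in> {1..k} \<and> j < j' \<and> i' \<le> i})"

definition A_s :: "nat \<Rightarrow> qalg cstar_alg" where
  "A_s n = universal_cstar (A_s_gens n) (A_s_rels n)"

definition B_s :: "nat \<Rightarrow> qalg cstar_alg" where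
  "B_s n = universal_cstar (B_s_gens n) (B_s_rels n)"

definition A_i :: "nat \<Rightarrow> nat \<Rightarrow> qalg cstar_alg" where
  "A_i n k = universal_cstar (A_i_gens n k) (A_i_rels n k)"

definition B_i :: "nat \<Rightarrow> nat \<Rightarrow> qalg cstar_alg" where
  "B_i n k = universal_cstar (B_i_gens n k) (B_i_rels n k)"

definition A_s_u :: "nat \<Rightarrow> nat \<Rightarrow> nat \<Rightarrow> qalg" where
  "A_s_u n i j = universal_gen (A_s_gens n) (A_s_rels n) (Ugen i j)"

definition B_s_u :: "nat \<Rightarrow> nat \<Rightarrow> nat \<Rightarrow> qalg" where
  "B_s_u n i j = universal_gen (B_s_gens n) (B_s_rels n) (Ugen i j)"

definition B_s_P :: "nat \<Rightarrow> qalg" where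
  "B_s_P n = universal_gen (B_s_gens n) (B_s_rels n) Pgen"

definition A_i_u :: "nat \<Rightarrow> nat \<Rightarrow> nat \<Rightarrow> nat \<Rightarrow> qalg" where
  "A_i_u n k i j = universal_gen (A_i_gens n k) (A_i_rels n k) (Ugen i j)"

definition B_i_u :: "nat \<Rightarrow> nat \<Rightarrow> nat \<Rightarrow> nat \<Rightarrow> qalg" where
  "B_i_u n k i j = universal_gen (B_i_gens n k) (B_i_rels n k) (Ugen i j)"

definition B_i_P :: "nat \<Rightarrow> nat \<Rightarrow> qalg" where
  "B_i_P n k = universal_gen (B_i_gens n k) (B_i_rels n k) Pgen"


section \<open>Exchangeability and spreadability\<close>

text \<open>The unital homomorphism \<open>\<alpha>\<close> with \<open>X\<^sub>j \<mapsto> \<Sum>\<^sub>i X\<^sub>i \<otimes> u i j\<close>.\<close>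

definition coaction ::
    "nat \<Rightarrow> (complex, 'c, 'm) module_scheme \<Rightarrow> (nat \<Rightarrow> nat \<Rightarrow> 'c) \<Rightarrow>
     (nat list \<Rightarrow> complex) \<Rightarrow> (nat list \<Rightarrow> 'c)" where
  "coaction n C u = poly_eval (nc_poly {1..n} C)
     (\<lambda>j. \<Oplus>\<^bsub>nc_poly {1..n} C\<^esub>i\<in>{1..n}. elem_tensor C (monomial [i]) (u i j))"

definition quantum_exchangeable ::
    "(complex, 'a, 'm) module_scheme \<Rightarrow> ('a \<Rightarrow> complex) \<Rightarrow> nat \<Rightarrow> (nat \<Rightarrow> 'a) \<Rightarrow> bool" where
  "quantum_exchangeable A \<phi> n x \<longleftrightarrow> (let \<mu> = joint_distribution A \<phi> x; C = A_s n in
     \<forall>p\<in>carrier (nc_polynomials {1..n}).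
       \<mu> p \<odot>\<^bsub>C\<^esub> \<one>\<^bsub>C\<^esub> = tensor_id C \<mu> (coaction n C (A_s_u n) p))"

definition quantum_spreadable ::
    "(complex, 'a, 'm) module_scheme \<Rightarrow> ('a \<Rightarrow> complex) \<Rightarrow> nat \<Rightarrow> (nat \<Rightarrow> 'a) \<Rightarrow> bool" where
  "quantum_spreadable A \<phi> n x \<longleftrightarrow> (let \<mu> = joint_distribution A \<phi> x in
     \<forall>k\<in>{1..<n}. let C = A_i n k in
     \<forall>p\<in>carrier (nc_polynomials {1..k}).
       \<mu> p \<odot>\<^bsub>C\<^esub> \<one>\<^bsub>C\<^esub> = tensor_id C \<mu> (coaction n C (A_i_u n k) p))"

definition boolean_exchangeable ::
    "(complex, 'a, 'm) module_scheme \<Rightarrow> ('a \<Rightarrow> complex) \<Rightarrow> nat \<Rightarrow> (nat \<Rightarrow> 'a) \<Rightarrow> bool" where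
  "boolean_exchangeable A \<phi> n x \<longleftrightarrow> (let \<mu> = joint_distribution A \<phi> x; C = B_s n; Q = B_s_P n in
     \<forall>p\<in>carrier (nc_polynomials {1..n}).
       \<mu> p \<odot>\<^bsub>C\<^esub> Q = Q \<otimes>\<^bsub>C\<^esub> tensor_id C \<mu> (coaction n C (B_s_u n) p) \<otimes>\<^bsub>C\<^esub> Q)"

definition boolean_spreadable ::
    "(complex, 'a, 'm) module_scheme \<Rightarrow> ('a \<Rightarrow> complex) \<Rightarrow> nat \<Rightarrow> (nat \<Rightarrow> 'a) \<Rightarrow> bool" where
  "boolean_spreadable A \<phi> n x \<longleftrightarrow> (let \<mu> = joint_distribution A \<phi> x in
     \<forall>k\<in>{1..<n}. let C = B_i n k; Q = B_i_P n k in
     \<forall>p\<in>carrier (nc_polynomials {1..k}).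
       \<mu> p \<odot>\<^bsub>C\<^esub> Q = Q \<otimes>\<^bsub>C\<^esub> tensor_id C \<mu> (coaction n C (B_i_u n k) p) \<otimes>\<^bsub>C\<^esub> Q)"


section \<open>Algebra structure of polynomials\<close>

lemma (in complex_algebra) smult_zero [simp]: "a \<odot> \<zero> = \<zero>"
  using smult_r_distr[of \<zero> \<zero> a] add.l_cancel_one'[of "a \<odot> \<zero>" "a \<odot> \<zero>"] by simp

lemma (in complex_algebra) zero_smult [simp]: "x \<in> carrier A \<Longrightarrow> 0 \<odot> x = \<zero>"
  using smult_l_distr[of x 0 0] add.l_cancel_one'[of "0 \<odot> x" "0 \<odot> x"] by simp

lemma (in complex_algebra) neg_smult: "x \<in> carrier A \<Longrightarrow> (-1) \<odot> x = \<ominus> x"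
  using smult_l_distr[of x "-1" 1] by (simp add: minus_equality)

lemma (in complex_algebra) finsum_smult:
  "finite I \<Longrightarrow> f \<in> I \<rightarrow> carrier A \<Longrightarrow> a \<odot> (\<Oplus>i\<in>I. f i) = (\<Oplus>i\<in>I. a \<odot> f i)"
  by (induct set: finite) (auto simp: Pi_def smult_r_distr)

lemma complex_alg_simps [simp]:
  "carrier complex_alg = UNIV" "mult complex_alg = (*)" "one complex_alg = 1"
  "zero complex_alg = 0" "add complex_alg = (+)" "smult complex_alg = (*)"
  by (simp_all add: complex_alg_def)

lemma complex_algebra_complex_alg: "complex_algebra complex_alg"
proof (unfold_locales)
  show "Units (add_monoid complex_alg) \<supseteq> carrier (add_monoid complex_alg)"
  proof
    fix x :: complex
    have "x + (-x) = 0" "(-x) + x = 0" by auto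
    then show "x \<in> Units (add_monoid complex_alg)"
      unfolding Units_def by (simp, metis)
  qed
qed (auto simp: algebra_simps)

lemma finsum_complex_alg [simp]: "finsum complex_alg f S = sum f S"
proof (cases "finite S")
  case True
  interpret complex_algebra complex_alg by (rule complex_algebra_complex_alg)
  show ?thesis using True by induct auto
next
  case False
  interpret complex_algebra complex_alg by (rule complex_algebra_complex_alg)
  show ?thesis using False by (simp add: finsum_infinite)
qed

context complex_algebra
begin

abbreviation conv :: "('v list \<Rightarrow> 'a) \<Rightarrow> ('v list \<Rightarrow> 'a) \<Rightarrow> 'v list \<Rightarrow> 'a" where
  "conv f g w \<equiv> \<Oplus>k\<in>{..length w}. f (take k w) \<otimes> g (drop k w)"

lemma conv_closed: "(\<And>w. f w \<in> carrier A) \<Longrightarrow> (\<And>w. g w \<in> carrier A) \<Longrightarrow> conv f g w \<in> carrier A"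
  by (auto intro!: finsum_closed)

lemma conv_Nil: "(\<And>w. f w \<in> carrier A) \<Longrightarrow> (\<And>w. g w \<in> carrier A) \<Longrightarrow> conv f g [] = f [] \<otimes> g []"
  by simp

lemma conv_Cons:
  assumes "\<And>w. f w \<in> carrier A" "\<And>w. g w \<in> carrier A"
  shows "conv f g (a # w) = f [] \<otimes> g (a # w) \<oplus> conv (\<lambda>w. f (a # w)) g w"
proof -
  have "conv f g (a # w) = conv (\<lambda>w. f (a # w)) g w \<oplus> f [] \<otimes> g (a # w)"
    using finsum_Suc2[of "\<lambda>k. f (take k (a#w)) \<otimes> g (drop k (a#w))" "length w"] assms by auto
  also have "\<dots> = f [] \<otimes> g (a # w) \<oplus> conv (\<lambda>w. f (a # w)) g w"
    using assms by (intro a_comm conv_closed) auto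
  finally show ?thesis .
qed

lemma conv_add_l:
  assumes "\<And>w. f w \<in> carrier A" "\<And>w. g w \<in> carrier A" "\<And>w. h w \<in> carrier A"
  shows "conv (\<lambda>w. f w \<oplus> g w) h w = conv f h w \<oplus> conv g h w"
  using assms by (simp add: l_distr finsum_addf Pi_def)

lemma conv_add_r:
  assumes "\<And>w. f w \<in> carrier A" "\<And>w. g w \<in> carrier A" "\<And>w. h w \<in> carrier A"
  shows "conv h (\<lambda>w. f w \<oplus> g w) w = conv h f w \<oplus> conv h g w"
  using assms by (simp add: r_distr finsum_addf Pi_def)

lemma conv_mult_l:
  assumes "\<And>w. f w \<in> carrier A" "\<And>w. g w \<in> carrier A" "a \<in> carrier A"
  shows "conv (\<lambda>w. a \<otimes> f w) g w = a \<otimes> conv f g w"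
  using assms by (simp add: finsum_rdistr m_assoc Pi_def)

lemma conv_smult_l:
  assumes "\<And>w. f w \<in> carrier A" "\<And>w. g w \<in> carrier A"
  shows "conv (\<lambda>w. a \<odot> f w) g w = a \<odot> conv f g w"
  using assms by (simp add: finsum_smult smult_mult_l Pi_def)

lemma conv_smult_r:
  assumes "\<And>w. f w \<in> carrier A" "\<And>w. g w \<in> carrier A"
  shows "conv f (\<lambda>w. a \<odot> g w) w = a \<odot> conv f g w"
  using assms by (simp add: finsum_smult smult_mult_r Pi_def)

lemma conv_assoc:
  assumes "\<And>w. f w \<in> carrier A" "\<And>w. g w \<in> carrier A" "\<And>w. h w \<in> carrier A"
  shows "conv (conv f g) h w = conv f (conv g h) w"
  using assms(1)
proof (induction w arbitrary: f)
  case Nil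
  then show ?case using assms(2,3) by (simp add: m_assoc)
next
  case (Cons a w)
  note c = Cons.prems assms(2,3)
  have "conv (conv f g) h (a # w) =
      conv f g [] \<otimes> h (a # w) \<oplus> conv (\<lambda>w. conv f g (a # w)) h w"
    using c by (intro conv_Cons conv_closed)
  also have "(\<lambda>w. conv f g (a # w)) = (\<lambda>w. f [] \<otimes> g (a # w) \<oplus> conv (\<lambda>w. f (a # w)) g w)"
    using c by (intro ext conv_Cons)
  also have "conv \<dots> h w = conv (\<lambda>w. f [] \<otimes> g (a # w)) h w \<oplus> conv (conv (\<lambda>w. f (a # w)) g) h w"
    using c by (intro conv_add_l conv_closed) auto
  also have "conv (conv (\<lambda>w. f (a # w)) g) h w = conv (\<lambda>w. f (a # w)) (conv g h) w"
    using c by (intro Cons.IH)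
  also have "conv (\<lambda>w. f [] \<otimes> g (a # w)) h w = f [] \<otimes> conv (\<lambda>w. g (a # w)) h w"
    using c by (intro conv_mult_l)
  also have "conv f g [] \<otimes> h (a # w) \<oplus> (f [] \<otimes> conv (\<lambda>w. g (a # w)) h w \<oplus> conv (\<lambda>w. f (a # w)) (conv g h) w)
     = f [] \<otimes> (g [] \<otimes> h (a # w) \<oplus> conv (\<lambda>w. g (a # w)) h w) \<oplus> conv (\<lambda>w. f (a # w)) (conv g h) w"
  proof -
    have *: "conv (\<lambda>w. g (a # w)) h w \<in> carrier A" "conv (\<lambda>w. f (a # w)) (conv g h) w \<in> carrier A"
      using c by (auto intro!: conv_closed)
    show ?thesis
      unfolding conv_Nil[OF c(1,2)] using c *
      by (simp add: r_distr m_assoc a_assoc)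
  qed
  also have "g [] \<otimes> h (a # w) \<oplus> conv (\<lambda>w. g (a # w)) h w = conv g h (a # w)"
    using c by (intro conv_Cons[symmetric])
  also have "f [] \<otimes> conv g h (a # w) \<oplus> conv (\<lambda>w. f (a # w)) (conv g h) w = conv f (conv g h) (a # w)"
    using c by (intro conv_Cons[symmetric] conv_closed)
  finally show ?case .
qed

lemma conv_support:
  assumes "\<And>w. f w \<in> carrier A" "\<And>w. g w \<in> carrier A"
  shows "{w. conv f g w \<noteq> \<zero>} \<subseteq> (\<lambda>(u, v). u @ v) ` ({w. f w \<noteq> \<zero>} \<times> {w. g w \<noteq> \<zero>})"
proof
  fix w assume w: "w \<in> {w. conv f g w \<noteq> \<zero>}"
  have "\<exists>k\<in>{..length w}. f (take k w) \<otimes> g (drop k w) \<noteq> \<zero>"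
  proof (rule ccontr)
    assume "\<not> ?thesis"
    then have "conv f g w = (\<Oplus>k\<in>{..length w}. \<zero>)"
      by (intro finsum_cong') auto
    then show False using w by (simp add: finsum_zero)
  qed
  then obtain k where "f (take k w) \<noteq> \<zero>" "g (drop k w) \<noteq> \<zero>"
    using assms by (metis l_null r_null)
  then show "w \<in> (\<lambda>(u, v). u @ v) ` ({w. f w \<noteq> \<zero>} \<times> {w. g w \<noteq> \<zero>})"
    by (intro image_eqI[of _ _ "(take k w, drop k w)"]) auto
qed

lemma conv_one_l:
  assumes "\<And>w. f w \<in> carrier A"
  shows "conv (\<lambda>w. if w = [] then \<one> else \<zero>) f w = f w"
proof (cases w)
  case Nil then show ?thesis using assms by simp
next
  case (Cons a v)
  have "conv (\<lambda>w. if w = [] then \<one> else \<zero>) f (a # v) =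
    (if [] = [] then \<one> else \<zero>) \<otimes> f (a # v) \<oplus> conv (\<lambda>w. if a # w = [] then \<one> else \<zero>) f v"
    using conv_Cons[of "\<lambda>w. if w = [] then \<one> else \<zero>" f a v] assms by auto
  also have "conv (\<lambda>w. if a # w = [] then \<one> else \<zero>) f v = \<zero>"
    using assms by (simp add: finsum_zero)
  finally show ?thesis using assms Cons by simp
qed

lemma conv_one_r:
  assumes "\<And>w. f w \<in> carrier A"
  shows "conv f (\<lambda>w. if w = [] then \<one> else \<zero>) w = f w"
  using assms
proof (induction w arbitrary: f)
  case Nil then show ?case by simp
next
  case (Cons a w)
  show ?case
    using conv_Cons[of f "\<lambda>w. if w = [] then \<one> else \<zero>" a w] Cons.IH[of "\<lambda>w. f (a # w)"] Cons.prems
    by auto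
qed

end

lemma nc_poly_simps:
  "carrier (nc_poly V C) = {f. (\<forall>w. f w \<in> carrier C) \<and> finite {w. f w \<noteq> \<zero>\<^bsub>C\<^esub>} \<and>
                    {w. f w \<noteq> \<zero>\<^bsub>C\<^esub>} \<subseteq> lists V}"
  "mult (nc_poly V C) = (\<lambda>f g w. \<Oplus>\<^bsub>C\<^esub>k\<in>{..length w}. f (take k w) \<otimes>\<^bsub>C\<^esub> g (drop k w))"
  "one (nc_poly V C) = (\<lambda>w. if w = [] then \<one>\<^bsub>C\<^esub> else \<zero>\<^bsub>C\<^esub>)"
  "zero (nc_poly V C) = (\<lambda>w. \<zero>\<^bsub>C\<^esub>)"
  "add (nc_poly V C) = (\<lambda>f g w. f w \<oplus>\<^bsub>C\<^esub> g w)"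
  "smult (nc_poly V C) = (\<lambda>a f w. a \<odot>\<^bsub>C\<^esub> f w)"
  by (simp_all add: nc_poly_def)

lemma complex_algebra_nc_poly:
  assumes "complex_algebra C"
  shows "complex_algebra (nc_poly V C)"
proof -
  interpret complex_algebra C by fact
  have sub: "f \<in> carrier (nc_poly V C)"
    if "\<And>w. f w \<in> carrier C" "{w. f w \<noteq> \<zero>\<^bsub>C\<^esub>} \<subseteq> S" "finite S" "S \<subseteq> lists V" for f S
    using that by (auto simp: nc_poly_simps intro: finite_subset)
  have c: "f w \<in> carrier C" if "f \<in> carrier (nc_poly V C)" for f w
    using that by (simp add: nc_poly_simps)
  have fin: "finite {w. f w \<noteq> \<zero>\<^bsub>C\<^esub>}" "{w. f w \<noteq> \<zero>\<^bsub>C\<^esub>} \<subseteq> lists V"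
    if "f \<in> carrier (nc_poly V C)" for f
    using that by (simp_all add: nc_poly_simps)
  have add: "f \<oplus>\<^bsub>nc_poly V C\<^esub> g \<in> carrier (nc_poly V C)"
    if "f \<in> carrier (nc_poly V C)" "g \<in> carrier (nc_poly V C)" for f g
    by (rule sub[of _ "{w. f w \<noteq> \<zero>\<^bsub>C\<^esub>} \<union> {w. g w \<noteq> \<zero>\<^bsub>C\<^esub>}"])
       (use fin[OF that(1)] fin[OF that(2)] c[OF that(1)] c[OF that(2)] in \<open>auto simp: nc_poly_simps(5)\<close>)
  have smult: "a \<odot>\<^bsub>nc_poly V C\<^esub> f \<in> carrier (nc_poly V C)" if "f \<in> carrier (nc_poly V C)" for a f
    by (rule sub[of _ "{w. f w \<noteq> \<zero>\<^bsub>C\<^esub>}"]) (use fin[OF that] c[OF that] in \<open>auto simp: nc_poly_simps(6)\<close>)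
  have mult: "f \<otimes>\<^bsub>nc_poly V C\<^esub> g \<in> carrier (nc_poly V C)"
    if "f \<in> carrier (nc_poly V C)" "g \<in> carrier (nc_poly V C)" for f g
  proof (rule sub)
    show "(f \<otimes>\<^bsub>nc_poly V C\<^esub> g) w \<in> carrier C" for w
      unfolding nc_poly_simps using that by (intro conv_closed c)
    show "{w. (f \<otimes>\<^bsub>nc_poly V C\<^esub> g) w \<noteq> \<zero>\<^bsub>C\<^esub>} \<subseteq> (\<lambda>(u, v). u @ v) ` ({w. f w \<noteq> \<zero>\<^bsub>C\<^esub>} \<times> {w. g w \<noteq> \<zero>\<^bsub>C\<^esub>})"
      unfolding nc_poly_simps using that by (intro conv_support c)
  qed (use fin[OF that(1)] fin[OF that(2)] in \<open>auto simp: subset_iff in_lists_conv_set\<close>)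
  show ?thesis
  proof (intro complex_algebra.intro complex_algebra_axioms.intro ringI abelian_groupI monoidI add mult smult)
    fix f assume f: "f \<in> carrier (nc_poly V C)"
    have "(-1) \<odot>\<^bsub>nc_poly V C\<^esub> f \<oplus>\<^bsub>nc_poly V C\<^esub> f = \<zero>\<^bsub>nc_poly V C\<^esub>"
      using c[OF f] by (auto simp: nc_poly_simps neg_smult l_neg)
    then show "\<exists>g\<in>carrier (nc_poly V C). g \<oplus>\<^bsub>nc_poly V C\<^esub> f = \<zero>\<^bsub>nc_poly V C\<^esub>"
      using smult[OF f] by blast
  next
    fix f g h assume "f \<in> carrier (nc_poly V C)" "g \<in> carrier (nc_poly V C)" "h \<in> carrier (nc_poly V C)"
    then show "f \<otimes>\<^bsub>nc_poly V C\<^esub> g \<otimes>\<^bsub>nc_poly V C\<^esub> h = f \<otimes>\<^bsub>nc_poly V C\<^esub> (g \<otimes>\<^bsub>nc_poly V C\<^esub> h)"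
      unfolding nc_poly_simps(2-) by (intro ext conv_assoc c)
  next
    fix f assume f: "f \<in> carrier (nc_poly V C)"
    from f show "\<one>\<^bsub>nc_poly V C\<^esub> \<otimes>\<^bsub>nc_poly V C\<^esub> f = f"
      unfolding nc_poly_simps(2-) by (intro ext conv_one_l c)
    show "f \<otimes>\<^bsub>nc_poly V C\<^esub> \<one>\<^bsub>nc_poly V C\<^esub> = f"
      unfolding nc_poly_simps(2-) using f by (intro ext conv_one_r c)
  next
    fix f g h assume "f \<in> carrier (nc_poly V C)" "g \<in> carrier (nc_poly V C)" "h \<in> carrier (nc_poly V C)"
    note c' = this[THEN c]
    show "(f \<oplus>\<^bsub>nc_poly V C\<^esub> g) \<otimes>\<^bsub>nc_poly V C\<^esub> h = f \<otimes>\<^bsub>nc_poly V C\<^esub> h \<oplus>\<^bsub>nc_poly V C\<^esub> g \<otimes>\<^bsub>nc_poly V C\<^esub> h"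
      unfolding nc_poly_simps(2-) by (intro ext conv_add_l c')
    show "h \<otimes>\<^bsub>nc_poly V C\<^esub> (f \<oplus>\<^bsub>nc_poly V C\<^esub> g) = h \<otimes>\<^bsub>nc_poly V C\<^esub> f \<oplus>\<^bsub>nc_poly V C\<^esub> h \<otimes>\<^bsub>nc_poly V C\<^esub> g"
      unfolding nc_poly_simps(2-) by (intro ext conv_add_r c')
  next
    fix f g a assume "f \<in> carrier (nc_poly V C)" "g \<in> carrier (nc_poly V C)"
    note c' = this[THEN c]
    show "(a \<odot>\<^bsub>nc_poly V C\<^esub> f) \<otimes>\<^bsub>nc_poly V C\<^esub> g = a \<odot>\<^bsub>nc_poly V C\<^esub> (f \<otimes>\<^bsub>nc_poly V C\<^esub> g)"
      unfolding nc_poly_simps(2-) by (intro ext conv_smult_l c')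
    show "f \<otimes>\<^bsub>nc_poly V C\<^esub> (a \<odot>\<^bsub>nc_poly V C\<^esub> g) = a \<odot>\<^bsub>nc_poly V C\<^esub> (f \<otimes>\<^bsub>nc_poly V C\<^esub> g)"
      unfolding nc_poly_simps(2-) by (intro ext conv_smult_r c')
  next
    show "\<zero>\<^bsub>nc_poly V C\<^esub> \<in> carrier (nc_poly V C)" "\<one>\<^bsub>nc_poly V C\<^esub> \<in> carrier (nc_poly V C)"
      by (auto simp: nc_poly_simps)
  next
    fix f g h assume "f \<in> carrier (nc_poly V C)" "g \<in> carrier (nc_poly V C)" "h \<in> carrier (nc_poly V C)"
    then show "f \<oplus>\<^bsub>nc_poly V C\<^esub> g \<oplus>\<^bsub>nc_poly V C\<^esub> h = f \<oplus>\<^bsub>nc_poly V C\<^esub> (g \<oplus>\<^bsub>nc_poly V C\<^esub> h)"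
      by (simp add: nc_poly_simps(5) a_assoc c)
  next
    fix f g a assume "f \<in> carrier (nc_poly V C)" "g \<in> carrier (nc_poly V C)"
    then show "f \<oplus>\<^bsub>nc_poly V C\<^esub> g = g \<oplus>\<^bsub>nc_poly V C\<^esub> f"
      "a \<odot>\<^bsub>nc_poly V C\<^esub> (f \<oplus>\<^bsub>nc_poly V C\<^esub> g) = a \<odot>\<^bsub>nc_poly V C\<^esub> f \<oplus>\<^bsub>nc_poly V C\<^esub> a \<odot>\<^bsub>nc_poly V C\<^esub> g"
      by (simp_all add: nc_poly_simps(5,6) a_comm smult_r_distr c)
  next
    fix f a b assume "f \<in> carrier (nc_poly V C)"
    then show "\<zero>\<^bsub>nc_poly V C\<^esub> \<oplus>\<^bsub>nc_poly V C\<^esub> f = f" "1 \<odot>\<^bsub>nc_poly V C\<^esub> f = f"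
      "(a + b) \<odot>\<^bsub>nc_poly V C\<^esub> f = a \<odot>\<^bsub>nc_poly V C\<^esub> f \<oplus>\<^bsub>nc_poly V C\<^esub> b \<odot>\<^bsub>nc_poly V C\<^esub> f"
      "(a * b) \<odot>\<^bsub>nc_poly V C\<^esub> f = a \<odot>\<^bsub>nc_poly V C\<^esub> (b \<odot>\<^bsub>nc_poly V C\<^esub> f)"
      by (simp_all add: nc_poly_simps(4,5,6) smult_l_distr smult_assoc c)
  qed
qed

lemma complex_algebra_cong:
  assumes "complex_algebra A" "carrier B = carrier A" "mult B = mult A" "one B = one A"
    "zero B = zero A" "add B = add A" "smult B = smult A"
  shows "complex_algebra B"
  using assms(1)
  unfolding complex_algebra_def ring_def abelian_group_def abelian_monoid_def
    abelian_group_axioms_def monoid_def ring_axioms_def complex_algebra_axioms_def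
    comm_group_def comm_monoid_def group_def comm_monoid_axioms_def group_axioms_def Units_def
    partial_object.simps monoid.simps assms(2-) .

lemma free_star_simps:
  "carrier (free_star G) = carrier (nc_polynomials (G \<times> UNIV))"
  "mult (free_star G) = mult (nc_polynomials (G \<times> UNIV))"
  "one (free_star G) = one (nc_polynomials (G \<times> UNIV))"
  "zero (free_star G) = zero (nc_polynomials (G \<times> UNIV))"
  "add (free_star G) = add (nc_polynomials (G \<times> UNIV))"
  "smult (free_star G) = smult (nc_polynomials (G \<times> UNIV))"
  "star (free_star G) = (\<lambda>p w. cnj (p (map (apsnd Not) (rev w))))"
  by (simp_all add: free_star_def module.defs star_alg.defs)

lemma apsnd_Not_twice: "map (apsnd Not) (map (apsnd Not) w) = w"
  by (induction w) auto

lemma star_algebra_free_star: "star_algebra (free_star G)"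
proof (intro star_algebra.intro star_algebra_axioms.intro)
  show "complex_algebra (free_star G)"
    by (rule complex_algebra_cong[OF complex_algebra_nc_poly[OF complex_algebra_complex_alg]])
       (simp_all add: free_star_simps)
next
  fix p assume p: "p \<in> carrier (free_star G)"
  let ?r = "\<lambda>w. map (apsnd Not) (rev w) :: ('a \<times> bool) list"
  have "{w. star (free_star G) p w \<noteq> 0} \<subseteq> ?r ` {w. p w \<noteq> 0}"
  proof
    fix w assume "w \<in> {w. star (free_star G) p w \<noteq> 0}"
    then have "?r w \<in> {w. p w \<noteq> 0}" by (simp add: free_star_simps)
    moreover have "w = ?r (?r w)"
      by (simp add: rev_map[symmetric] apsnd_Not_twice del: map_map)
    ultimately show "w \<in> ?r ` {w. p w \<noteq> 0}" by blast
  qed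
  moreover have "finite (?r ` {w. p w \<noteq> 0})" "?r ` {w. p w \<noteq> 0} \<subseteq> lists (G \<times> UNIV)"
    using p by (auto simp: free_star_simps nc_poly_simps in_lists_conv_set subset_iff) blast
  ultimately show "star (free_star G) p \<in> carrier (free_star G)"
    by (auto simp: free_star_simps(1) nc_poly_simps intro: finite_subset)
next
  fix p q assume "p \<in> carrier (free_star G)" "q \<in> carrier (free_star G)"
  show "star (free_star G) (p \<otimes>\<^bsub>free_star G\<^esub> q) =
      star (free_star G) q \<otimes>\<^bsub>free_star G\<^esub> star (free_star G) p"
  proof
    fix w
    show "star (free_star G) (p \<otimes>\<^bsub>free_star G\<^esub> q) w =
      (star (free_star G) q \<otimes>\<^bsub>free_star G\<^esub> star (free_star G) p) w"
      unfolding free_star_simps nc_poly_simps complex_alg_simps finsum_complex_alg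
        complex_cnj_cnj cnj_sum complex_cnj_mult
      by (rule sum.reindex_bij_witness[of _ "\<lambda>k. length w - k" "\<lambda>k. length w - k"])
         (auto simp: rev_take rev_drop take_map drop_map mult.commute)
  qed
next
  fix p :: "('a \<times> bool) list \<Rightarrow> complex"
  show "star (free_star G) (star (free_star G) p) = p"
    by (simp add: free_star_simps rev_map[symmetric] del: map_map) (simp add: apsnd_Not_twice del: map_map)
qed (auto simp: free_star_simps nc_poly_simps)

lemma nc_polynomial_induct [consumes 1, case_names zero add]:
  assumes "p \<in> carrier (nc_polynomials V)"
    and z: "Q (\<lambda>w. 0)"
    and a: "\<And>a v p. v \<in> lists V \<Longrightarrow> p \<in> carrier (nc_polynomials V) \<Longrightarrow> Q p \<Longrightarrow> Q (\<lambda>w. a * monomial v w + p w)"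
  shows "Q p"
proof -
  have "Q p" if "finite S" "{w. p w \<noteq> 0} \<subseteq> S" "S \<subseteq> lists V" for S p
    using that
  proof (induction S arbitrary: p)
    case empty
    then have "p = (\<lambda>w. 0)" by auto
    then show ?case using z by simp
  next
    case (insert v S)
    define q where "q = p(v := 0)"
    have q: "{w. q w \<noteq> 0} \<subseteq> S" using insert.prems by (auto simp: q_def)
    then have "q \<in> carrier (nc_polynomials V)" "Q q"
      using insert by (auto simp: nc_poly_simps intro: finite_subset)
    then have "Q (\<lambda>w. p v * monomial v w + q w)" using insert.prems by (intro a) auto
    moreover have "(\<lambda>w. p v * monomial v w + q w) = p"
      by (auto simp: q_def monomial_def)
    ultimately show ?case by simp
  qed
  then show ?thesis using assms(1) by (auto simp: nc_poly_simps)
qed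

lemma monomial_closed: "v \<in> lists V \<Longrightarrow> monomial v \<in> carrier (nc_polynomials V)"
  by (auto simp: nc_poly_simps monomial_def)

lemma monomial_mult: "monomial u \<otimes>\<^bsub>nc_polynomials V\<^esub> monomial v = monomial (u @ v)"
proof
  fix w
  have "(monomial u \<otimes>\<^bsub>nc_polynomials V\<^esub> monomial v) w =
    (\<Sum>k\<le>length w. if k = length u then (if w = u @ v then 1 else 0) else 0)"
    unfolding nc_poly_simps complex_alg_simps finsum_complex_alg
  proof (rule sum.cong[OF refl])
    fix k assume "k \<in> {..length w}"
    then have l: "length (take k w) = k" by simp
    have "take k w = u \<and> drop k w = v \<longleftrightarrow> k = length u \<and> w = u @ v"
    proof
      assume e: "take k w = u \<and> drop k w = v"
      with l have "k = length u" by metis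
      with e show "k = length u \<and> w = u @ v" by (metis append_take_drop_id)
    qed simp
    moreover have "monomial u (take k w) * monomial v (drop k w) =
      (if take k w = u \<and> drop k w = v then 1 else 0)"
      by (simp add: monomial_def)
    ultimately show "monomial u (take k w) * monomial v (drop k w) =
      (if k = length u then (if w = u @ v then 1 else 0) else 0)"
      by simp
  qed
  also have "\<dots> = monomial (u @ v) w"
    by (auto simp: monomial_def)
  finally show "(monomial u \<otimes>\<^bsub>nc_polynomials V\<^esub> monomial v) w = monomial (u @ v) w" .
qed

lemma nc_polynomials_add: "p \<oplus>\<^bsub>nc_polynomials V\<^esub> q = (\<lambda>w. p w + q w)"
  by (simp add: nc_poly_simps)

lemma nc_polynomials_smult: "a \<odot>\<^bsub>nc_polynomials V\<^esub> q = (\<lambda>w. a * q w)"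
  by (simp add: nc_poly_simps)

context complex_algebra
begin

context
  fixes V :: "'v set" and x
  assumes x: "x \<in> V \<rightarrow> carrier A"
begin

lemma word_prod_closed: "w \<in> lists V \<Longrightarrow> word_prod A x w \<in> carrier A"
  using x by (induction w) (auto simp: word_prod_def)

lemma word_prod_append:
  "u \<in> lists V \<Longrightarrow> v \<in> lists V \<Longrightarrow> word_prod A x (u @ v) = word_prod A x u \<otimes> word_prod A x v"
proof (induction u)
  case Nil
  then show ?case using word_prod_closed[of v] by (simp add: word_prod_def[of _ _ "[]"])
next
  case (Cons a u)
  then have "x a \<in> carrier A" "word_prod A x u \<in> carrier A" "word_prod A x v \<in> carrier A"
    "word_prod A x (u @ v) = word_prod A x u \<otimes> word_prod A x v"
    using word_prod_closed[of u] word_prod_closed[of v] x by auto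
  then show ?case
    using m_assoc by (simp add: word_prod_def[of A x "_ # _"] flip: word_prod_def)
qed

lemma poly_eval_superset:
  assumes "finite S" "{w. p w \<noteq> 0} \<subseteq> S" "S \<subseteq> lists V"
  shows "poly_eval A x p = (\<Oplus>w\<in>S. p w \<odot> word_prod A x w)"
  unfolding poly_eval_def
proof (rule add.finprod_mono_neutral_cong_left)
  have c: "w \<in> S \<Longrightarrow> word_prod A x w \<in> carrier A" for w using assms(3) word_prod_closed by blast
  show "w \<in> S - {w. p w \<noteq> 0} \<Longrightarrow> p w \<odot> word_prod A x w = \<zero>" for w using c[of w] by simp
  show "(\<lambda>w. p w \<odot> word_prod A x w) \<in> S \<rightarrow> carrier A" using c by simp
qed (use assms in auto)

lemma poly_eval_closed: "p \<in> carrier (nc_polynomials V) \<Longrightarrow> poly_eval A x p \<in> carrier A"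
  unfolding poly_eval_def
  by (rule finsum_closed) (auto simp: nc_poly_simps intro!: word_prod_closed smult_closed)

lemma poly_eval_add:
  assumes p: "p \<in> carrier (nc_polynomials V)" and q: "q \<in> carrier (nc_polynomials V)"
  shows "poly_eval A x (p \<oplus>\<^bsub>nc_polynomials V\<^esub> q) = poly_eval A x p \<oplus> poly_eval A x q"
proof -
  let ?S = "{w. p w \<noteq> 0} \<union> {w. q w \<noteq> 0}"
  have S: "finite ?S" "?S \<subseteq> lists V" using p q by (auto simp: nc_poly_simps)
  have c: "word_prod A x w \<in> carrier A" if "w \<in> ?S" for w
    using word_prod_closed S(2) that by blast
  have "poly_eval A x (p \<oplus>\<^bsub>nc_polynomials V\<^esub> q) = (\<Oplus>w\<in>?S. (p w + q w) \<odot> word_prod A x w)"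
    using S by (subst poly_eval_superset[of ?S]) (auto simp: nc_polynomials_add)
  also have "\<dots> = (\<Oplus>w\<in>?S. p w \<odot> word_prod A x w \<oplus> q w \<odot> word_prod A x w)"
    using c by (intro finsum_cong') (auto simp: smult_l_distr)
  also have "\<dots> = (\<Oplus>w\<in>?S. p w \<odot> word_prod A x w) \<oplus> (\<Oplus>w\<in>?S. q w \<odot> word_prod A x w)"
    using c by (intro finsum_addf) auto
  also have "\<dots> = poly_eval A x p \<oplus> poly_eval A x q"
    using S by (subst (1 2) poly_eval_superset[of ?S]) auto
  finally show ?thesis .
qed

lemma poly_eval_smult:
  assumes p: "p \<in> carrier (nc_polynomials V)"
  shows "poly_eval A x (a \<odot>\<^bsub>nc_polynomials V\<^esub> p) = a \<odot> poly_eval A x p"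
proof -
  let ?S = "{w. p w \<noteq> 0}"
  have S: "finite ?S" "?S \<subseteq> lists V" using p by (auto simp: nc_poly_simps)
  have c: "word_prod A x w \<in> carrier A" if "w \<in> ?S" for w
    using word_prod_closed S(2) that by blast
  have "poly_eval A x (a \<odot>\<^bsub>nc_polynomials V\<^esub> p) = (\<Oplus>w\<in>?S. (a * p w) \<odot> word_prod A x w)"
    using S by (subst poly_eval_superset[of ?S]) (auto simp: nc_polynomials_smult)
  also have "\<dots> = (\<Oplus>w\<in>?S. a \<odot> (p w \<odot> word_prod A x w))"
    using c by (intro finsum_cong') (auto simp: smult_assoc)
  also have "\<dots> = a \<odot> poly_eval A x p"
    unfolding poly_eval_def using S c by (intro finsum_smult[symmetric]) auto
  finally show ?thesis .
qed

lemma poly_eval_zero: "poly_eval A x (\<lambda>w. 0) = \<zero>"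
  by (simp add: poly_eval_def)

lemma poly_eval_monomial: "v \<in> lists V \<Longrightarrow> poly_eval A x (monomial v) = word_prod A x v"
  using word_prod_closed[of v] by (subst poly_eval_superset[of "{v}"]) (auto simp: monomial_def)

lemma poly_eval_mult:
  assumes p: "p \<in> carrier (nc_polynomials V)" and q: "q \<in> carrier (nc_polynomials V)"
  shows "poly_eval A x (p \<otimes>\<^bsub>nc_polynomials V\<^esub> q) = poly_eval A x p \<otimes> poly_eval A x q"
proof -
  interpret N: complex_algebra "nc_polynomials V"
    by (rule complex_algebra_nc_poly[OF complex_algebra_complex_alg])
  have *: "poly_eval A x (monomial u \<otimes>\<^bsub>nc_polynomials V\<^esub> q) = word_prod A x u \<otimes> poly_eval A x q"
    if "u \<in> lists V" for u
    using q
  proof (induction rule: nc_polynomial_induct)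
    case zero
    have "monomial u \<otimes>\<^bsub>nc_polynomials V\<^esub> \<zero>\<^bsub>nc_polynomials V\<^esub> = \<zero>\<^bsub>nc_polynomials V\<^esub>"
      using monomial_closed[OF that] by simp
    then show ?case using word_prod_closed[OF that] by (simp add: nc_poly_simps(4) poly_eval_zero)
  next
    case (add a v p)
    note c = monomial_closed[OF that] monomial_closed[OF add(1)] add(2) monomial_closed[of "u @ v" V]
      word_prod_closed[OF that] word_prod_closed[OF add(1)] poly_eval_closed[OF add(2)]
    have e: "(\<lambda>w. a * monomial v w + p w) =
        a \<odot>\<^bsub>nc_polynomials V\<^esub> monomial v \<oplus>\<^bsub>nc_polynomials V\<^esub> p"
      by (simp add: nc_poly_simps)
    show ?case unfolding e using c that add
      by (simp add: N.r_distr N.smult_mult_r monomial_mult poly_eval_add poly_eval_smult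
          poly_eval_monomial word_prod_append r_distr smult_mult_r)
  qed
  show ?thesis using p
  proof (induction rule: nc_polynomial_induct)
    case zero
    have "\<zero>\<^bsub>nc_polynomials V\<^esub> \<otimes>\<^bsub>nc_polynomials V\<^esub> q = \<zero>\<^bsub>nc_polynomials V\<^esub>"
      using q by simp
    then show ?case using poly_eval_closed[OF q] by (simp add: nc_poly_simps(4) poly_eval_zero)
  next
    case (add a v p)
    note c = q monomial_closed[OF add(1)] add(2) poly_eval_closed[OF q]
      word_prod_closed[OF add(1)] poly_eval_closed[OF add(2)]
    have e: "(\<lambda>w. a * monomial v w + p w) =
        a \<odot>\<^bsub>nc_polynomials V\<^esub> monomial v \<oplus>\<^bsub>nc_polynomials V\<^esub> p"
      by (simp add: nc_poly_simps)
    show ?case unfolding e using c add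
      by (simp add: N.l_distr N.smult_mult_l * poly_eval_add poly_eval_smult
          poly_eval_monomial l_distr smult_mult_l)
  qed
qed

end

end


section \<open>Completion with respect to a C*-seminorm\<close>

locale seminormed_star_algebra = star_algebra A for A :: "('a, 'm) star_alg_scheme" (structure) +
  fixes \<nu> :: "'a \<Rightarrow> real"
  assumes seminorm: "cstar_seminorm A \<nu>"
begin

lemma sn_nonneg [simp]: "x \<in> carrier A \<Longrightarrow> 0 \<le> \<nu> x"
  and sn_smult: "x \<in> carrier A \<Longrightarrow> \<nu> (a \<odot> x) = cmod a * \<nu> x"
  and sn_add: "x \<in> carrier A \<Longrightarrow> y \<in> carrier A \<Longrightarrow> \<nu> (x \<oplus> y) \<le> \<nu> x + \<nu> y"
  and sn_mult: "x \<in> carrier A \<Longrightarrow> y \<in> carrier A \<Longrightarrow> \<nu> (x \<otimes> y) \<le> \<nu> x * \<nu> y"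
  and sn_cstar: "x \<in> carrier A \<Longrightarrow> \<nu> (star A x \<otimes> x) = (\<nu> x)\<^sup>2"
  using seminorm by (auto simp: cstar_seminorm_def)

lemma sn_zero [simp]: "\<nu> \<zero> = 0"
  using sn_smult[of \<zero> 0] by simp

lemma sn_neg [simp]: "x \<in> carrier A \<Longrightarrow> \<nu> (\<ominus> x) = \<nu> x"
  using sn_smult[of x "-1"] by (simp add: neg_smult)

lemma sn_self [simp]: "x \<in> carrier A \<Longrightarrow> \<nu> (x \<ominus> x) = 0"
  by (simp add: a_minus_def r_neg)

lemma minus_swap: "x \<in> carrier A \<Longrightarrow> y \<in> carrier A \<Longrightarrow> \<ominus> (x \<ominus> y) = y \<ominus> x"
  by (simp add: a_minus_def minus_add a_comm)

lemma sn_minus_commute: "x \<in> carrier A \<Longrightarrow> y \<in> carrier A \<Longrightarrow> \<nu> (x \<ominus> y) = \<nu> (y \<ominus> x)"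
  using sn_neg[of "x \<ominus> y"] by (simp add: minus_swap)

lemma sn_triangle:
  assumes "x \<in> carrier A" "y \<in> carrier A" "z \<in> carrier A"
  shows "\<nu> (x \<ominus> z) \<le> \<nu> (x \<ominus> y) + \<nu> (y \<ominus> z)"
proof -
  have "x \<ominus> z = (x \<ominus> y) \<oplus> (y \<ominus> z)"
    using assms by (simp add: a_minus_def a_assoc) (simp add: a_assoc[symmetric] l_neg)
  then show ?thesis using sn_add[of "x \<ominus> y" "y \<ominus> z"] assms by simp
qed

lemma sn_reverse_triangle:
  assumes "x \<in> carrier A" "y \<in> carrier A"
  shows "\<bar>\<nu> x - \<nu> y\<bar> \<le> \<nu> (x \<ominus> y)"
proof -
  have "z \<ominus> \<zero> = z" if "z \<in> carrier A" for z using that by (simp add: a_minus_def)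
  then show ?thesis
    using sn_triangle[of x y \<zero>] sn_triangle[of y x \<zero>] sn_minus_commute[of x y] assms by auto
qed

lemma sn_star [simp]:
  assumes "x \<in> carrier A"
  shows "\<nu> (star A x) = \<nu> x"
proof -
  have *: "\<nu> y \<le> \<nu> (star A y)" if "y \<in> carrier A" for y
  proof (cases "\<nu> y = 0")
    case False
    have "\<nu> y * \<nu> y \<le> \<nu> (star A y) * \<nu> y"
      using sn_cstar[OF that] sn_mult[of "star A y" y] that by (simp add: power2_eq_square)
    then show ?thesis using False sn_nonneg[OF that] by (simp add: mult_le_cancel_right)
  qed (use that in simp)
  show ?thesis using *[of x] *[of "star A x"] assms by simp
qed

lemma star_minus:
  assumes "x \<in> carrier A" "y \<in> carrier A"
  shows "star A (x \<ominus> y) = star A x \<ominus> star A y"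
  using assms star_smult[of y "-1"] by (simp add: a_minus_def star_add neg_smult)

lemma smult_minus:
  assumes "x \<in> carrier A" "y \<in> carrier A"
  shows "a \<odot> (x \<ominus> y) = a \<odot> x \<ominus> a \<odot> y"
  using assms smult_assoc[of y a "-1"] smult_assoc[of y "-1" a]
  by (simp add: a_minus_def smult_r_distr neg_smult flip: neg_smult)

lemma add_diff:
  assumes "x \<in> carrier A" "y \<in> carrier A" "x' \<in> carrier A" "y' \<in> carrier A"
  shows "(x \<oplus> y) \<ominus> (x' \<oplus> y') = (x \<ominus> x') \<oplus> (y \<ominus> y')"
  using assms by (simp add: a_minus_def minus_add a_ac)

lemma mult_diff:
  assumes "x \<in> carrier A" "y \<in> carrier A" "x' \<in> carrier A" "y' \<in> carrier A"
  shows "(x \<otimes> y) \<ominus> (x' \<otimes> y') = (x \<ominus> x') \<otimes> y \<oplus> x' \<otimes> (y \<ominus> y')"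
proof -
  have "(x \<ominus> x') \<otimes> y \<oplus> x' \<otimes> (y \<ominus> y') = x \<otimes> y \<oplus> ((\<ominus> (x' \<otimes> y) \<oplus> x' \<otimes> y) \<oplus> \<ominus> (x' \<otimes> y'))"
    using assms by (simp add: a_minus_def l_distr r_distr l_minus r_minus a_assoc)
  also have "\<dots> = (x \<otimes> y) \<ominus> (x' \<otimes> y')"
    using assms by (simp add: l_neg a_minus_def)
  finally show ?thesis ..
qed

abbreviation "cau \<equiv> cauchy_in A \<nu>"
abbreviation "cl \<equiv> cauchy_class A \<nu>"
abbreviation "Cm \<equiv> cstar_completion A \<nu>"
abbreviation eqv (infix "\<approx>" 50) where "s \<approx> t \<equiv> (\<lambda>m::nat. \<nu> (s m \<ominus> t m)) \<longlonglongrightarrow> 0"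

lemma cauD: "cau s \<Longrightarrow> s m \<in> carrier A"
  by (simp add: cauchy_in_def)

lemma cauE: "cau s \<Longrightarrow> e > 0 \<Longrightarrow> \<exists>N. \<forall>m\<ge>N. \<forall>k\<ge>N. \<nu> (s m \<ominus> s k) < e"
  by (simp add: cauchy_in_def)

lemma eqvI:
  assumes "f \<longlonglongrightarrow> 0" "\<And>m. \<nu> (s m \<ominus> t m) \<le> f m" "\<And>m. s m \<in> carrier A" "\<And>m. t m \<in> carrier A"
  shows "s \<approx> t"
  by (rule tendsto_sandwich[OF _ _ tendsto_const assms(1)]) (use assms in \<open>auto intro!: always_eventually\<close>)

lemma eqv_sym: "cau s \<Longrightarrow> cau t \<Longrightarrow> s \<approx> t \<Longrightarrow> t \<approx> s"
  by (simp add: sn_minus_commute cauD)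

lemma eqv_trans:
  assumes "cau r" "cau s" "cau t" "r \<approx> s" "s \<approx> t"
  shows "r \<approx> t"
  by (rule eqvI[OF tendsto_add[OF assms(4,5), simplified]])
     (use assms(1-3) in \<open>auto intro!: sn_triangle simp: cauD\<close>)

lemma cl_eq_iff: "cau s \<Longrightarrow> cau t \<Longrightarrow> cl s = cl t \<longleftrightarrow> s \<approx> t"
proof
  assume st: "cau s" "cau t" "cl s = cl t"
  have "t \<in> cl t" using st by (simp add: cauchy_class_def cauD)
  then show "s \<approx> t" using st(3) by (auto simp: cauchy_class_def)
next
  assume st: "cau s" "cau t" "s \<approx> t"
  show "cl s = cl t"
    unfolding cauchy_class_def using st eqv_trans eqv_sym by blast
qed

lemma cl_memD: "t \<in> cl s \<Longrightarrow> cau t \<and> s \<approx> t"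
  by (simp add: cauchy_class_def)

lemma cl_self: "cau s \<Longrightarrow> s \<in> cl s"
  by (simp add: cauchy_class_def cauD)

lemma sn_convergent: assumes "cau s" shows "convergent (\<lambda>m. \<nu> (s m))"
proof (rule Cauchy_convergent, rule metric_CauchyI)
  fix e :: real assume "e > 0"
  then obtain N where N: "\<forall>m\<ge>N. \<forall>k\<ge>N. \<nu> (s m \<ominus> s k) < e" using cauE[OF assms] by blast
  have "dist (\<nu> (s m)) (\<nu> (s k)) < e" if "m \<ge> N" "k \<ge> N" for m k
    using sn_reverse_triangle[OF cauD[OF assms] cauD[OF assms], of m k] N that
    by (force simp: dist_real_def)
  then show "\<exists>N. \<forall>m\<ge>N. \<forall>k\<ge>N. dist (\<nu> (s m)) (\<nu> (s k)) < e" by blast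
qed

lemma sn_tendsto_lim: "cau s \<Longrightarrow> (\<lambda>m. \<nu> (s m)) \<longlonglongrightarrow> lim (\<lambda>m. \<nu> (s m))"
  using sn_convergent by (simp add: convergent_LIMSEQ_iff)

lemma sn_bounded: assumes "cau s" obtains B where "B > 0" "\<And>m. \<nu> (s m) \<le> B"
proof -
  have "Bseq (\<lambda>m. \<nu> (s m))" using sn_convergent[OF assms] convergent_imp_Bseq by blast
  then show ?thesis using that unfolding Bseq_def by (metis abs_le_D1 real_norm_def)
qed

lemma cau_const [simp]: "x \<in> carrier A \<Longrightarrow> cau (\<lambda>m. x)"
  by (auto simp: cauchy_in_def)

lemma cau_add: assumes "cau s" "cau t" shows "cau (\<lambda>m. s m \<oplus> t m)"
  unfolding cauchy_in_def
proof (intro conjI allI impI)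
  fix e :: real assume "e > 0"
  then obtain N M where N: "\<forall>m\<ge>N. \<forall>k\<ge>N. \<nu> (s m \<ominus> s k) < e / 2"
    and M: "\<forall>m\<ge>M. \<forall>k\<ge>M. \<nu> (t m \<ominus> t k) < e / 2"
    using cauE[OF assms(1), of "e / 2"] cauE[OF assms(2), of "e / 2"] by auto
  have "\<nu> (s m \<oplus> t m \<ominus> (s k \<oplus> t k)) < e" if "m \<ge> max N M" "k \<ge> max N M" for m k
  proof -
    note c = assms[THEN cauD]
    have "\<nu> (s m \<oplus> t m \<ominus> (s k \<oplus> t k)) \<le> \<nu> (s m \<ominus> s k) + \<nu> (t m \<ominus> t k)"
      using c by (simp add: add_diff sn_add)
    also have "\<dots> < e / 2 + e / 2" using N M that by (intro add_strict_mono) auto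
    finally show ?thesis by simp
  qed
  then show "\<exists>N. \<forall>m\<ge>N. \<forall>k\<ge>N. \<nu> (s m \<oplus> t m \<ominus> (s k \<oplus> t k)) < e" by blast
qed (use assms[THEN cauD] in auto)

lemma sn_mult_diff:
  assumes "x \<in> carrier A" "y \<in> carrier A" "x' \<in> carrier A" "y' \<in> carrier A"
  shows "\<nu> ((x \<otimes> y) \<ominus> (x' \<otimes> y')) \<le> \<nu> (x \<ominus> x') * \<nu> y + \<nu> x' * \<nu> (y \<ominus> y')"
  unfolding mult_diff[OF assms]
  using sn_add[of "(x \<ominus> x') \<otimes> y" "x' \<otimes> (y \<ominus> y')"] sn_mult[of "x \<ominus> x'" y] sn_mult[of x' "y \<ominus> y'"] assms
  by auto

lemma cau_mult: assumes "cau s" "cau t" shows "cau (\<lambda>m. s m \<otimes> t m)"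
  unfolding cauchy_in_def
proof (intro conjI allI impI)
  fix e :: real assume "e > 0"
  obtain B where B: "B > 0" "\<And>m. \<nu> (s m) \<le> B" using sn_bounded[OF assms(1)] by blast
  obtain D where D: "D > 0" "\<And>m. \<nu> (t m) \<le> D" using sn_bounded[OF assms(2)] by blast
  obtain N M where N: "\<forall>m\<ge>N. \<forall>k\<ge>N. \<nu> (s m \<ominus> s k) < e / (2 * D)"
    and M: "\<forall>m\<ge>M. \<forall>k\<ge>M. \<nu> (t m \<ominus> t k) < e / (2 * B)"
    using cauE[OF assms(1), of "e / (2 * D)"] cauE[OF assms(2), of "e / (2 * B)"] B D \<open>e > 0\<close>
    by auto
  have "\<nu> (s m \<otimes> t m \<ominus> (s k \<otimes> t k)) < e" if mk: "m \<ge> max N M" "k \<ge> max N M" for m k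
  proof -
    note c = assms[THEN cauD]
    have "\<nu> (s m \<otimes> t m \<ominus> (s k \<otimes> t k)) \<le> \<nu> (s m \<ominus> s k) * \<nu> (t m) + \<nu> (s k) * \<nu> (t m \<ominus> t k)"
      using c by (intro sn_mult_diff)
    also have "\<dots> \<le> \<nu> (s m \<ominus> s k) * D + B * \<nu> (t m \<ominus> t k)"
      using c B D by (intro add_mono mult_mono) auto
    also have "\<dots> < e / (2 * D) * D + B * (e / (2 * B))"
      using N M mk B D by (intro add_strict_mono mult_strict_right_mono mult_strict_left_mono) auto
    also have "\<dots> = e" using B D by simp
    finally show ?thesis .
  qed
  then show "\<exists>N. \<forall>m\<ge>N. \<forall>k\<ge>N. \<nu> (s m \<otimes> t m \<ominus> (s k \<otimes> t k)) < e" by blast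
qed (use assms[THEN cauD] in auto)

lemma cau_smult: assumes "cau s" shows "cau (\<lambda>m. a \<odot> s m)"
proof -
  have "(\<lambda>m. a \<odot> s m) = (\<lambda>m. (a \<odot> \<one>) \<otimes> s m)"
    using cauD[OF assms] by (simp add: smult_mult_l)
  then show ?thesis using cau_mult[OF cau_const[of "a \<odot> \<one>"] assms] by simp
qed

lemma cau_star: assumes "cau s" shows "cau (\<lambda>m. star A (s m))"
  using assms by (auto simp: cauchy_in_def simp flip: star_minus)

lemma eqv_add:
  assumes "cau s" "cau t" "cau s'" "cau t'" "s \<approx> s'" "t \<approx> t'"
  shows "(\<lambda>m. s m \<oplus> t m) \<approx> (\<lambda>m. s' m \<oplus> t' m)"
  by (rule eqvI[OF tendsto_add[OF assms(5,6), simplified]])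
     (use assms(1-4)[THEN cauD] in \<open>auto simp: add_diff intro!: sn_add\<close>)

lemma eqv_mult:
  assumes "cau s" "cau t" "cau s'" "cau t'" "s \<approx> s'" "t \<approx> t'"
  shows "(\<lambda>m. s m \<otimes> t m) \<approx> (\<lambda>m. s' m \<otimes> t' m)"
proof (rule eqvI)
  show "(\<lambda>m. \<nu> (s m \<ominus> s' m) * \<nu> (t m) + \<nu> (s' m) * \<nu> (t m \<ominus> t' m)) \<longlonglongrightarrow> 0"
    using tendsto_add[OF tendsto_mult[OF assms(5) sn_tendsto_lim[OF assms(2)]]
        tendsto_mult[OF sn_tendsto_lim[OF assms(3)] assms(6)]] by simp
qed (use assms(1-4)[THEN cauD] in \<open>auto intro!: sn_mult_diff\<close>)

lemma eqv_smult:
  assumes "cau s" "cau s'" "s \<approx> s'"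
  shows "(\<lambda>m. a \<odot> s m) \<approx> (\<lambda>m. a \<odot> s' m)"
  using tendsto_mult[OF tendsto_const[of "cmod a"] assms(3)] assms(1,2)[THEN cauD]
  by (simp add: smult_minus[symmetric] sn_smult)

lemma eqv_star:
  assumes "cau s" "cau s'" "s \<approx> s'"
  shows "(\<lambda>m. star A (s m)) \<approx> (\<lambda>m. star A (s' m))"
  using assms(3) assms(1,2)[THEN cauD] by (simp add: star_minus[symmetric])

lemma UN_const_class: "x \<in> X \<Longrightarrow> (\<And>y. y \<in> X \<Longrightarrow> f y = c) \<Longrightarrow> (\<Union>y\<in>X. f y) = c"
  by blast

lemma Cm_carrier: "carrier Cm = cl ` {s. cau s}"
  and Cm_one: "\<one>\<^bsub>Cm\<^esub> = cl (\<lambda>m. \<one>)"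
  and Cm_zero: "\<zero>\<^bsub>Cm\<^esub> = cl (\<lambda>m. \<zero>)"
  by (simp_all add: cstar_completion_def)

lemma Cm_add: assumes "cau s" "cau t" shows "cl s \<oplus>\<^bsub>Cm\<^esub> cl t = cl (\<lambda>m. s m \<oplus> t m)"
proof -
  have "cl (\<lambda>m. s' m \<oplus> t' m) = cl (\<lambda>m. s m \<oplus> t m)" if "s' \<in> cl s" "t' \<in> cl t" for s' t'
    using that[THEN cl_memD] assms by (auto simp: cl_eq_iff cau_add eqv_add eqv_sym)
  then have "(\<Union>s'\<in>cl s. \<Union>t'\<in>cl t. cl (\<lambda>m. s' m \<oplus> t' m)) = cl (\<lambda>m. s m \<oplus> t m)"
    by (intro UN_const_class[OF cl_self[OF assms(1)]] UN_const_class[OF cl_self[OF assms(2)]])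
  then show ?thesis by (simp add: cstar_completion_def)
qed

lemma Cm_mult: assumes "cau s" "cau t" shows "cl s \<otimes>\<^bsub>Cm\<^esub> cl t = cl (\<lambda>m. s m \<otimes> t m)"
proof -
  have "cl (\<lambda>m. s' m \<otimes> t' m) = cl (\<lambda>m. s m \<otimes> t m)" if "s' \<in> cl s" "t' \<in> cl t" for s' t'
    using that[THEN cl_memD] assms by (auto simp: cl_eq_iff cau_mult eqv_mult eqv_sym)
  then have "(\<Union>s'\<in>cl s. \<Union>t'\<in>cl t. cl (\<lambda>m. s' m \<otimes> t' m)) = cl (\<lambda>m. s m \<otimes> t m)"
    by (intro UN_const_class[OF cl_self[OF assms(1)]] UN_const_class[OF cl_self[OF assms(2)]])
  then show ?thesis by (simp add: cstar_completion_def)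
qed

lemma Cm_smult: assumes "cau s" shows "a \<odot>\<^bsub>Cm\<^esub> cl s = cl (\<lambda>m. a \<odot> s m)"
proof -
  have "cl (\<lambda>m. a \<odot> s' m) = cl (\<lambda>m. a \<odot> s m)" if "s' \<in> cl s" for s'
    using that[THEN cl_memD] assms by (auto simp: cl_eq_iff cau_smult eqv_smult eqv_sym)
  then have "(\<Union>s'\<in>cl s. cl (\<lambda>m. a \<odot> s' m)) = cl (\<lambda>m. a \<odot> s m)"
    by (intro UN_const_class[OF cl_self[OF assms(1)]])
  then show ?thesis by (simp add: cstar_completion_def)
qed

lemma Cm_star: assumes "cau s" shows "star Cm (cl s) = cl (\<lambda>m. star A (s m))"
proof -
  have "cl (\<lambda>m. star A (s' m)) = cl (\<lambda>m. star A (s m))" if "s' \<in> cl s" for s'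
    using that[THEN cl_memD] assms by (auto simp: cl_eq_iff cau_star eqv_star eqv_sym)
  then have "(\<Union>s'\<in>cl s. cl (\<lambda>m. star A (s' m))) = cl (\<lambda>m. star A (s m))"
    by (intro UN_const_class[OF cl_self[OF assms(1)]])
  then show ?thesis by (simp add: cstar_completion_def)
qed

lemma eqv_tendsto:
  assumes "cau s" "cau t" "s \<approx> t" "(\<lambda>m. \<nu> (s m)) \<longlonglongrightarrow> r"
  shows "(\<lambda>m. \<nu> (t m)) \<longlonglongrightarrow> r"
proof -
  have "(\<lambda>m. \<nu> (t m) - \<nu> (s m)) \<longlonglongrightarrow> 0"
    by (rule tendsto_rabs_zero_cancel, rule tendsto_sandwich[OF _ _ tendsto_const assms(3)])
       (use sn_reverse_triangle assms(1,2)[THEN cauD] in \<open>auto intro!: always_eventually simp: abs_minus_commute\<close>)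
  from tendsto_add[OF this assms(4)] show ?thesis by simp
qed

lemma Cm_norm_tendsto: assumes "cau s" shows "(\<lambda>m. \<nu> (s m)) \<longlonglongrightarrow> cnorm Cm (cl s)"
proof -
  have "cnorm Cm (cl s) = lim (\<lambda>m. \<nu> (s m))"
    unfolding cstar_completion_def
  proof (simp, rule the_equality)
    show "\<forall>t\<in>cl s. (\<lambda>m. \<nu> (t m)) \<longlonglongrightarrow> lim (\<lambda>m. \<nu> (s m))"
      using eqv_tendsto[OF assms _ _ sn_tendsto_lim[OF assms]] cl_memD by blast
  qed (use cl_self[OF assms] limI in blast)
  then show ?thesis using sn_tendsto_lim[OF assms] by simp
qed

lemma Cm_normI: "cau s \<Longrightarrow> (\<lambda>m. \<nu> (s m)) \<longlonglongrightarrow> r \<Longrightarrow> cnorm Cm (cl s) = r"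
  using Cm_norm_tendsto LIMSEQ_unique by blast

lemma Cm_E: assumes "S \<in> carrier Cm" obtains s where "cau s" "S = cl s"
  using assms Cm_carrier by auto

lemma Cm_cl: "cau s \<Longrightarrow> cl s \<in> carrier Cm"
  by (simp add: Cm_carrier)

lemmas Cm_ops = Cm_one Cm_zero Cm_add Cm_mult Cm_smult Cm_star Cm_cl
  cau_add cau_mult cau_smult cau_star

lemma complex_algebra_Cm: "complex_algebra Cm"
proof (intro complex_algebra.intro complex_algebra_axioms.intro ringI abelian_groupI monoidI)
  show "\<zero>\<^bsub>Cm\<^esub> \<in> carrier Cm" "\<one>\<^bsub>Cm\<^esub> \<in> carrier Cm" by (simp_all add: Cm_ops)
next
  fix x y z a assume "x \<in> carrier Cm" "y \<in> carrier Cm" "z \<in> carrier Cm"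
  then obtain s t u where "cau s" "cau t" "cau u" and [simp]: "x = cl s" "y = cl t" "z = cl u"
    by (metis Cm_E)
  note [simp] = this(1-3) this(1-3)[THEN cauD]
  show "x \<oplus>\<^bsub>Cm\<^esub> y \<oplus>\<^bsub>Cm\<^esub> z = x \<oplus>\<^bsub>Cm\<^esub> (y \<oplus>\<^bsub>Cm\<^esub> z)" by (simp add: Cm_ops a_assoc)
  show "x \<otimes>\<^bsub>Cm\<^esub> y \<otimes>\<^bsub>Cm\<^esub> z = x \<otimes>\<^bsub>Cm\<^esub> (y \<otimes>\<^bsub>Cm\<^esub> z)" by (simp add: Cm_ops m_assoc)
  show "(x \<oplus>\<^bsub>Cm\<^esub> y) \<otimes>\<^bsub>Cm\<^esub> z = x \<otimes>\<^bsub>Cm\<^esub> z \<oplus>\<^bsub>Cm\<^esub> y \<otimes>\<^bsub>Cm\<^esub> z" by (simp add: Cm_ops l_distr)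
  show "z \<otimes>\<^bsub>Cm\<^esub> (x \<oplus>\<^bsub>Cm\<^esub> y) = z \<otimes>\<^bsub>Cm\<^esub> x \<oplus>\<^bsub>Cm\<^esub> z \<otimes>\<^bsub>Cm\<^esub> y" by (simp add: Cm_ops r_distr)
next
  fix x y a assume "x \<in> carrier Cm" "y \<in> carrier Cm"
  then obtain s t where "cau s" "cau t" and [simp]: "x = cl s" "y = cl t"
    by (metis Cm_E)
  note [simp] = this(1-2) this(1-2)[THEN cauD]
  show "x \<oplus>\<^bsub>Cm\<^esub> y \<in> carrier Cm" "x \<otimes>\<^bsub>Cm\<^esub> y \<in> carrier Cm" by (simp_all add: Cm_ops)
  show "x \<oplus>\<^bsub>Cm\<^esub> y = y \<oplus>\<^bsub>Cm\<^esub> x" by (simp add: Cm_ops a_comm)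
  show "a \<odot>\<^bsub>Cm\<^esub> (x \<oplus>\<^bsub>Cm\<^esub> y) = a \<odot>\<^bsub>Cm\<^esub> x \<oplus>\<^bsub>Cm\<^esub> a \<odot>\<^bsub>Cm\<^esub> y" by (simp add: Cm_ops smult_r_distr)
  show "a \<odot>\<^bsub>Cm\<^esub> x \<otimes>\<^bsub>Cm\<^esub> y = a \<odot>\<^bsub>Cm\<^esub> (x \<otimes>\<^bsub>Cm\<^esub> y)" by (simp add: Cm_ops smult_mult_l)
  show "x \<otimes>\<^bsub>Cm\<^esub> (a \<odot>\<^bsub>Cm\<^esub> y) = a \<odot>\<^bsub>Cm\<^esub> (x \<otimes>\<^bsub>Cm\<^esub> y)" by (simp add: Cm_ops smult_mult_r)
next
  fix x a b assume "x \<in> carrier Cm"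
  then obtain s where "cau s" and [simp]: "x = cl s"
    by (metis Cm_E)
  note [simp] = this(1) this(1)[THEN cauD]
  show "a \<odot>\<^bsub>Cm\<^esub> x \<in> carrier Cm" by (simp add: Cm_ops)
  show "\<zero>\<^bsub>Cm\<^esub> \<oplus>\<^bsub>Cm\<^esub> x = x" by (simp add: Cm_ops)
  show "\<one>\<^bsub>Cm\<^esub> \<otimes>\<^bsub>Cm\<^esub> x = x" "x \<otimes>\<^bsub>Cm\<^esub> \<one>\<^bsub>Cm\<^esub> = x" by (simp_all add: Cm_ops)
  show "1 \<odot>\<^bsub>Cm\<^esub> x = x" by (simp add: Cm_ops)
  show "(a + b) \<odot>\<^bsub>Cm\<^esub> x = a \<odot>\<^bsub>Cm\<^esub> x \<oplus>\<^bsub>Cm\<^esub> b \<odot>\<^bsub>Cm\<^esub> x" by (simp add: Cm_ops smult_l_distr)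
  show "(a * b) \<odot>\<^bsub>Cm\<^esub> x = a \<odot>\<^bsub>Cm\<^esub> (b \<odot>\<^bsub>Cm\<^esub> x)" by (simp add: Cm_ops smult_assoc)
  have "(-1) \<odot>\<^bsub>Cm\<^esub> x \<oplus>\<^bsub>Cm\<^esub> x = \<zero>\<^bsub>Cm\<^esub>" "(-1) \<odot>\<^bsub>Cm\<^esub> x \<in> carrier Cm"
    using cau_smult[of s "-1"] by (simp_all add: Cm_ops neg_smult l_neg)
  then show "\<exists>y\<in>carrier Cm. y \<oplus>\<^bsub>Cm\<^esub> x = \<zero>\<^bsub>Cm\<^esub>" by blast
qed

lemma star_algebra_Cm: "star_algebra Cm"
proof (intro star_algebra.intro star_algebra_axioms.intro complex_algebra_Cm)
  fix x y assume "x \<in> carrier Cm" "y \<in> carrier Cm"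
  then obtain s t where "cau s" "cau t" and [simp]: "x = cl s" "y = cl t"
    by (metis Cm_E)
  note [simp] = this(1-2) this(1-2)[THEN cauD]
  show "star Cm (x \<oplus>\<^bsub>Cm\<^esub> y) = star Cm x \<oplus>\<^bsub>Cm\<^esub> star Cm y" by (simp add: Cm_ops star_add)
  show "star Cm (x \<otimes>\<^bsub>Cm\<^esub> y) = star Cm y \<otimes>\<^bsub>Cm\<^esub> star Cm x" by (simp add: Cm_ops star_mult)
next
  fix x a assume "x \<in> carrier Cm"
  then obtain s where "cau s" and [simp]: "x = cl s"
    by (metis Cm_E)
  note [simp] = this(1) this(1)[THEN cauD]
  show "star Cm x \<in> carrier Cm" by (simp add: Cm_ops)
  show "star Cm (star Cm x) = x" by (simp add: Cm_ops)
  show "star Cm (a \<odot>\<^bsub>Cm\<^esub> x) = cnj a \<odot>\<^bsub>Cm\<^esub> star Cm x" by (simp add: Cm_ops star_smult)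
qed

lemma cstar_seminorm_Cm: "cstar_seminorm Cm (cnorm Cm)"
  unfolding cstar_seminorm_def
proof (intro conjI ballI allI)
  fix x y assume "x \<in> carrier Cm" "y \<in> carrier Cm"
  then obtain s t where st: "cau s" "cau t" and [simp]: "x = cl s" "y = cl t"
    by (metis Cm_E)
  note [simp] = st st[THEN cauD]
  show "cnorm Cm (x \<oplus>\<^bsub>Cm\<^esub> y) \<le> cnorm Cm x + cnorm Cm y"
    using LIMSEQ_le[OF Cm_norm_tendsto[OF cau_add[OF st]] tendsto_add[OF st[THEN Cm_norm_tendsto]]] sn_add
    by (simp add: Cm_ops)
  show "cnorm Cm (x \<otimes>\<^bsub>Cm\<^esub> y) \<le> cnorm Cm x * cnorm Cm y"
    using LIMSEQ_le[OF Cm_norm_tendsto[OF cau_mult[OF st]] tendsto_mult[OF st[THEN Cm_norm_tendsto]]] sn_mult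
    by (simp add: Cm_ops)
next
  fix x a assume "x \<in> carrier Cm"
  then obtain s where s: "cau s" and [simp]: "x = cl s"
    by (metis Cm_E)
  note [simp] = s s[THEN cauD]
  show "0 \<le> cnorm Cm x"
    using LIMSEQ_le_const[OF Cm_norm_tendsto[OF s], of 0] by simp
  show "cnorm Cm (a \<odot>\<^bsub>Cm\<^esub> x) = cmod a * cnorm Cm x"
    using tendsto_mult[OF tendsto_const[of "cmod a"] Cm_norm_tendsto[OF s]]
    by (simp add: Cm_ops Cm_normI sn_smult)
  show "cnorm Cm (star Cm x \<otimes>\<^bsub>Cm\<^esub> x) = (cnorm Cm x)\<^sup>2"
    using tendsto_power[OF Cm_norm_tendsto[OF s], of 2]
    by (simp add: Cm_ops Cm_normI sn_cstar)
qed

lemma Cm_minus: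
  assumes "cau s" "cau t"
  shows "cl s \<ominus>\<^bsub>Cm\<^esub> cl t = cl (\<lambda>m. s m \<ominus> t m)" "cau (\<lambda>m. s m \<ominus> t m)"
proof -
  interpret C: complex_algebra Cm by (rule complex_algebra_Cm)
  have e: "(\<lambda>m. s m \<ominus> t m) = (\<lambda>m. s m \<oplus> (-1) \<odot> t m)"
    using assms[THEN cauD] by (simp add: neg_smult a_minus_def)
  show "cl s \<ominus>\<^bsub>Cm\<^esub> cl t = cl (\<lambda>m. s m \<ominus> t m)"
    unfolding e using assms by (simp add: a_minus_def C.neg_smult[symmetric] Cm_ops)
  show "cau (\<lambda>m. s m \<ominus> t m)"
    unfolding e using assms by (simp add: Cm_ops)
qed

lemma Cm_dist: "x \<in> carrier A \<Longrightarrow> y \<in> carrier A \<Longrightarrow> cnorm Cm (cl (\<lambda>m. x) \<ominus>\<^bsub>Cm\<^esub> cl (\<lambda>m. y)) = \<nu> (x \<ominus> y)"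
  by (simp add: Cm_minus Cm_normI)

lemma Cm_dense_lim:
  assumes "cau s"
  shows "(\<lambda>m. cnorm Cm (cl s \<ominus>\<^bsub>Cm\<^esub> cl (\<lambda>k. s m))) \<longlonglongrightarrow> 0"
proof (rule LIMSEQ_I)
  fix e :: real assume "e > 0"
  then obtain N where N: "\<forall>m\<ge>N. \<forall>k\<ge>N. \<nu> (s m \<ominus> s k) < e / 2" using cauE[OF assms, of "e / 2"] by auto
  have "norm (cnorm Cm (cl s \<ominus>\<^bsub>Cm\<^esub> cl (\<lambda>k. s m)) - 0) < e" if "m \<ge> N" for m
  proof -
    have c: "cau (\<lambda>k. s m)" using cauD[OF assms] by simp
    note l = Cm_norm_tendsto[OF Cm_minus(2)[OF assms c], folded Cm_minus(1)[OF assms c]]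
    have "cnorm Cm (cl s \<ominus>\<^bsub>Cm\<^esub> cl (\<lambda>k. s m)) \<le> e / 2"
      using N that by (intro LIMSEQ_le_const2[OF l]) (auto intro!: exI[of _ N] less_imp_le)
    moreover have "0 \<le> cnorm Cm (cl s \<ominus>\<^bsub>Cm\<^esub> cl (\<lambda>k. s m))"
      using cauD[OF assms] by (intro LIMSEQ_le_const[OF l]) auto
    ultimately show ?thesis using \<open>e > 0\<close> by simp
  qed
  then show "\<exists>N. \<forall>m\<ge>N. norm (cnorm Cm (cl s \<ominus>\<^bsub>Cm\<^esub> cl (\<lambda>k. s m)) - 0) < e" by blast
qed

end

sublocale unital_cstar_algebra \<subseteq> seminormed_star_algebra A "cnorm A"
  by unfold_locales (rule cstar_norm)

context seminormed_star_algebra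
begin

theorem unital_cstar_algebra_completion: "unital_cstar_algebra Cm"
proof (intro unital_cstar_algebra.intro star_algebra_Cm unital_cstar_algebra_axioms.intro cstar_seminorm_Cm)
  fix x assume "x \<in> carrier Cm" and z: "cnorm Cm x = 0"
  then obtain s where s: "cau s" and [simp]: "x = cl s" by (metis Cm_E)
  have "s \<approx> (\<lambda>m. \<zero>)"
    using Cm_norm_tendsto[OF s] z cauD[OF s] by (simp add: a_minus_def)
  then show "x = \<zero>\<^bsub>Cm\<^esub>" using s by (simp add: Cm_zero cl_eq_iff)
next
  fix S assume S: "cauchy_in Cm (cnorm Cm) S"
  interpret C: seminormed_star_algebra Cm "cnorm Cm"
    by (intro seminormed_star_algebra.intro star_algebra_Cm seminormed_star_algebra_axioms.intro cstar_seminorm_Cm)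
  have "\<exists>p. p \<in> carrier A \<and> cnorm Cm (S m \<ominus>\<^bsub>Cm\<^esub> cl (\<lambda>k. p)) < 1 / Suc m" for m
  proof -
    obtain s where s: "cau s" "S m = cl s" using C.cauD[OF S] by (metis Cm_E)
    obtain N where N: "\<And>j. j \<ge> N \<Longrightarrow> norm (cnorm Cm (cl s \<ominus>\<^bsub>Cm\<^esub> cl (\<lambda>k. s j)) - 0) < 1 / Suc m"
      using LIMSEQ_D[OF Cm_dense_lim[OF s(1)], of "1 / Suc m"] by auto
    from N[OF order_refl] have "cnorm Cm (S m \<ominus>\<^bsub>Cm\<^esub> cl (\<lambda>k. s N)) < 1 / Suc m"
      unfolding s(2) real_norm_def by linarith
    then show ?thesis using cauD[OF s(1), of N] by blast
  qed
  then obtain p where p: "\<And>m. p m \<in> carrier A" "\<And>m. cnorm Cm (S m \<ominus>\<^bsub>Cm\<^esub> cl (\<lambda>k. p m)) < 1 / Suc m"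
    by metis
  have pc: "cl (\<lambda>k. p m) \<in> carrier Cm" for m using p by (simp add: Cm_cl)
  note Sc = C.cauD[OF S]
  have cp: "cau p"
    unfolding cauchy_in_def
  proof (intro conjI allI impI p)
    fix e :: real assume e: "e > 0"
    then obtain N where N: "\<forall>m\<ge>N. \<forall>k\<ge>N. cnorm Cm (S m \<ominus>\<^bsub>Cm\<^esub> S k) < e / 3" using C.cauE[OF S, of "e / 3"] by auto
    obtain M where M: "1 / Suc M < e / 3" using nat_approx_posE[of "e / 3"] e by auto
    have "\<nu> (p m \<ominus> p k) < e" if mk: "m \<ge> max N M" "k \<ge> max N M" for m k
    proof -
      have q: "1 / Suc j \<le> 1 / Suc M" if "j \<ge> M" for j using that by (simp add: frac_le)
      have "\<nu> (p m \<ominus> p k) = cnorm Cm (cl (\<lambda>j. p m) \<ominus>\<^bsub>Cm\<^esub> cl (\<lambda>j. p k))"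
        using p by (simp add: Cm_dist)
      also have "\<dots> \<le> cnorm Cm (cl (\<lambda>j. p m) \<ominus>\<^bsub>Cm\<^esub> S m) + cnorm Cm (S m \<ominus>\<^bsub>Cm\<^esub> cl (\<lambda>j. p k))"
        using pc Sc by (intro C.sn_triangle)
      also have "\<dots> \<le> cnorm Cm (cl (\<lambda>j. p m) \<ominus>\<^bsub>Cm\<^esub> S m) +
          (cnorm Cm (S m \<ominus>\<^bsub>Cm\<^esub> S k) + cnorm Cm (S k \<ominus>\<^bsub>Cm\<^esub> cl (\<lambda>j. p k)))"
        using pc Sc by (intro add_left_mono C.sn_triangle)
      also have "cnorm Cm (cl (\<lambda>j. p m) \<ominus>\<^bsub>Cm\<^esub> S m) = cnorm Cm (S m \<ominus>\<^bsub>Cm\<^esub> cl (\<lambda>j. p m))"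
        using pc Sc by (intro C.sn_minus_commute)
      also have "\<dots> + (cnorm Cm (S m \<ominus>\<^bsub>Cm\<^esub> S k) + cnorm Cm (S k \<ominus>\<^bsub>Cm\<^esub> cl (\<lambda>j. p k))) < e / 3 + (e / 3 + e / 3)"
      proof (intro add_strict_mono)
        show "cnorm Cm (S m \<ominus>\<^bsub>Cm\<^esub> cl (\<lambda>j. p m)) < e / 3" using p(2)[of m] q[of m] M mk by linarith
        show "cnorm Cm (S k \<ominus>\<^bsub>Cm\<^esub> cl (\<lambda>j. p k)) < e / 3" using p(2)[of k] q[of k] M mk by linarith
        show "cnorm Cm (S m \<ominus>\<^bsub>Cm\<^esub> S k) < e / 3" using N mk by simp
      qed
      finally show ?thesis by simp
    qed
    then show "\<exists>N. \<forall>m\<ge>N. \<forall>k\<ge>N. \<nu> (p m \<ominus> p k) < e" by blast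
  qed
  have "(\<lambda>m. cnorm Cm (S m \<ominus>\<^bsub>Cm\<^esub> cl p)) \<longlonglongrightarrow> 0"
  proof (rule C.eqvI)
    show "(\<lambda>m. 1 / Suc m + cnorm Cm (cl p \<ominus>\<^bsub>Cm\<^esub> cl (\<lambda>k. p m))) \<longlonglongrightarrow> 0"
      using tendsto_add[OF LIMSEQ_inverse_real_of_nat Cm_dense_lim[OF cp]] by (simp add: inverse_eq_divide)
    show "cnorm Cm (S m \<ominus>\<^bsub>Cm\<^esub> cl p) \<le> 1 / Suc m + cnorm Cm (cl p \<ominus>\<^bsub>Cm\<^esub> cl (\<lambda>k. p m))" for m
      using C.sn_triangle[OF Sc pc Cm_cl[OF cp], of m m] p(2)[of m] C.sn_minus_commute[OF pc Cm_cl[OF cp], of m]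
      by linarith
  qed (use Sc Cm_cl[OF cp] in auto)
  then show "\<exists>x\<in>carrier Cm. (\<lambda>m. cnorm Cm (S m \<ominus>\<^bsub>Cm\<^esub> x)) \<longlonglongrightarrow> 0"
    using Cm_cl[OF cp] by blast
qed

end


section \<open>Evaluation of *-polynomials\<close>

definition star_poly_eval ::
    "('a, 'm) star_alg_scheme \<Rightarrow> ('g \<Rightarrow> 'a) \<Rightarrow> (('g \<times> bool) list \<Rightarrow> complex) \<Rightarrow> 'a" where
  "star_poly_eval A x = poly_eval A (\<lambda>(g, b). if b then star A (x g) else x g)"

lemma complex_algebra_free_star: "complex_algebra (free_star G)"
  using star_algebra_free_star star_algebra_def by blast

lemma flip_lists: "w \<in> lists (G \<times> UNIV) \<Longrightarrow> map (apsnd Not) (rev w) \<in> lists (G \<times> UNIV)"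
  by (induction w) auto

lemma star_monomial: "star (free_star G) (monomial w) = monomial (map (apsnd Not) (rev w))"
proof
  fix v
  have "map (apsnd Not) (rev v) = w \<longleftrightarrow> v = map (apsnd Not) (rev w)"
    by (auto simp: rev_map[symmetric] apsnd_Not_twice simp del: map_map)
  then show "star (free_star G) (monomial w) v = monomial (map (apsnd Not) (rev w)) v"
    by (simp add: free_star_simps monomial_def)
qed

lemma free_gen_closed: "g \<in> G \<Longrightarrow> free_gen g \<in> carrier (free_star G)"
  by (auto simp: free_gen_def free_star_simps intro!: monomial_closed)

lemma free_star_induct [consumes 1, case_names zero add]:
  assumes "p \<in> carrier (free_star G)"
    and "Q \<zero>\<^bsub>free_star G\<^esub>"
    and "\<And>a v p. v \<in> lists (G \<times> UNIV) \<Longrightarrow> p \<in> carrier (free_star G) \<Longrightarrow> Q p \<Longrightarrow>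
      Q (a \<odot>\<^bsub>free_star G\<^esub> monomial v \<oplus>\<^bsub>free_star G\<^esub> p)"
  shows "Q p"
  using assms(1)[unfolded free_star_simps]
proof (induction rule: nc_polynomial_induct)
  case zero
  then show ?case using assms(2) by (simp add: free_star_simps nc_poly_simps)
next
  case (add a v p)
  then show ?case using assms(3)[of v p a] by (simp add: free_star_simps nc_poly_simps)
qed

context star_algebra
begin

context
  fixes G :: "'g set" and x
  assumes x: "x \<in> G \<rightarrow> carrier A"
begin

abbreviation "star_fam \<equiv> \<lambda>(g, b). if b then star A (x g) else x g"

lemma star_fam: "star_fam \<in> G \<times> UNIV \<rightarrow> carrier A"
  using x by (auto dest: funcset_mem)

lemma star_poly_eval_gen: "g \<in> G \<Longrightarrow> star_poly_eval A x (free_gen g) = x g"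
  unfolding free_gen_def star_poly_eval_def
  using x poly_eval_monomial[OF star_fam, of "[(g, False)]"]
  by (auto simp: word_prod_def dest: funcset_mem)

lemma star_word_prod:
  assumes "w \<in> lists (G \<times> UNIV)"
  shows "star A (word_prod A star_fam w) = word_prod A star_fam (map (apsnd Not) (rev w))"
  using assms
proof (induction w)
  case Nil
  have "star A \<one> = star A \<one> \<otimes> star A (star A \<one>)" by simp
  also have "\<dots> = star A (star A \<one> \<otimes> \<one>)" by (subst star_mult) auto
  also have "\<dots> = \<one>" by simp
  finally show ?case by (simp add: word_prod_def)
next
  case (Cons a w)
  obtain g b where a: "a = (g, b)" by force
  have g: "x g \<in> carrier A" using Cons a x by auto
  have w: "word_prod A star_fam w \<in> carrier A" using Cons by (intro word_prod_closed[OF star_fam]) auto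
  have r: "map (apsnd Not) (rev w) \<in> lists (G \<times> UNIV)" using Cons by (intro flip_lists) auto
  have "star A (word_prod A star_fam (a # w)) = star A (word_prod A star_fam w) \<otimes> star A (star_fam a)"
    using g w a by (simp add: word_prod_def star_mult)
  also have "star A (star_fam a) = word_prod A star_fam (map (apsnd Not) [a])"
    using g a by (simp add: word_prod_def)
  also have "star A (word_prod A star_fam w) \<otimes> word_prod A star_fam (map (apsnd Not) [a]) =
      word_prod A star_fam (map (apsnd Not) (rev w) @ map (apsnd Not) [a])"
    using Cons r a by (subst word_prod_append[OF star_fam]) auto
  finally show ?case by simp
qed

lemma star_poly_eval_hom: "unital_star_hom (free_star G) A (star_poly_eval A x)"
proof -
  interpret F: star_algebra "free_star G" by (rule star_algebra_free_star)
  note e = star_poly_eval_def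
  have cl: "star_poly_eval A x p \<in> carrier A" if "p \<in> carrier (free_star G)" for p
    using poly_eval_closed[OF star_fam] that unfolding e free_star_simps by blast
  have ad: "star_poly_eval A x (p \<oplus>\<^bsub>free_star G\<^esub> q) = star_poly_eval A x p \<oplus> star_poly_eval A x q"
    if "p \<in> carrier (free_star G)" "q \<in> carrier (free_star G)" for p q
    using poly_eval_add[OF star_fam] that unfolding e free_star_simps by blast
  have sm: "star_poly_eval A x (a \<odot>\<^bsub>free_star G\<^esub> p) = a \<odot> star_poly_eval A x p"
    if "p \<in> carrier (free_star G)" for p a
    using poly_eval_smult[OF star_fam] that unfolding e free_star_simps by blast
  have mo: "star_poly_eval A x (monomial v) = word_prod A star_fam v" if "v \<in> lists (G \<times> UNIV)" for v
    unfolding e using poly_eval_monomial[OF star_fam that] .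
  show ?thesis
    unfolding unital_star_hom_def
  proof (intro conjI ballI allI ad sm)
    show "star_poly_eval A x \<in> carrier (free_star G) \<rightarrow> carrier A" using cl by blast
    have "\<one>\<^bsub>free_star G\<^esub> = monomial []" by (auto simp: free_star_simps nc_poly_simps monomial_def)
    then show "star_poly_eval A x \<one>\<^bsub>free_star G\<^esub> = \<one>" using mo[of "[]"] by (simp add: word_prod_def)
    show "star_poly_eval A x (p \<otimes>\<^bsub>free_star G\<^esub> q) = star_poly_eval A x p \<otimes> star_poly_eval A x q"
      if "p \<in> carrier (free_star G)" "q \<in> carrier (free_star G)" for p q
      using poly_eval_mult[OF star_fam] that unfolding e free_star_simps by blast
    fix p assume "p \<in> carrier (free_star G)"
    then show "star_poly_eval A x (star (free_star G) p) = star A (star_poly_eval A x p)"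
    proof (induction rule: free_star_induct)
      case zero
      have "star_poly_eval A x \<zero>\<^bsub>free_star G\<^esub> = \<zero>"
        using sm[of "\<zero>\<^bsub>free_star G\<^esub>" 0] cl[of "\<zero>\<^bsub>free_star G\<^esub>"] by simp
      moreover have "star (free_star G) \<zero>\<^bsub>free_star G\<^esub> = \<zero>\<^bsub>free_star G\<^esub>"
        using F.star_smult[of "\<zero>\<^bsub>free_star G\<^esub>" 0] by simp
      moreover have "star A \<zero> = \<zero>" using star_smult[of "\<zero>" 0] by simp
      ultimately show ?case by simp
    next
      case (add a v p)
      have m: "monomial v \<in> carrier (free_star G)"
        using monomial_closed[OF add(1)] by (simp add: free_star_simps)
      have w: "word_prod A star_fam v \<in> carrier A" by (rule word_prod_closed[OF star_fam add(1)])
      have v: "map (apsnd Not) (rev v) \<in> lists (G \<times> UNIV)" using add(1) by (rule flip_lists)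
      have m': "monomial (map (apsnd Not) (rev v)) \<in> carrier (free_star G)"
        using monomial_closed[OF v] by (simp add: free_star_simps)
      show ?case
        using m m' w v add cl[OF add(2)]
        by (simp add: F.star_add F.star_smult ad sm star_add star_smult star_monomial mo star_word_prod)
    qed
  qed auto
qed

end

end

lemma star_hom_minus:
  assumes "star_algebra A" "star_algebra B" "unital_star_hom A B h" "x \<in> carrier A" "y \<in> carrier A"
  shows "h (x \<ominus>\<^bsub>A\<^esub> y) = h x \<ominus>\<^bsub>B\<^esub> h y"
proof -
  interpret A: star_algebra A by fact
  interpret B: star_algebra B by fact
  have "h y \<in> carrier B" using assms by (auto simp: unital_star_hom_def)
  then show ?thesis
    using assms by (simp add: a_minus_def unital_star_hom_def flip: A.neg_smult B.neg_smult)
qed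

lemma star_hom_free_unique:
  assumes "star_algebra A" "unital_star_hom (free_star G) A h" "p \<in> carrier (free_star G)"
  shows "h p = star_poly_eval A (\<lambda>g. h (free_gen g)) p"
proof -
  interpret A: star_algebra A by fact
  interpret F: star_algebra "free_star G" by (rule star_algebra_free_star)
  let ?x = "\<lambda>g. h (free_gen g)"
  have x: "?x \<in> G \<rightarrow> carrier A" using assms(2) free_gen_closed by (fastforce simp: unital_star_hom_def)
  have k: "unital_star_hom (free_star G) A (star_poly_eval A ?x)"
    by (rule A.star_poly_eval_hom[OF x])
  have mo: "h (monomial v) = star_poly_eval A ?x (monomial v)" if "v \<in> lists (G \<times> UNIV)" for v
    using that
  proof (induction v)
    case Nil
    have "\<one>\<^bsub>free_star G\<^esub> = monomial []" by (auto simp: free_star_simps nc_poly_simps monomial_def)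
    then show ?case using assms(2) k by (auto simp: unital_star_hom_def)
  next
    case (Cons a v)
    obtain g b where a: "a = (g, b)" by force
    have g: "g \<in> G" using Cons a by auto
    have av: "monomial (a # v) = monomial [a] \<otimes>\<^bsub>free_star G\<^esub> monomial v"
      by (simp add: free_star_simps monomial_mult)
    have "[a] \<in> lists (G \<times> UNIV)" using Cons by auto
    then have m: "monomial [a] \<in> carrier (free_star G)" "monomial v \<in> carrier (free_star G)"
      using Cons monomial_closed[of _ "G \<times> (UNIV::bool set)"] by (auto simp: free_star_simps)
    have ma: "monomial [a] = (if b then star (free_star G) (free_gen g) else free_gen g)"
      by (simp add: a free_gen_def star_monomial)
    have e: "star_poly_eval A ?x (free_gen g) = ?x g"
      by (rule A.star_poly_eval_gen[OF x g])
    have "h (monomial [a]) = star_poly_eval A ?x (monomial [a])"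
      unfolding ma using assms(2) k e free_gen_closed[OF g] by (simp add: unital_star_hom_def)
    then show ?case unfolding av using Cons m assms(2) k by (auto simp: unital_star_hom_def)
  qed
  show ?thesis using assms(3)
  proof (induction rule: free_star_induct)
    case zero
    have "l \<zero>\<^bsub>free_star G\<^esub> = \<zero>\<^bsub>A\<^esub>" if l: "unital_star_hom (free_star G) A l" for l
    proof -
      have "l (0 \<odot>\<^bsub>free_star G\<^esub> \<zero>\<^bsub>free_star G\<^esub>) = 0 \<odot>\<^bsub>A\<^esub> l \<zero>\<^bsub>free_star G\<^esub>" "l \<zero>\<^bsub>free_star G\<^esub> \<in> carrier A"
        using l F.zero_closed unfolding unital_star_hom_def by blast+
      then show ?thesis by simp
    qed
    then show ?case using assms(2) k by metis
  next
    case (add a v p)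
    have m: "monomial v \<in> carrier (free_star G)"
      using monomial_closed[OF add(1)] by (simp add: free_star_simps)
    show ?case using add m mo[OF add(1)] assms(2) k by (simp add: unital_star_hom_def)
  qed
qed

section \<open>Correctness of the universal C*-algebra\<close>

text \<open>For relations containing the projection relations, \<open>universal_cstar G R\<close> is a unital C*-algebra
  in which the *-polynomials in the generators are dense and the relations hold, and every family
  in a unital C*-algebra (of any type) that satisfies the relations is the image of the generators
  under a unital *-homomorphism. The algebras \<open>A_s\<close>, \<open>B_s\<close>, \<open>A_i\<close>, \<open>B_i\<close> are of this kind.\<close>

locale bounded_presentation =
  fixes G :: "'g set" and R :: "'g relations"
  assumes rels: "R \<subseteq> carrier (free_star G) \<times> carrier (free_star G)"
    and proj: "projection_relations G \<subseteq> R"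
begin

abbreviation "F \<equiv> free_star G"
abbreviation "cs \<equiv> compatible_seminorms G R"
abbreviation "us \<equiv> universal_seminorm G R"

sublocale F: star_algebra F by (rule star_algebra_free_star)

lemma csD: "\<rho> \<in> cs \<Longrightarrow> seminormed_star_algebra F \<rho>"
  by (intro seminormed_star_algebra.intro star_algebra_free_star seminormed_star_algebra_axioms.intro)
     (simp add: compatible_seminorms_def)

lemma cs_rel: "\<rho> \<in> cs \<Longrightarrow> (l, r) \<in> R \<Longrightarrow> \<rho> (l \<ominus>\<^bsub>F\<^esub> r) = 0"
  by (auto simp: compatible_seminorms_def)

lemma cs_zero: "(\<lambda>p. 0) \<in> cs"
  by (auto simp: compatible_seminorms_def cstar_seminorm_def)

lemma cs_gen: assumes "\<rho> \<in> cs" "g \<in> G" shows "\<rho> (free_gen g) \<le> 1"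
proof -
  interpret seminormed_star_algebra F \<rho> by (rule csD) fact
  let ?g = "free_gen g"
  have g: "?g \<in> carrier F" by (rule free_gen_closed) fact
  have r: "\<rho> (?g \<otimes>\<^bsub>F\<^esub> ?g \<ominus>\<^bsub>F\<^esub> ?g) = 0" "\<rho> (star F ?g \<ominus>\<^bsub>F\<^esub> ?g) = 0"
    using assms proj by (auto intro!: cs_rel simp: projection_relations_def)
  have "(\<rho> ?g)\<^sup>2 = \<rho> (star F ?g \<otimes>\<^bsub>F\<^esub> ?g)" using g by (simp add: sn_cstar)
  also have "\<dots> \<le> \<rho> (?g \<otimes>\<^bsub>F\<^esub> ?g) + \<rho> (star F ?g \<otimes>\<^bsub>F\<^esub> ?g \<ominus>\<^bsub>F\<^esub> ?g \<otimes>\<^bsub>F\<^esub> ?g)"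
    using sn_reverse_triangle[of "star F ?g \<otimes>\<^bsub>F\<^esub> ?g" "?g \<otimes>\<^bsub>F\<^esub> ?g"] g by auto
  also have "\<rho> (star F ?g \<otimes>\<^bsub>F\<^esub> ?g \<ominus>\<^bsub>F\<^esub> ?g \<otimes>\<^bsub>F\<^esub> ?g) \<le> 0"
    using sn_mult_diff[of "star F ?g" ?g ?g ?g] g r by simp
  also have "\<rho> (?g \<otimes>\<^bsub>F\<^esub> ?g) \<le> \<rho> ?g"
    using sn_reverse_triangle[of "?g \<otimes>\<^bsub>F\<^esub> ?g" ?g] g r by auto
  finally have "\<rho> ?g * \<rho> ?g \<le> 1 * \<rho> ?g" by (simp add: power2_eq_square)
  then show ?thesis using sn_nonneg[OF g] by (cases "\<rho> ?g = 0") (auto simp: mult_le_cancel_right)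
qed

lemma cs_monomial: assumes "\<rho> \<in> cs" "w \<in> lists (G \<times> UNIV)" shows "\<rho> (monomial w) \<le> 1"
  using assms(2)
proof (induction w)
  interpret seminormed_star_algebra F \<rho> by (rule csD) fact
  case Nil
  have "\<rho> \<one>\<^bsub>F\<^esub> * \<rho> \<one>\<^bsub>F\<^esub> = \<rho> (star F \<one>\<^bsub>F\<^esub> \<otimes>\<^bsub>F\<^esub> \<one>\<^bsub>F\<^esub>)" by (subst sn_cstar) (auto simp: power2_eq_square)
  also have "\<dots> = \<rho> \<one>\<^bsub>F\<^esub>" by simp
  finally have "\<rho> \<one>\<^bsub>F\<^esub> \<le> 1" by auto
  moreover have "\<one>\<^bsub>F\<^esub> = monomial []" by (auto simp: free_star_simps nc_poly_simps monomial_def)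
  ultimately show ?case by simp
next
  interpret seminormed_star_algebra F \<rho> by (rule csD) fact
  case (Cons a w)
  obtain g b where a: "a = (g, b)" by force
  have g: "g \<in> G" using Cons a by auto
  have "[a] \<in> lists (G \<times> UNIV)" using Cons by auto
  then have m: "monomial [a] \<in> carrier F" "monomial w \<in> carrier F"
    using Cons monomial_closed[of _ "G \<times> (UNIV::bool set)"] by (auto simp: free_star_simps)
  have "monomial [a] = (if b then star F (free_gen g) else free_gen g)"
    by (simp add: a free_gen_def star_monomial)
  then have "\<rho> (monomial [a]) \<le> 1"
    using cs_gen[OF assms(1) g] free_gen_closed[OF g] by simp
  moreover have "\<rho> (monomial (a # w)) \<le> \<rho> (monomial [a]) * \<rho> (monomial w)"
    using sn_mult[OF m] by (simp add: free_star_simps monomial_mult)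
  moreover have "\<rho> (monomial [a]) * \<rho> (monomial w) \<le> 1 * 1"
    using calculation(1) Cons m by (intro mult_mono) auto
  ultimately show ?case by simp
qed

lemma cs_bdd: assumes "p \<in> carrier F" shows "bdd_above ((\<lambda>\<rho>. \<rho> p) ` cs)"
  using assms
proof (induction rule: free_star_induct)
  case zero
  have "\<rho> \<zero>\<^bsub>F\<^esub> \<le> 0" if "\<rho> \<in> cs" for \<rho>
    using seminormed_star_algebra.sn_zero[OF csD[OF that]] by simp
  then show ?case by (auto intro!: bdd_aboveI2)
next
  case (add a v p)
  then obtain B where B: "\<And>\<rho>. \<rho> \<in> cs \<Longrightarrow> \<rho> p \<le> B" by (auto simp: bdd_above_def)
  have m: "monomial v \<in> carrier F"
    using monomial_closed[OF add(1)] by (simp add: free_star_simps)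
  have "\<rho> (a \<odot>\<^bsub>F\<^esub> monomial v \<oplus>\<^bsub>F\<^esub> p) \<le> cmod a * 1 + B" if r: "\<rho> \<in> cs" for \<rho>
  proof -
    interpret seminormed_star_algebra F \<rho> by (rule csD) fact
    have "\<rho> (a \<odot>\<^bsub>F\<^esub> monomial v \<oplus>\<^bsub>F\<^esub> p) \<le> cmod a * \<rho> (monomial v) + \<rho> p"
      using sn_add[of "a \<odot>\<^bsub>F\<^esub> monomial v" p] m add by (simp add: sn_smult)
    also have "\<dots> \<le> cmod a * 1 + B"
      using B[OF r] cs_monomial[OF r add(1)] by (intro add_mono mult_left_mono) auto
    finally show ?thesis .
  qed
  then show ?case by (auto intro!: bdd_aboveI2)
qed

lemma us_upper: "\<rho> \<in> cs \<Longrightarrow> p \<in> carrier F \<Longrightarrow> \<rho> p \<le> us p"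
  unfolding universal_seminorm_def by (intro cSUP_upper cs_bdd)

lemma us_least: "(\<And>\<rho>. \<rho> \<in> cs \<Longrightarrow> \<rho> p \<le> c) \<Longrightarrow> us p \<le> c"
  unfolding universal_seminorm_def using cs_zero by (intro cSUP_least) auto

lemma us_nonneg: "p \<in> carrier F \<Longrightarrow> 0 \<le> us p"
  using us_upper[OF cs_zero] by simp

lemma cstar_seminorm_us: "cstar_seminorm F us"
  unfolding cstar_seminorm_def
proof (intro conjI ballI allI)
  fix p assume p: "p \<in> carrier F"
  have le: "us (a \<odot>\<^bsub>F\<^esub> q) \<le> cmod a * us q" if q: "q \<in> carrier F" for q a
  proof (rule us_least)
    fix \<rho> assume r: "\<rho> \<in> cs"
    show "\<rho> (a \<odot>\<^bsub>F\<^esub> q) \<le> cmod a * us q"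
      using seminormed_star_algebra.sn_smult[OF csD[OF r] q] us_upper[OF r q] by (simp add: mult_left_mono)
  qed
  show "us (a \<odot>\<^bsub>F\<^esub> p) = cmod a * us p" for a
  proof (cases "a = 0")
    case True
    then show ?thesis using le[OF p, of a] us_nonneg[of "a \<odot>\<^bsub>F\<^esub> p"] p by simp
  next
    case False
    have "us p = us (inverse a \<odot>\<^bsub>F\<^esub> (a \<odot>\<^bsub>F\<^esub> p))"
      using False p by (simp flip: F.smult_assoc)
    also have "\<dots> \<le> cmod (inverse a) * us (a \<odot>\<^bsub>F\<^esub> p)" using p by (intro le) auto
    finally have "us p \<le> us (a \<odot>\<^bsub>F\<^esub> p) / cmod a"
      by (simp add: norm_inverse divide_inverse mult.commute)
    then have "cmod a * us p \<le> us (a \<odot>\<^bsub>F\<^esub> p)"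
      using False by (simp add: pos_le_divide_eq mult.commute)
    then show ?thesis using le[OF p, of a] by simp
  qed
  show "us (star F p \<otimes>\<^bsub>F\<^esub> p) = (us p)\<^sup>2"
  proof (rule antisym)
    show "us (star F p \<otimes>\<^bsub>F\<^esub> p) \<le> (us p)\<^sup>2"
    proof (rule us_least)
      fix \<rho> assume r: "\<rho> \<in> cs"
      interpret seminormed_star_algebra F \<rho> by (rule csD) fact
      show "\<rho> (star F p \<otimes>\<^bsub>F\<^esub> p) \<le> (us p)\<^sup>2"
        using p us_upper[OF r p] by (simp add: sn_cstar power_mono)
    qed
    have "us p \<le> sqrt (us (star F p \<otimes>\<^bsub>F\<^esub> p))"
    proof (rule us_least)
      fix \<rho> assume r: "\<rho> \<in> cs"
      interpret seminormed_star_algebra F \<rho> by (rule csD) fact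
      show "\<rho> p \<le> sqrt (us (star F p \<otimes>\<^bsub>F\<^esub> p))"
        using us_upper[OF r, of "star F p \<otimes>\<^bsub>F\<^esub> p"] p by (intro real_le_rsqrt) (simp add: sn_cstar)
    qed
    then have "(us p)\<^sup>2 \<le> (sqrt (us (star F p \<otimes>\<^bsub>F\<^esub> p)))\<^sup>2" by (intro power_mono us_nonneg p)
    then show "(us p)\<^sup>2 \<le> us (star F p \<otimes>\<^bsub>F\<^esub> p)" using us_nonneg p by simp
  qed
next
  fix p q assume pq: "p \<in> carrier F" "q \<in> carrier F"
  show "us (p \<oplus>\<^bsub>F\<^esub> q) \<le> us p + us q"
  proof (rule us_least)
    fix \<rho> assume r: "\<rho> \<in> cs"
    show "\<rho> (p \<oplus>\<^bsub>F\<^esub> q) \<le> us p + us q"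
      using seminormed_star_algebra.sn_add[OF csD[OF r] pq] pq[THEN us_upper[OF r]] by linarith
  qed
  show "us (p \<otimes>\<^bsub>F\<^esub> q) \<le> us p * us q"
  proof (rule us_least)
    fix \<rho> assume r: "\<rho> \<in> cs"
    have "\<rho> p * \<rho> q \<le> us p * us q"
      using pq seminormed_star_algebra.sn_nonneg[OF csD[OF r]] us_nonneg us_upper[OF r]
      by (intro mult_mono) auto
    then show "\<rho> (p \<otimes>\<^bsub>F\<^esub> q) \<le> us p * us q"
      using seminormed_star_algebra.sn_mult[OF csD[OF r] pq] by linarith
  qed
qed (rule us_nonneg)

sublocale S: seminormed_star_algebra F us
  by (intro seminormed_star_algebra.intro star_algebra_free_star seminormed_star_algebra_axioms.intro
      cstar_seminorm_us)

theorem unital_cstar_algebra_universal: "unital_cstar_algebra (universal_cstar G R)"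
  unfolding universal_cstar_def by (rule S.unital_cstar_algebra_completion)

sublocale U: unital_cstar_algebra "universal_cstar G R"
  by (rule unital_cstar_algebra_universal)

lemma universal_hom: "unital_star_hom F (universal_cstar G R) (\<lambda>p. S.cl (\<lambda>m. p))"
  unfolding unital_star_hom_def universal_cstar_def by (auto simp: S.Cm_ops)

lemma universal_gen_closed: "g \<in> G \<Longrightarrow> universal_gen G R g \<in> carrier (universal_cstar G R)"
  unfolding universal_gen_def universal_cstar_def by (simp add: S.Cm_cl free_gen_closed)

lemma universal_eval:
  "p \<in> carrier F \<Longrightarrow> star_poly_eval (universal_cstar G R) (universal_gen G R) p = S.cl (\<lambda>m. p)"
  using star_hom_free_unique[OF U.star_algebra_axioms universal_hom, of p]
  by (simp flip: universal_gen_def)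

theorem universal_relations:
  assumes "(l, r) \<in> R"
  shows "star_poly_eval (universal_cstar G R) (universal_gen G R) l =
    star_poly_eval (universal_cstar G R) (universal_gen G R) r"
proof -
  have lr: "l \<in> carrier F" "r \<in> carrier F" using rels assms by auto
  have "us (l \<ominus>\<^bsub>F\<^esub> r) \<le> 0" by (rule us_least) (simp add: cs_rel[OF _ assms])
  then have "us (l \<ominus>\<^bsub>F\<^esub> r) = 0" using us_nonneg lr by (simp add: antisym)
  then show ?thesis using lr by (simp add: universal_eval S.cl_eq_iff)
qed

theorem universal_dense:
  assumes "y \<in> carrier (universal_cstar G R)" "e > 0"
  shows "\<exists>p\<in>carrier F. cnorm (universal_cstar G R)
    (y \<ominus>\<^bsub>universal_cstar G R\<^esub> star_poly_eval (universal_cstar G R) (universal_gen G R) p) < e"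
proof -
  obtain s where s: "S.cau s" "y = S.cl s"
    using assms(1) unfolding universal_cstar_def by (metis S.Cm_E)
  obtain N where N: "\<And>j. j \<ge> N \<Longrightarrow> norm (cnorm S.Cm (S.cl s \<ominus>\<^bsub>S.Cm\<^esub> S.cl (\<lambda>k. s j)) - 0) < e"
    using LIMSEQ_D[OF S.Cm_dense_lim[OF s(1)] assms(2)] by auto
  have "cnorm S.Cm (S.cl s \<ominus>\<^bsub>S.Cm\<^esub> S.cl (\<lambda>k. s N)) < e"
    using N[OF order_refl] unfolding real_norm_def by linarith
  then show ?thesis
    using universal_eval[OF S.cauD[OF s(1), of N]] S.cauD[OF s(1), of N] s(2)
    unfolding universal_cstar_def by metis
qed

theorem universal_property:
  assumes B: "unital_cstar_algebra B" and b: "\<And>g. g \<in> G \<Longrightarrow> b g \<in> carrier B"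
    and brel: "\<And>l r. (l, r) \<in> R \<Longrightarrow> star_poly_eval B b l = star_poly_eval B b r"
  shows "\<exists>h. unital_star_hom (universal_cstar G R) B h \<and> (\<forall>g\<in>G. h (universal_gen G R g) = b g)"
proof -
  interpret B: unital_cstar_algebra B by fact
  let ?\<pi> = "star_poly_eval B b"
  have b': "b \<in> G \<rightarrow> carrier B" using b by auto
  have pi: "unital_star_hom F B ?\<pi>" by (rule B.star_poly_eval_hom[OF b'])
  have pic: "?\<pi> p \<in> carrier B" if "p \<in> carrier F" for p
    using pi that by (auto simp: unital_star_hom_def)
  have pim: "?\<pi> (p \<ominus>\<^bsub>F\<^esub> q) = ?\<pi> p \<ominus>\<^bsub>B\<^esub> ?\<pi> q" if "p \<in> carrier F" "q \<in> carrier F" for p q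
    by (rule star_hom_minus[OF star_algebra_free_star B.star_algebra_axioms pi that])
  have sn: "cstar_seminorm F (\<lambda>p. cnorm B (?\<pi> p))"
    unfolding cstar_seminorm_def
    using pi pic by (simp add: unital_star_hom_def B.sn_smult B.sn_add B.sn_mult B.sn_cstar)
  have "(\<lambda>p. cnorm B (?\<pi> p)) \<in> cs"
    unfolding compatible_seminorms_def
  proof (intro CollectI conjI sn ballI, clarify)
    fix l r assume lr: "(l, r) \<in> R"
    then have "l \<in> carrier F" "r \<in> carrier F" using rels by auto
    then show "cnorm B (?\<pi> (l \<ominus>\<^bsub>F\<^esub> r)) = 0" using brel[OF lr] pic by (simp add: pim)
  qed
  then have bd: "cnorm B (?\<pi> p) \<le> us p" if "p \<in> carrier F" for p using us_upper that by blast
  have cau: "B.cau (\<lambda>m. ?\<pi> (s m))" if s: "S.cau s" for s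
    unfolding cauchy_in_def
  proof (intro conjI allI impI)
    show "?\<pi> (s m) \<in> carrier B" for m using S.cauD[OF s] by (rule pic)
    fix e :: real assume "e > 0"
    then obtain N where N: "\<forall>m\<ge>N. \<forall>k\<ge>N. us (s m \<ominus>\<^bsub>F\<^esub> s k) < e" using S.cauE[OF s] by blast
    have "cnorm B (?\<pi> (s m) \<ominus>\<^bsub>B\<^esub> ?\<pi> (s k)) < e" if "m \<ge> N" "k \<ge> N" for m k
      using bd[of "s m \<ominus>\<^bsub>F\<^esub> s k"] N that S.cauD[OF s] by (fastforce simp: pim)
    then show "\<exists>N. \<forall>m\<ge>N. \<forall>k\<ge>N. cnorm B (?\<pi> (s m) \<ominus>\<^bsub>B\<^esub> ?\<pi> (s k)) < e" by blast
  qed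
  have eqv: "(\<lambda>m. cnorm B (?\<pi> (s m) \<ominus>\<^bsub>B\<^esub> ?\<pi> (t m))) \<longlonglongrightarrow> 0"
    if "S.cau s" "S.cau t" "S.cl s = S.cl t" for s t
  proof (rule B.eqvI)
    show "(\<lambda>m. us (s m \<ominus>\<^bsub>F\<^esub> t m)) \<longlonglongrightarrow> 0" using that S.cl_eq_iff by blast
    show "cnorm B (?\<pi> (s m) \<ominus>\<^bsub>B\<^esub> ?\<pi> (t m)) \<le> us (s m \<ominus>\<^bsub>F\<^esub> t m)" for m
      using bd[of "s m \<ominus>\<^bsub>F\<^esub> t m"] that(1,2)[THEN S.cauD] by (simp add: pim)
  qed (use that(1,2)[THEN S.cauD] pic in auto)
  define lm where "lm s y \<longleftrightarrow> y \<in> carrier B \<and> (\<lambda>m. cnorm B (?\<pi> (s m) \<ominus>\<^bsub>B\<^esub> y)) \<longlonglongrightarrow> 0" for s y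
  have uniq: "y = z" if "S.cau s" "S.cau t" "S.cl s = S.cl t" "lm s y" "lm t z" for s t y z
  proof -
    have c: "B.cau (\<lambda>m. y)" "B.cau (\<lambda>m. z)" using that by (auto simp: lm_def)
    have "B.eqv (\<lambda>m. y) (\<lambda>m. z)"
      using B.eqv_trans[OF c(1) cau[OF that(1)] c(2) B.eqv_sym[OF cau[OF that(1)] c(1)]
          B.eqv_trans[OF cau[OF that(1)] cau[OF that(2)] c(2) eqv[OF that(1-3)]]] that(4,5)
      unfolding lm_def by blast
    then have "cnorm B (y \<ominus>\<^bsub>B\<^esub> z) = 0" by (simp add: LIMSEQ_const_iff)
    moreover have yz: "y \<in> carrier B" "z \<in> carrier B" using that by (auto simp: lm_def)
    ultimately have "y \<ominus>\<^bsub>B\<^esub> z = \<zero>\<^bsub>B\<^esub>" by (intro B.norm_definite) auto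
    then show ?thesis using yz using B.minus_equality[of y "\<ominus>\<^bsub>B\<^esub> z"] by (simp add: a_minus_def)
  qed
  have ex: "\<exists>y. lm s y" if "S.cau s" for s
    using B.complete[OF cau[OF that]] by (auto simp: lm_def)
  define h where "h Y = (SOME y. \<exists>s. S.cau s \<and> Y = S.cl s \<and> lm s y)" for Y
  have hl: "h (S.cl s) = y" if "S.cau s" "lm s y" for s y
  proof -
    have "\<exists>t. S.cau t \<and> S.cl s = S.cl t \<and> lm t (h (S.cl s))"
      unfolding h_def by (rule someI[of _ y]) (use that in blast)
    then show ?thesis using uniq that by metis
  qed
  have lh: "lm s (h (S.cl s))" if "S.cau s" for s
    using hl[OF that] ex[OF that] by metis
  have lc: "B.cau (\<lambda>m. h (S.cl s))" if "S.cau s" for s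
    using lh[OF that] by (auto simp: lm_def)
  have lt: "B.eqv (\<lambda>m. ?\<pi> (s m)) (\<lambda>m. h (S.cl s))" if "S.cau s" for s
    using lh[OF that] by (auto simp: lm_def)
  have const: "h (S.cl (\<lambda>m. p)) = ?\<pi> p" if "p \<in> carrier F" for p
    using that pic by (intro hl) (auto simp: lm_def)
  have hc: "h (S.cl s) \<in> carrier B" if "S.cau s" for s using lh[OF that] by (simp add: lm_def)
  have "unital_star_hom S.Cm B h"
    unfolding unital_star_hom_def
  proof (intro conjI ballI allI)
    show "h \<in> carrier S.Cm \<rightarrow> carrier B" using hc by (auto simp: S.Cm_carrier)
    show "h \<one>\<^bsub>S.Cm\<^esub> = \<one>\<^bsub>B\<^esub>" using pi by (simp add: S.Cm_one const unital_star_hom_def)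
  next
    fix x y assume "x \<in> carrier S.Cm" "y \<in> carrier S.Cm"
    then obtain s t where st: "S.cau s" "S.cau t" and [simp]: "x = S.cl s" "y = S.cl t"
      by (metis S.Cm_E)
    note c = st[THEN S.cauD]
    show "h (x \<oplus>\<^bsub>S.Cm\<^esub> y) = h x \<oplus>\<^bsub>B\<^esub> h y"
      using B.eqv_add[OF cau[OF st(1)] cau[OF st(2)] lc[OF st(1)] lc[OF st(2)] lt[OF st(1)] lt[OF st(2)]]
        st hc pi c by (simp add: S.Cm_ops, intro hl) (auto simp: lm_def S.Cm_ops unital_star_hom_def)
    show "h (x \<otimes>\<^bsub>S.Cm\<^esub> y) = h x \<otimes>\<^bsub>B\<^esub> h y"
      using B.eqv_mult[OF cau[OF st(1)] cau[OF st(2)] lc[OF st(1)] lc[OF st(2)] lt[OF st(1)] lt[OF st(2)]]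
        st hc pi c by (simp add: S.Cm_ops, intro hl) (auto simp: lm_def S.Cm_ops unital_star_hom_def)
  next
    fix x a assume "x \<in> carrier S.Cm"
    then obtain s where st: "S.cau s" and [simp]: "x = S.cl s"
      by (metis S.Cm_E)
    note c = st[THEN S.cauD]
    show "h (a \<odot>\<^bsub>S.Cm\<^esub> x) = a \<odot>\<^bsub>B\<^esub> h x"
      using B.eqv_smult[OF cau[OF st] lc[OF st] lt[OF st], of a]
        st hc pi c by (simp add: S.Cm_ops, intro hl) (auto simp: lm_def S.Cm_ops unital_star_hom_def)
    show "h (star S.Cm x) = star B (h x)"
      using B.eqv_star[OF cau[OF st] lc[OF st] lt[OF st]]
        st hc pi c by (simp add: S.Cm_ops, intro hl) (auto simp: lm_def S.Cm_ops unital_star_hom_def)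
  qed
  moreover have "h (universal_gen G R g) = b g" if g: "g \<in> G" for g
  proof -
    have "?\<pi> (free_gen g) = b g"
      by (rule B.star_poly_eval_gen[OF b' g])
    then show ?thesis unfolding universal_gen_def using const free_gen_closed[OF g] by simp
  qed
  ultimately show ?thesis unfolding universal_cstar_def by blast
qed

end

lemma bounded_presentation_A_s: "bounded_presentation (A_s_gens n) (A_s_rels n)"
  and bounded_presentation_B_s: "bounded_presentation (B_s_gens n) (B_s_rels n)"
  and bounded_presentation_A_i: "bounded_presentation (A_i_gens n k) (A_i_rels n k)"
  and bounded_presentation_B_i: "bounded_presentation (B_i_gens n k) (B_i_rels n k)"
proof -
  have p: "projection_relations G \<subseteq> carrier (free_star G) \<times> carrier (free_star G)" for G :: "qgen set"
  proof -
    interpret star_algebra "free_star G" by (rule star_algebra_free_star)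
    show ?thesis by (auto simp: projection_relations_def free_gen_closed)
  qed
  show "bounded_presentation (A_s_gens n) (A_s_rels n)"
  proof
    interpret star_algebra "free_star (A_s_gens n)" by (rule star_algebra_free_star)
    have [simp]: "i \<in> {1..n} \<Longrightarrow> j \<in> {1..n} \<Longrightarrow> free_gen (Ugen i j) \<in> carrier (free_star (A_s_gens n))" for i j
      by (rule free_gen_closed) (auto simp: A_s_gens_def)
    show "A_s_rels n \<subseteq> carrier (free_star (A_s_gens n)) \<times> carrier (free_star (A_s_gens n))"
      unfolding A_s_rels_def Let_def using p by (auto intro!: finsum_closed simp del: atLeastAtMost_iff)
  qed (auto simp: A_s_rels_def Let_def)
  show "bounded_presentation (B_s_gens n) (B_s_rels n)"
  proof
    interpret star_algebra "free_star (B_s_gens n)" by (rule star_algebra_free_star)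
    have [simp]: "i \<in> {1..n} \<Longrightarrow> j \<in> {1..n} \<Longrightarrow> free_gen (Ugen i j) \<in> carrier (free_star (B_s_gens n))" for i j
      by (rule free_gen_closed) (auto simp: B_s_gens_def)
    have [simp]: "free_gen Pgen \<in> carrier (free_star (B_s_gens n))"
      by (rule free_gen_closed) (auto simp: B_s_gens_def)
    show "B_s_rels n \<subseteq> carrier (free_star (B_s_gens n)) \<times> carrier (free_star (B_s_gens n))"
      unfolding B_s_rels_def Let_def using p by (auto intro!: finsum_closed simp del: atLeastAtMost_iff)
  qed (auto simp: B_s_rels_def Let_def)
  show "bounded_presentation (A_i_gens n k) (A_i_rels n k)"
  proof
    interpret star_algebra "free_star (A_i_gens n k)" by (rule star_algebra_free_star)
    have [simp]: "i \<in> {1..n} \<Longrightarrow> j \<in> {1..k} \<Longrightarrow> free_gen (Ugen i j) \<in> carrier (free_star (A_i_gens n k))" for i j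
      by (rule free_gen_closed) (auto simp: A_i_gens_def)
    show "A_i_rels n k \<subseteq> carrier (free_star (A_i_gens n k)) \<times> carrier (free_star (A_i_gens n k))"
      unfolding A_i_rels_def Let_def using p by (auto intro!: finsum_closed simp del: atLeastAtMost_iff)
  qed (auto simp: A_i_rels_def Let_def)
  show "bounded_presentation (B_i_gens n k) (B_i_rels n k)"
  proof
    interpret star_algebra "free_star (B_i_gens n k)" by (rule star_algebra_free_star)
    have [simp]: "i \<in> {1..n} \<Longrightarrow> j \<in> {1..k} \<Longrightarrow> free_gen (Ugen i j) \<in> carrier (free_star (B_i_gens n k))" for i j
      by (rule free_gen_closed) (auto simp: B_i_gens_def)
    have [simp]: "free_gen Pgen \<in> carrier (free_star (B_i_gens n k))"
      by (rule free_gen_closed) (auto simp: B_i_gens_def)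
    show "B_i_rels n k \<subseteq> carrier (free_star (B_i_gens n k)) \<times> carrier (free_star (B_i_gens n k))"
      unfolding B_i_rels_def Let_def using p by (auto intro!: finsum_closed simp del: atLeastAtMost_iff)
  qed (auto simp: B_i_rels_def Let_def)
qed

end

theory Submission
  imports Defs "HOL-Analysis.L2_Norm"
begin

text \<open>
  For a word \<open>w = j\<^sub>1 \<dots> j\<^sub>m\<close> the coaction identity reads
  \<open>\<phi>(x\<^sub>w) = \<Sum>\<^sub>i \<phi>(x\<^sub>i) u\<^bsub>i\<^sub>1 j\<^sub>1\<^esub> \<dots> u\<^bsub>i\<^sub>m j\<^sub>m\<^esub>\<close>, compressed by \<open>P\<close> in the boolean case.

  Quantum case. Think of the generators of \<open>A\<^sub>i(n,k)\<close> as the events \<open>X\<^sub>j = i\<close> for an increasing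
  sequence \<open>X\<^sub>1 < \<dots> < X\<^sub>k\<close>. Adjoining the events that the \<open>m\<close>-th element of the complement
  of \<open>{X\<^sub>1, \<dots>, X\<^sub>k}\<close> is \<open>i\<close> gives an \<open>n \<times> n\<close> matrix of projections whose rows and columns sum
  to one (Curran). Projections in a C*-algebra that sum to one are mutually orthogonal, so this
  matrix defines a homomorphism \<open>A\<^sub>s(n) \<rightarrow> A\<^sub>i(n,k)\<close> that transports the identity.

  Boolean case. The relations of \<open>B\<^sub>i(n,k)\<close> do not make the projections in one column orthogonal,
  so in general there is no homomorphism \<open>B\<^sub>s(n) \<rightarrow> B\<^sub>i(n,k)\<close> with \<open>u\<^sub>i\<^sub>j \<mapsto> u\<^sub>i\<^sub>j\<close>. Instead, a
  representation of \<open>B\<^sub>s(n)\<close> by rank one projections turns exchangeability into the statement that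
  \<open>\<phi>(x\<^sub>w)\<close> is the average of \<open>\<phi>(x\<^sub>i)\<close> over the words \<open>i\<close> in which the same neighbouring letters agree
  as in \<open>w\<close>; hence \<open>\<phi>(x\<^sub>w)\<close> depends only on this pattern of agreements. For such moments the
  compressed identity in \<open>B\<^sub>i(n,k)\<close> follows by summing out one letter at a time with
  \<open>\<Sum>\<^sub>i P u\<^sub>i\<^sub>j = P\<close> and \<open>u\<^sub>i\<^sub>j u\<^sub>i\<^sub>j\<^sub>' = 0\<close> for \<open>j \<noteq> j'\<close>.
\<close>

\<comment> \<open>Keeps the simplifier from rewriting \<open>{1..n}\<close> to \<open>{Suc 0..n}\<close>.\<close>
declare One_nat_def [simp del]

section \<open>Star algebras\<close>

lemma (in abelian_monoid) finsum_swap: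
  assumes "finite I" "finite J" "\<And>i j. i \<in> I \<Longrightarrow> j \<in> J \<Longrightarrow> f i j \<in> carrier G"
  shows "(\<Oplus>i\<in>I. \<Oplus>j\<in>J. f i j) = (\<Oplus>j\<in>J. \<Oplus>i\<in>I. f i j)"
  using assms(1,3)
proof (induction I)
  case empty
  then show ?case by simp
next
  case (insert i I)
  have "(\<Oplus>i\<in>insert i I. \<Oplus>j\<in>J. f i j) = (\<Oplus>j\<in>J. f i j) \<oplus> (\<Oplus>j\<in>J. \<Oplus>i\<in>I. f i j)"
    using insert by (subst finsum_insert) (auto intro!: finsum_closed)
  also have "\<dots> = (\<Oplus>j\<in>J. f i j \<oplus> (\<Oplus>i\<in>I. f i j))"
    using insert by (intro finsum_addf[symmetric]) (auto intro!: finsum_closed)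
  also have "\<dots> = (\<Oplus>j\<in>J. \<Oplus>i\<in>insert i I. f i j)"
    using insert by (intro finsum_cong') (auto intro!: finsum_closed)
  finally show ?case .
qed

lemma (in abelian_group) finsum_telescope:
  assumes "\<And>p. p \<le> Suc k \<Longrightarrow> g p \<in> carrier G"
  shows "(\<Oplus>p\<in>{..k}. g p \<ominus> g (Suc p)) = g 0 \<ominus> g (Suc k)"
  using assms
proof (induction k)
  case 0
  then show ?case by simp
next
  case (Suc k)
  have "(\<Oplus>p\<in>{..Suc k}. g p \<ominus> g (Suc p)) = (g (Suc k) \<ominus> g (Suc (Suc k))) \<oplus> (g 0 \<ominus> g (Suc k))"
    using Suc by (subst finsum_Suc) auto
  also have "\<dots> = (g 0 \<ominus> g (Suc (Suc k))) \<oplus> (g (Suc k) \<ominus> g (Suc k))"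
    using Suc.prems by (simp add: a_minus_def a_ac)
  finally show ?case using Suc.prems by (simp add: r_neg a_minus_def)
qed

lemma (in complex_algebra) sum_smult:
  "finite I \<Longrightarrow> y \<in> carrier A \<Longrightarrow> (\<Oplus>i\<in>I. c i \<odot> y) = (\<Sum>i\<in>I. c i) \<odot> y"
  by (induction I rule: finite_induct) (auto simp: smult_l_distr)

lemma (in star_algebra) star_zero [simp]: "star A \<zero> = \<zero>"
  using star_smult[of \<zero> 0] by simp

lemma (in star_algebra) star_finsum:
  "finite I \<Longrightarrow> f \<in> I \<rightarrow> carrier A \<Longrightarrow> star A (\<Oplus>i\<in>I. f i) = (\<Oplus>i\<in>I. star A (f i))"
  by (induction I rule: finite_induct) (auto simp: Pi_def star_add)

lemma (in star_algebra) star_one [simp]: "star A \<one> = \<one>"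
proof -
  have "star A \<one> = star A \<one> \<otimes> star A (star A \<one>)" by simp
  also have "\<dots> = star A (star A \<one> \<otimes> \<one>)" by (subst star_mult) auto
  finally show ?thesis by simp
qed

definition (in star_algebra) projection :: "'a \<Rightarrow> bool" where
  "projection p \<longleftrightarrow> p \<in> carrier A \<and> p \<otimes> p = p \<and> star A p = p"

lemma (in star_algebra) projection_closed: "projection p \<Longrightarrow> p \<in> carrier A"
  by (simp add: projection_def)

lemma (in star_algebra) projection_orthogonal_sym:
  assumes "projection p" "projection q" "p \<otimes> q = \<zero>"
  shows "q \<otimes> p = \<zero>"
proof -
  have "star A (p \<otimes> q) = \<zero>" using assms(3) by simp
  then show ?thesis using assms(1,2) by (simp add: projection_def star_mult)
qed

lemma (in star_algebra) projection_finsum: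
  assumes "finite I" "\<And>i. i \<in> I \<Longrightarrow> projection (p i)"
    and "\<And>i j. i \<in> I \<Longrightarrow> j \<in> I \<Longrightarrow> i \<noteq> j \<Longrightarrow> p i \<otimes> p j = \<zero>"
  shows "projection (\<Oplus>i\<in>I. p i)"
  using assms
proof (induction I rule: finite_induct)
  case empty
  then show ?case by (simp add: projection_def)
next
  case (insert i I)
  have pc: "p l \<in> carrier A" if "l \<in> insert i I" for l using insert.prems(1)[OF that] by (simp add: projection_def)
  let ?s = "\<Oplus>l\<in>I. p l"
  have s: "projection ?s" using insert by auto
  have "p i \<otimes> ?s = (\<Oplus>l\<in>I. p i \<otimes> p l)" using insert(1) pc by (intro finsum_rdistr) auto
  also have "\<dots> = (\<Oplus>l\<in>I. \<zero>)" using insert by (intro finsum_cong') auto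
  finally have z: "p i \<otimes> ?s = \<zero>" by simp
  moreover have "?s \<otimes> p i = \<zero>"
    by (rule projection_orthogonal_sym[OF insert.prems(1)[OF insertI1] s z])
  moreover have "(\<Oplus>l\<in>insert i I. p l) = p i \<oplus> ?s" using insert pc by (intro finsum_insert) auto
  ultimately show ?case
    using s insert.prems(1)[of i] by (simp add: projection_def l_distr r_distr star_add)
qed

lemma star_hom_finsum:
  assumes "star_algebra A" "star_algebra B" "unital_star_hom A B h" "finite I" "f \<in> I \<rightarrow> carrier A"
  shows "h (\<Oplus>\<^bsub>A\<^esub>i\<in>I. f i) = (\<Oplus>\<^bsub>B\<^esub>i\<in>I. h (f i))"
proof -
  interpret A: star_algebra A by fact
  interpret B: star_algebra B by fact
  note h = assms(3)[unfolded unital_star_hom_def]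
  have "h (0 \<odot>\<^bsub>A\<^esub> \<zero>\<^bsub>A\<^esub>) = 0 \<odot>\<^bsub>B\<^esub> h \<zero>\<^bsub>A\<^esub>" using h by blast
  then have z: "h \<zero>\<^bsub>A\<^esub> = \<zero>\<^bsub>B\<^esub>" using h by (simp add: Pi_def)
  show ?thesis using assms(4,5)
  proof (induction I rule: finite_induct)
    case empty
    then show ?case by (simp add: z)
  next
    case (insert i I)
    then have "h (\<Oplus>\<^bsub>A\<^esub>i\<in>insert i I. f i) = h (f i) \<oplus>\<^bsub>B\<^esub> (\<Oplus>\<^bsub>B\<^esub>i\<in>I. h (f i))"
      using h by (auto simp: Pi_def intro!: A.finsum_closed)
    also have "\<dots> = (\<Oplus>\<^bsub>B\<^esub>i\<in>insert i I. h (f i))"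
      using insert h by (intro B.finsum_insert[symmetric]) (auto simp: Pi_def)
    finally show ?case .
  qed
qed

section \<open>Evaluating the relations of a presentation\<close>

context star_algebra
begin

context
  fixes G :: "'g set" and x
  assumes x: "x \<in> G \<rightarrow> carrier A"
begin

text \<open>Together with \<open>star_poly_eval_gen\<close>, these cover the shapes of all elements
  in the defining relations of \<open>A_s\<close>, \<open>B_s\<close>, \<open>A_i\<close> and
  \<open>B_i\<close>. They serve to check the relations for a concrete family before the universal
  property is applied, and to read off the relations of the universal generators.\<close>

lemma star_poly_eval_simps:
  shows "star_poly_eval A x \<zero>\<^bsub>free_star G\<^esub> = \<zero>"
    and "star_poly_eval A x \<one>\<^bsub>free_star G\<^esub> = \<one>"
    and "g \<in> G \<Longrightarrow> g' \<in> G \<Longrightarrow>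
      star_poly_eval A x (free_gen g \<otimes>\<^bsub>free_star G\<^esub> free_gen g') = x g \<otimes> x g'"
    and "g \<in> G \<Longrightarrow> star_poly_eval A x (star (free_star G) (free_gen g)) = star A (x g)"
    and "finite I \<Longrightarrow> (\<And>i. i \<in> I \<Longrightarrow> c i \<in> G) \<Longrightarrow>
      star_poly_eval A x (\<Oplus>\<^bsub>free_star G\<^esub>i\<in>I. free_gen (c i)) = (\<Oplus>i\<in>I. x (c i))"
    and "finite I \<Longrightarrow> (\<And>i. i \<in> I \<Longrightarrow> c i \<in> G) \<Longrightarrow> g \<in> G \<Longrightarrow>
      star_poly_eval A x (\<Oplus>\<^bsub>free_star G\<^esub>i\<in>I. free_gen (c i) \<otimes>\<^bsub>free_star G\<^esub> free_gen g) =
      (\<Oplus>i\<in>I. x (c i) \<otimes> x g)"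
proof -
  interpret F: star_algebra "free_star G" by (rule star_algebra_free_star)
  note h = star_poly_eval_hom[OF x]
  note h' = h[unfolded unital_star_hom_def]
  note fin = star_hom_finsum[OF F.star_algebra_axioms star_algebra_axioms h]
  have xg: "x g \<in> carrier A" if "g \<in> G" for g using x that by blast
  show zero: "star_poly_eval A x \<zero>\<^bsub>free_star G\<^esub> = \<zero>" using fin[of "{}"] by simp
  show "star_poly_eval A x \<one>\<^bsub>free_star G\<^esub> = \<one>" using h' by blast
  show mult: "star_poly_eval A x (free_gen g \<otimes>\<^bsub>free_star G\<^esub> free_gen g') = x g \<otimes> x g'"
    if "g \<in> G" "g' \<in> G" for g g'
    using h' that by (simp add: free_gen_closed star_poly_eval_gen[OF x])
  show "star_poly_eval A x (star (free_star G) (free_gen g)) = star A (x g)" if "g \<in> G"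
    using h' that by (simp add: free_gen_closed star_poly_eval_gen[OF x])
  assume I: "finite I" "\<And>i. i \<in> I \<Longrightarrow> c i \<in> G"
  show "star_poly_eval A x (\<Oplus>\<^bsub>free_star G\<^esub>i\<in>I. free_gen (c i)) = (\<Oplus>i\<in>I. x (c i))"
    using I by (subst fin) (auto simp: free_gen_closed star_poly_eval_gen[OF x] xg intro!: finsum_cong')
  assume "g \<in> G"
  then show "star_poly_eval A x (\<Oplus>\<^bsub>free_star G\<^esub>i\<in>I. free_gen (c i) \<otimes>\<^bsub>free_star G\<^esub> free_gen g) =
      (\<Oplus>i\<in>I. x (c i) \<otimes> x g)"
    using I by (subst fin) (auto simp: free_gen_closed mult xg intro!: finsum_cong')
qed

end

end

context bounded_presentation
begin

lemma universal_gen_funcset: "universal_gen G R \<in> G \<rightarrow> carrier (universal_cstar G R)"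
  using universal_gen_closed by blast

lemmas universal_gen_eval =
  U.star_poly_eval_simps[OF universal_gen_funcset] U.star_poly_eval_gen[OF universal_gen_funcset]

lemma universal_gen_projection:
  assumes "g \<in> G"
  shows "universal_gen G R g \<otimes>\<^bsub>universal_cstar G R\<^esub> universal_gen G R g = universal_gen G R g"
    and "star (universal_cstar G R) (universal_gen G R g) = universal_gen G R g"
proof -
  have "(free_gen g \<otimes>\<^bsub>F\<^esub> free_gen g, free_gen g) \<in> R" "(star F (free_gen g), free_gen g) \<in> R"
    using proj assms by (auto simp: projection_relations_def)
  from this[THEN universal_relations] show
    "universal_gen G R g \<otimes>\<^bsub>universal_cstar G R\<^esub> universal_gen G R g = universal_gen G R g"
    "star (universal_cstar G R) (universal_gen G R g) = universal_gen G R g"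
    using assms by (simp_all add: universal_gen_eval)
qed

end

section \<open>The coaction on words\<close>

text \<open>The sum of \<open>f i\<close> times u_{i_1 j_1} ... u_{i_m j_m} over all index words i,
  with the first letter factored out at each stage. In the applications \<open>f\<close> gives the
  moments, and the recursion lets the later arguments peel letters off the left end.\<close>

primrec word_sum ::
    "(complex, 'c, 'm) module_scheme \<Rightarrow> nat \<Rightarrow> (nat \<Rightarrow> nat \<Rightarrow> 'c) \<Rightarrow> nat list \<Rightarrow> (nat list \<Rightarrow> complex) \<Rightarrow> 'c" where
  "word_sum C n u [] f = f [] \<odot>\<^bsub>C\<^esub> \<one>\<^bsub>C\<^esub>"
| "word_sum C n u (j # w) f = (\<Oplus>\<^bsub>C\<^esub>a\<in>{1..n}. u a j \<otimes>\<^bsub>C\<^esub> word_sum C n u w (\<lambda>i. f (a # i)))"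

text \<open>The image of the variable X_j under the coaction.\<close>

abbreviation generic_column ::
    "(complex, 'c, 'm) module_scheme \<Rightarrow> nat \<Rightarrow> (nat \<Rightarrow> nat \<Rightarrow> 'c) \<Rightarrow> nat \<Rightarrow> nat list \<Rightarrow> 'c" where
  "generic_column C n u j \<equiv> \<Oplus>\<^bsub>nc_poly {1..n} C\<^esub>i\<in>{1..n}. elem_tensor C (monomial [i]) (u i j)"

abbreviation words :: "nat \<Rightarrow> nat \<Rightarrow> nat list set" where
  "words n m \<equiv> {i \<in> lists {1..n}. length i = m}"

lemma finite_words: "finite (words n m)"
  using finite_lists_length_eq[of "{1..n}" m] by (simp add: lists_eq_set)

context complex_algebra
begin

lemma elem_tensor_closed:
  "i \<in> {1..n} \<Longrightarrow> c \<in> carrier A \<Longrightarrow> elem_tensor A (monomial [i]) c \<in> carrier (nc_poly {1..n} A)"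
  by (auto simp: elem_tensor_def monomial_def nc_poly_simps intro: finite_subset[of _ "{[i]}"])

lemma tensor_id_superset:
  assumes "finite S" "{w. F w \<noteq> \<zero>} \<subseteq> S" "\<And>w. F w \<in> carrier A"
  shows "tensor_id A \<mu> F = (\<Oplus>w\<in>S. \<mu> (monomial w) \<odot> F w)"
  unfolding tensor_id_def
  by (rule add.finprod_mono_neutral_cong_left) (use assms in auto)

lemma tensor_id_add:
  assumes "F \<in> carrier (nc_poly V A)" "H \<in> carrier (nc_poly V A)"
  shows "tensor_id A \<mu> (\<lambda>w. F w \<oplus> H w) = tensor_id A \<mu> F \<oplus> tensor_id A \<mu> H"
proof -
  let ?S = "{w. F w \<noteq> \<zero>} \<union> {w. H w \<noteq> \<zero>}"
  have c: "finite ?S" "\<And>w. F w \<in> carrier A" "\<And>w. H w \<in> carrier A"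
    using assms by (auto simp: nc_poly_simps)
  have "tensor_id A \<mu> (\<lambda>w. F w \<oplus> H w) = (\<Oplus>w\<in>?S. \<mu> (monomial w) \<odot> (F w \<oplus> H w))"
    by (rule tensor_id_superset) (use c in auto)
  also have "\<dots> = (\<Oplus>w\<in>?S. \<mu> (monomial w) \<odot> F w) \<oplus> (\<Oplus>w\<in>?S. \<mu> (monomial w) \<odot> H w)"
    using c by (simp add: smult_r_distr finsum_addf)
  also have "\<dots> = tensor_id A \<mu> F \<oplus> tensor_id A \<mu> H"
    using c by (subst (1 2) tensor_id_superset[of ?S]) auto
  finally show ?thesis .
qed

lemma tensor_id_smult:
  assumes "F \<in> carrier (nc_poly V A)"
  shows "tensor_id A \<mu> (\<lambda>w. a \<odot> F w) = a \<odot> tensor_id A \<mu> F"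
proof -
  let ?S = "{w. F w \<noteq> \<zero>}"
  have c: "finite ?S" "\<And>w. F w \<in> carrier A" using assms by (auto simp: nc_poly_simps)
  have "tensor_id A \<mu> (\<lambda>w. a \<odot> F w) = (\<Oplus>w\<in>?S. \<mu> (monomial w) \<odot> (a \<odot> F w))"
    by (rule tensor_id_superset) (use c in auto)
  also have "\<dots> = a \<odot> tensor_id A \<mu> F"
    using c by (simp add: tensor_id_def finsum_smult flip: smult_assoc) (simp add: mult.commute)
  finally show ?thesis .
qed

context
  fixes n :: nat and V :: "nat set" and u :: "nat \<Rightarrow> nat \<Rightarrow> 'a"
  assumes u: "\<And>i j. i \<in> {1..n} \<Longrightarrow> j \<in> V \<Longrightarrow> u i j \<in> carrier A"
begin

lemma word_sum_closed: "w \<in> lists V \<Longrightarrow> word_sum A n u w f \<in> carrier A"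
  by (induction w arbitrary: f) (auto intro!: finsum_closed u)

lemma generic_column_closed: "j \<in> V \<Longrightarrow> generic_column A n u j \<in> carrier (nc_poly {1..n} A)"
proof -
  interpret N: complex_algebra "nc_poly {1..n} A" by (intro complex_algebra_nc_poly complex_algebra_axioms)
  show "j \<in> V \<Longrightarrow> ?thesis" by (auto intro!: N.finsum_closed elem_tensor_closed u)
qed

lemma generic_column_apply:
  assumes j: "j \<in> V"
  shows "generic_column A n u j w = (case w of [a] \<Rightarrow> if a \<in> {1..n} then u a j else \<zero> | _ \<Rightarrow> \<zero>)"
proof -
  interpret N: complex_algebra "nc_poly {1..n} A" by (intro complex_algebra_nc_poly complex_algebra_axioms)
  have "(\<Oplus>\<^bsub>nc_poly {1..n} A\<^esub>i\<in>I. elem_tensor A (monomial [i]) (u i j)) w =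
      (case w of [a] \<Rightarrow> if a \<in> I then u a j else \<zero> | _ \<Rightarrow> \<zero>)" if "finite I" "I \<subseteq> {1..n}" for I
    using that
  proof (induction I)
    case empty
    then show ?case by (simp add: nc_poly_simps(4) split: list.splits)
  next
    case (insert i I)
    have c: "(\<lambda>i. elem_tensor A (monomial [i]) (u i j)) \<in> I \<rightarrow> carrier (nc_poly {1..n} A)"
      "elem_tensor A (monomial [i]) (u i j) \<in> carrier (nc_poly {1..n} A)"
      "u i j \<in> carrier A" "\<And>a. a \<in> I \<Longrightarrow> u a j \<in> carrier A"
      using insert.prems j by (auto intro!: elem_tensor_closed u)
    show ?case
      unfolding N.finsum_insert[OF insert(1,2) c(1,2)]
      using insert c(3,4)
      by (auto simp: nc_poly_simps(5) elem_tensor_def monomial_def split: list.splits)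
  qed
  from this[of "{1..n}"] show ?thesis by simp
qed

text \<open>The left factor is homogeneous of degree one, so in the convolution only the split after
  the first letter survives. This is the one-letter recursion behind
  \<open>word_sum\<close>.\<close>

lemma generic_column_mult:
  assumes j: "j \<in> V" and F: "F \<in> carrier (nc_poly {1..n} A)"
  shows "(generic_column A n u j \<otimes>\<^bsub>nc_poly {1..n} A\<^esub> F) [] = \<zero>"
    and "a \<in> {1..n} \<Longrightarrow> (generic_column A n u j \<otimes>\<^bsub>nc_poly {1..n} A\<^esub> F) (a # i) = u a j \<otimes> F i"
proof -
  let ?X = "generic_column A n u j"
  have X: "?X w \<in> carrier A" and Fc: "F w \<in> carrier A" for w
    using generic_column_closed[OF j] F by (auto simp: nc_poly_simps)
  show "(?X \<otimes>\<^bsub>nc_poly {1..n} A\<^esub> F) [] = \<zero>"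
    using X Fc by (simp add: nc_poly_simps(2)) (simp add: generic_column_apply[OF j])
  assume a: "a \<in> {1..n}"
  have "(?X \<otimes>\<^bsub>nc_poly {1..n} A\<^esub> F) (a # i) = ?X [] \<otimes> F (a # i) \<oplus> conv (\<lambda>w. ?X (a # w)) F i"
    unfolding nc_poly_simps(2) by (rule conv_Cons[OF X Fc])
  also have "?X [] = \<zero>" by (simp add: generic_column_apply[OF j])
  \<comment> \<open>Once \<open>a\<close> has been removed, the column is \<open>u a j\<close> times
    the unit of the convolution.\<close>
  also have "(\<lambda>w. ?X (a # w)) = (\<lambda>w. u a j \<otimes> (if w = [] then \<one> else \<zero>))"
    using a u[OF a j] by (auto simp: generic_column_apply[OF j] split: list.split)
  also have "conv \<dots> F i = u a j \<otimes> conv (\<lambda>w. if w = [] then \<one> else \<zero>) F i"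
    using Fc u[OF a j] by (intro conv_mult_l) auto
  also have "conv (\<lambda>w. if w = [] then \<one> else \<zero>) F i = F i" using Fc by (rule conv_one_l)
  finally show "(?X \<otimes>\<^bsub>nc_poly {1..n} A\<^esub> F) (a # i) = u a j \<otimes> F i" using u[OF a j] Fc by simp
qed

text \<open>The image of a word of length m is homogeneous of degree m, so the sum in
  \<open>tensor_id\<close> may run over a fixed finite set of index words.\<close>

lemma coaction_word_support:
  assumes "w \<in> lists V" "word_prod (nc_poly {1..n} A) (generic_column A n u) w i \<noteq> \<zero>"
  shows "i \<in> words n (length w)"
  using assms
proof (induction w arbitrary: i rule: list.induct)
  case Nil
  then show ?case by (auto simp: word_prod_def nc_poly_simps(3) split: if_splits)
next
  case (Cons j w)
  interpret N: complex_algebra "nc_poly {1..n} A" by (intro complex_algebra_nc_poly complex_algebra_axioms)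
  have g: "generic_column A n u \<in> V \<rightarrow> carrier (nc_poly {1..n} A)" using generic_column_closed by blast
  have jw: "j \<in> V" "w \<in> lists V" using Cons.prems(1) by simp_all
  let ?F = "word_prod (nc_poly {1..n} A) (generic_column A n u)"
  have F: "?F w \<in> carrier (nc_poly {1..n} A)" by (rule N.word_prod_closed[OF g jw(2)])
  have F': "?F (j # w) \<in> carrier (nc_poly {1..n} A)" by (rule N.word_prod_closed[OF g Cons.prems(1)])
  have e: "?F (j # w) = generic_column A n u j \<otimes>\<^bsub>nc_poly {1..n} A\<^esub> ?F w" by (simp add: word_prod_def)
  have i: "i \<in> lists {1..n}" using F' Cons.prems(2) by (auto simp: nc_poly_simps)
  show ?case
  proof (cases i)
    case Nil
    then show ?thesis using Cons.prems(2) generic_column_mult(1)[OF jw(1) F] e by simp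
  next
    case (Cons a i')
    have a: "a \<in> {1..n}" using i Cons by auto
    have "u a j \<otimes> ?F w i' \<noteq> \<zero>" using Cons.prems(2) Cons e generic_column_mult(2)[OF jw(1) F a] by simp
    then have "?F w i' \<noteq> \<zero>" using u[OF a jw(1)] by auto
    then show ?thesis using Cons.IH[OF jw(2), of i'] i Cons by simp
  qed
qed

lemma word_sum_coaction:
  assumes "w \<in> lists V"
  shows "(\<Oplus>i\<in>words n (length w). f i \<odot> word_prod (nc_poly {1..n} A) (generic_column A n u) w i) =
    word_sum A n u w f"
  using assms
proof (induction w arbitrary: f rule: list.induct)
  case Nil
  have "words n 0 = {[]}" by auto
  then show ?case by (simp add: word_prod_def nc_poly_simps(3))
next
  case (Cons j w)
  interpret N: complex_algebra "nc_poly {1..n} A" by (intro complex_algebra_nc_poly complex_algebra_axioms)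
  have g: "generic_column A n u \<in> V \<rightarrow> carrier (nc_poly {1..n} A)" using generic_column_closed by blast
  have jw: "j \<in> V" "w \<in> lists V" using Cons.prems(1) by simp_all
  let ?F = "word_prod (nc_poly {1..n} A) (generic_column A n u)"
  have F: "?F v \<in> carrier (nc_poly {1..n} A)" if "v \<in> lists V" for v by (rule N.word_prod_closed[OF g that])
  have Fc: "?F v i \<in> carrier A" if "v \<in> lists V" for v i using F[OF that] by (simp add: nc_poly_simps)
  have e: "?F (j # w) = generic_column A n u j \<otimes>\<^bsub>nc_poly {1..n} A\<^esub> ?F w" by (simp add: word_prod_def)
  \<comment> \<open>Index words grouped by their first letter, matching the recursion of
    \<open>word_sum\<close>.\<close>
  have W: "words n (length (j # w)) = (\<Union>a\<in>{1..n}. Cons a ` words n (length w))"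
    by (auto simp: length_Suc_conv image_iff)
  have "(\<Oplus>i\<in>words n (length (j # w)). f i \<odot> ?F (j # w) i) =
      (\<Oplus>a\<in>{1..n}. \<Oplus>i\<in>Cons a ` words n (length w). f i \<odot> ?F (j # w) i)"
    unfolding W using finite_words Fc[OF Cons.prems]
    by (intro add.finprod_UN_disjoint) (auto simp: pairwise_def disjnt_def)
  also have "\<dots> = (\<Oplus>a\<in>{1..n}. \<Oplus>i\<in>words n (length w). f (a # i) \<odot> ?F (j # w) (a # i))"
    using Fc[OF Cons.prems] by (intro finsum_cong' finsum_reindex) (auto intro!: finsum_closed)
  also have "\<dots> = (\<Oplus>a\<in>{1..n}. u a j \<otimes> (\<Oplus>i\<in>words n (length w). f (a # i) \<odot> ?F w i))"
  proof (intro finsum_cong' refl)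
    fix a assume a: "a \<in> {1..n}"
    have "u a j \<otimes> (\<Oplus>i\<in>words n (length w). f (a # i) \<odot> ?F w i) =
        (\<Oplus>i\<in>words n (length w). u a j \<otimes> (f (a # i) \<odot> ?F w i))"
      using finite_words Fc[OF jw(2)] u[OF a jw(1)] by (intro finsum_rdistr) auto
    also have "\<dots> = (\<Oplus>i\<in>words n (length w). f (a # i) \<odot> ?F (j # w) (a # i))"
      using Fc[OF jw(2)] u[OF a jw(1)]
      by (intro finsum_cong') (auto simp: e generic_column_mult(2)[OF jw(1) F[OF jw(2)] a] smult_mult_r)
    finally show "(\<Oplus>i\<in>words n (length w). f (a # i) \<odot> ?F (j # w) (a # i)) =
      u a j \<otimes> (\<Oplus>i\<in>words n (length w). f (a # i) \<odot> ?F w i)" ..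
  qed (use Fc[OF jw(2)] u jw in \<open>auto intro!: finsum_closed\<close>)
  finally show ?case using Cons.IH[OF jw(2)] by simp
qed

lemma tensor_id_coaction_monomial:
  assumes w: "w \<in> lists V"
  shows "tensor_id A \<mu> (coaction n A u (monomial w)) = word_sum A n u w (\<lambda>i. \<mu> (monomial i))"
proof -
  interpret N: complex_algebra "nc_poly {1..n} A" by (intro complex_algebra_nc_poly complex_algebra_axioms)
  have g: "generic_column A n u \<in> V \<rightarrow> carrier (nc_poly {1..n} A)" using generic_column_closed by blast
  have "coaction n A u (monomial w) = word_prod (nc_poly {1..n} A) (generic_column A n u) w"
    unfolding coaction_def by (rule N.poly_eval_monomial[OF g w])
  then show ?thesis
    using word_sum_coaction[OF w, of "\<lambda>i. \<mu> (monomial i)"] coaction_word_support[OF w] finite_words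
      N.word_prod_closed[OF g w]
    by (subst tensor_id_superset[of "words n (length w)"]) (auto simp: nc_poly_simps(1))
qed

lemma coaction_closed: "p \<in> carrier (nc_polynomials V) \<Longrightarrow> coaction n A u p \<in> carrier (nc_poly {1..n} A)"
proof -
  interpret N: complex_algebra "nc_poly {1..n} A" by (intro complex_algebra_nc_poly complex_algebra_axioms)
  have g: "generic_column A n u \<in> V \<rightarrow> carrier (nc_poly {1..n} A)" using generic_column_closed by blast
  show "p \<in> carrier (nc_polynomials V) \<Longrightarrow> ?thesis"
    unfolding coaction_def by (rule N.poly_eval_closed[OF g])
qed

lemma tensor_id_coaction_closed:
  assumes "p \<in> carrier (nc_polynomials V)"
  shows "tensor_id A \<mu> (coaction n A u p) \<in> carrier A"
  using coaction_closed[OF assms] unfolding tensor_id_def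
  by (intro finsum_closed) (auto simp: nc_poly_simps)

text \<open>Linearity, phrased for the induction step of
  \<open>nc_polynomial_induct\<close>.\<close>

lemma tensor_id_coaction_step:
  assumes "v \<in> lists V" "p \<in> carrier (nc_polynomials V)"
  shows "tensor_id A \<mu> (coaction n A u (\<lambda>w. a * monomial v w + p w)) =
    a \<odot> word_sum A n u v (\<lambda>i. \<mu> (monomial i)) \<oplus> tensor_id A \<mu> (coaction n A u p)"
proof -
  interpret N: complex_algebra "nc_poly {1..n} A" by (intro complex_algebra_nc_poly complex_algebra_axioms)
  interpret P: complex_algebra "nc_polynomials V"
    by (rule complex_algebra_nc_poly[OF complex_algebra_complex_alg])
  have g: "generic_column A n u \<in> V \<rightarrow> carrier (nc_poly {1..n} A)" using generic_column_closed by blast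
  have m: "monomial v \<in> carrier (nc_polynomials V)" by (rule monomial_closed[OF assms(1)])
  have e: "(\<lambda>w. a * monomial v w + p w) =
        a \<odot>\<^bsub>nc_polynomials V\<^esub> monomial v \<oplus>\<^bsub>nc_polynomials V\<^esub> p"
    by (simp add: nc_poly_simps)
  have "coaction n A u (\<lambda>w. a * monomial v w + p w) =
      (\<lambda>w. (a \<odot>\<^bsub>nc_poly {1..n} A\<^esub> coaction n A u (monomial v)) w \<oplus> coaction n A u p w)"
    unfolding e using N.poly_eval_add[OF g P.smult_closed[OF m] assms(2)] N.poly_eval_smult[OF g m]
    by (simp add: coaction_def nc_poly_simps(5))
  then show ?thesis
    using tensor_id_add[OF N.smult_closed[OF coaction_closed[OF m], of a] coaction_closed[OF assms(2)]]
      tensor_id_smult[OF coaction_closed[OF m]] tensor_id_coaction_monomial[OF assms(1)]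
    by (simp add: nc_poly_simps(6))
qed

end

end

lemma (in complex_algebra) word_sum_cong:
  assumes "w \<in> lists V" "\<And>i j. i \<in> {1..n} \<Longrightarrow> j \<in> V \<Longrightarrow> u i j \<in> carrier A"
    and "\<And>i j. i \<in> {1..n} \<Longrightarrow> j \<in> V \<Longrightarrow> u i j = v i j"
    and "\<And>i. i \<in> lists {1..n} \<Longrightarrow> length i = length w \<Longrightarrow> f i = g i"
  shows "word_sum A n u w f = word_sum A n v w g"
  using assms(1,4)
proof (induction w arbitrary: f g rule: list.induct)
  case (Cons j w)
  then have jw: "j \<in> V" "w \<in> lists V" by simp_all
  have "word_sum A n u w (\<lambda>i. f (a # i)) = word_sum A n v w (\<lambda>i. g (a # i))" if "a \<in> {1..n}" for a
    using that Cons.prems jw by (intro Cons.IH) auto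
  moreover have "word_sum A n v w (\<lambda>i. g (a # i)) \<in> carrier A" for a
    using assms(2,3) jw(2) by (intro word_sum_closed[of n V]) auto
  ultimately show ?case
    using assms(2,3) jw(1) by (auto intro!: finsum_cong')
qed simp

lemma star_hom_word_sum:
  assumes "star_algebra A" "star_algebra B" "unital_star_hom A B h"
    and u: "\<And>i j. i \<in> {1..n} \<Longrightarrow> j \<in> V \<Longrightarrow> u i j \<in> carrier A" and "w \<in> lists V"
  shows "h (word_sum A n u w f) = word_sum B n (\<lambda>i j. h (u i j)) w f"
  using assms(5)
proof (induction w arbitrary: f rule: list.induct)
  case Nil
  interpret A: star_algebra A by fact
  show ?case using assms(3) by (simp add: unital_star_hom_def)
next
  case (Cons j w)
  interpret A: star_algebra A by fact
  interpret B: star_algebra B by fact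
  have jw: "j \<in> V" "w \<in> lists V" using Cons.prems by simp_all
  note h = assms(3)[unfolded unital_star_hom_def]
  note R = A.word_sum_closed[of n V u, OF u jw(2)]
  have "h (word_sum A n u (j # w) f) = (\<Oplus>\<^bsub>B\<^esub>a\<in>{1..n}. h (u a j \<otimes>\<^bsub>A\<^esub> word_sum A n u w (\<lambda>i. f (a # i))))"
    using u jw R by (simp, intro star_hom_finsum[OF assms(1-3)]) auto
  also have "\<dots> = word_sum B n (\<lambda>i j. h (u i j)) (j # w) f"
    using u jw R h Cons.IH[OF jw(2)] by (auto intro!: B.finsum_cong' B.word_sum_closed[of n V] simp: Pi_def)
  finally show ?case .
qed

section \<open>Reduction of the coaction identities to words\<close>

context nc_probability_space
begin

context
  fixes n :: nat and x :: "nat \<Rightarrow> 'a"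
  assumes x: "\<forall>i\<in>{1..n}. x i \<in> carrier A"
begin

lemma joint_distribution_step:
  assumes "v \<in> lists {1..n}" "p \<in> carrier (nc_polynomials {1..n})"
  shows "joint_distribution A \<phi> x (\<lambda>w. a * monomial v w + p w) =
    a * joint_distribution A \<phi> x (monomial v) + joint_distribution A \<phi> x p"
proof -
  interpret P: complex_algebra "nc_polynomials {1..n}"
    by (rule complex_algebra_nc_poly[OF complex_algebra_complex_alg])
  have x': "x \<in> {1..n} \<rightarrow> carrier A" using x by auto
  have m: "monomial v \<in> carrier (nc_polynomials {1..n})" by (rule monomial_closed[OF assms(1)])
  have e: "(\<lambda>w. a * monomial v w + p w) =
        a \<odot>\<^bsub>nc_polynomials {1..n}\<^esub> monomial v \<oplus>\<^bsub>nc_polynomials {1..n}\<^esub> p"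
    by (simp add: nc_poly_simps)
  show ?thesis
    unfolding e joint_distribution_def
    using poly_eval_add[OF x' P.smult_closed[OF m] assms(2)] poly_eval_smult[OF x' m]
      poly_eval_closed[OF x' m] poly_eval_closed[OF x' assms(2)]
    by (simp add: functional_add functional_smult)
qed

lemma joint_distribution_zero: "joint_distribution A \<phi> x (\<lambda>w. 0) = 0"
  using functional_smult[of \<zero> 0] by (simp add: joint_distribution_def poly_eval_def)

text \<open>Both sides are linear in \<open>p\<close>, so words suffice. Compressing by an arbitrary
  \<open>Q\<close> covers both notions at once: \<open>Q\<close> is the projection P in the boolean
  case and the unit in the quantum case.\<close>

lemma coaction_identity_of_words:
  fixes C :: "(complex, 'c, 'k) module_scheme"
  assumes C: "complex_algebra C" and V: "V \<subseteq> {1..n}"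
    and u: "\<And>i j. i \<in> {1..n} \<Longrightarrow> j \<in> V \<Longrightarrow> u i j \<in> carrier C" and Q: "Q \<in> carrier C"
    and words: "\<And>w. w \<in> lists V \<Longrightarrow> joint_distribution A \<phi> x (monomial w) \<odot>\<^bsub>C\<^esub> Q =
      Q \<otimes>\<^bsub>C\<^esub> word_sum C n u w (\<lambda>i. joint_distribution A \<phi> x (monomial i)) \<otimes>\<^bsub>C\<^esub> Q"
    and p: "p \<in> carrier (nc_polynomials V)"
  shows "joint_distribution A \<phi> x p \<odot>\<^bsub>C\<^esub> Q =
    Q \<otimes>\<^bsub>C\<^esub> tensor_id C (joint_distribution A \<phi> x) (coaction n C u p) \<otimes>\<^bsub>C\<^esub> Q"
  using p
proof (induction rule: nc_polynomial_induct)
  interpret C: complex_algebra C by fact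
  interpret N: complex_algebra "nc_poly {1..n} C" by (rule complex_algebra_nc_poly[OF C])
  case zero
  have "coaction n C u (\<lambda>w. 0) = (\<lambda>w. \<zero>\<^bsub>C\<^esub>)"
    by (simp add: coaction_def poly_eval_def nc_poly_simps(4))
  then show ?case using Q by (simp add: joint_distribution_zero tensor_id_def)
next
  interpret C: complex_algebra C by fact
  case (add a v p)
  have v: "v \<in> lists {1..n}" and p: "p \<in> carrier (nc_polynomials {1..n})"
    using add(1,2) V by (auto simp: nc_poly_simps)
  note c = C.word_sum_closed[of n V u, OF u add(1)] C.tensor_id_coaction_closed[of n V u, OF u add(2)]
  have st: "tensor_id C (joint_distribution A \<phi> x) (coaction n C u (\<lambda>w. a * monomial v w + p w)) =
      a \<odot>\<^bsub>C\<^esub> word_sum C n u v (\<lambda>i. joint_distribution A \<phi> x (monomial i)) \<oplus>\<^bsub>C\<^esub>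
      tensor_id C (joint_distribution A \<phi> x) (coaction n C u p)"
    by (rule C.tensor_id_coaction_step[of n V u, OF u add(1,2)])
  show ?case
    using Q c add.IH words[OF add(1)]
    by (simp add: st joint_distribution_step[OF v p]
        C.r_distr C.l_distr C.smult_mult_l C.smult_mult_r C.smult_l_distr C.smult_assoc)
qed

end

end

section \<open>Moments that depend only on the pattern of a word\<close>

text \<open>The empty word and all one-letter words share the empty pattern. The moment of the empty
  word is 1, which need not be that of a letter; this is why \<open>w \<noteq> []\<close> recurs
  below.\<close>

fun pattern :: "'v list \<Rightarrow> bool list" where
  "pattern (a # b # w) = (a = b) # pattern (b # w)"
| "pattern w = []"

text \<open>Sums out the first letter. If the second letter is \<open>b\<close>, the first letters
  \<open>a\<close> that compare with \<open>b\<close> differently from how \<open>j\<close> compares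
  with \<open>j'\<close> contribute nothing in total, and the others act on \<open>u b j'\<close>
  like \<open>P\<close> itself. So \<open>a = b\<close> may be replaced by \<open>j = j'\<close>,
  and the induction continues with the word that starts at \<open>j'\<close>.\<close>

lemma (in complex_algebra) projection_word_sum_pattern:
  assumes P: "P \<in> carrier A"
    and u: "\<And>i j. i \<in> {1..n} \<Longrightarrow> j \<in> V \<Longrightarrow> u i j \<in> carrier A"
    and idem: "\<And>i j. i \<in> {1..n} \<Longrightarrow> j \<in> V \<Longrightarrow> u i j \<otimes> u i j = u i j"
    and row: "\<And>i j j'. i \<in> {1..n} \<Longrightarrow> j \<in> V \<Longrightarrow> j' \<in> V \<Longrightarrow> j \<noteq> j' \<Longrightarrow> u i j \<otimes> u i j' = \<zero>"
    and sum: "\<And>j. j \<in> V \<Longrightarrow> (\<Oplus>i\<in>{1..n}. P \<otimes> u i j) = P"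
    and w: "w \<in> lists V" "w \<noteq> []"
  shows "P \<otimes> word_sum A n u w (\<lambda>i. F (pattern i)) = F (pattern w) \<odot> P"
  using w
proof (induction w arbitrary: F rule: pattern.induct)
  case (1 j j' w)
  then have j: "j \<in> V" "j' \<in> V" "w \<in> lists V" by simp_all
  define R where "R e b = word_sum A n u w (\<lambda>i. F (e # pattern (b # i)))" for e b
  have R: "R e b \<in> carrier A" for e b
    unfolding R_def by (rule word_sum_closed[OF u j(3)])
  have inner: "(\<Oplus>a\<in>{1..n}. P \<otimes> u a j \<otimes> (u b j' \<otimes> R (a = b) b)) = P \<otimes> (u b j' \<otimes> R (j = j') b)"
    if b: "b \<in> {1..n}" for b
  proof -
    \<comment> \<open>\<open>S\<close> collects the first letters different from \<open>b\<close>;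
      the column relation then reads \<open>P = P \<otimes> u b j \<oplus> S\<close>.\<close>
    define S where "S = (\<Oplus>a\<in>{1..n} - {b}. P \<otimes> u a j)"
    have ub: "u b j \<in> carrier A" "u b j' \<in> carrier A" using u b j by auto
    have S: "S \<in> carrier A" unfolding S_def using P u j by (auto intro!: finsum_closed)
    have ins: "insert b ({1..n} - {b}) = {1..n}" using b by auto
    have split: "P = P \<otimes> u b j \<oplus> S"
      using finsum_insert[of "{1..n} - {b}" b "\<lambda>a. P \<otimes> u a j"] P u j ub
      unfolding S_def ins sum[OF j(1)] by auto
    have "(\<Oplus>a\<in>insert b ({1..n} - {b}). P \<otimes> u a j \<otimes> (u b j' \<otimes> R (a = b) b)) =
        P \<otimes> u b j \<otimes> (u b j' \<otimes> R True b) \<oplus>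
        (\<Oplus>a\<in>{1..n} - {b}. P \<otimes> u a j \<otimes> (u b j' \<otimes> R (a = b) b))"
      using P u j ub R by (subst finsum_insert) auto
    also have "(\<Oplus>a\<in>{1..n} - {b}. P \<otimes> u a j \<otimes> (u b j' \<otimes> R (a = b) b)) =
        (\<Oplus>a\<in>{1..n} - {b}. P \<otimes> u a j \<otimes> (u b j' \<otimes> R False b))"
      using P u j ub R by (intro finsum_cong') auto
    also have "\<dots> = S \<otimes> (u b j' \<otimes> R False b)"
      unfolding S_def using P u j ub R by (intro finsum_ldistr[symmetric]) auto
    finally have eq: "(\<Oplus>a\<in>{1..n}. P \<otimes> u a j \<otimes> (u b j' \<otimes> R (a = b) b)) =
        P \<otimes> u b j \<otimes> (u b j' \<otimes> R True b) \<oplus> S \<otimes> (u b j' \<otimes> R False b)" unfolding ins .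
    \<comment> \<open>The splitting of \<open>P\<close>, multiplied by \<open>u b j'\<close> on the
      right, decides which of the two summands survives.\<close>
    have Pu: "P \<otimes> u b j' = P \<otimes> (u b j \<otimes> u b j') \<oplus> S \<otimes> u b j'"
      using arg_cong[OF split, of "\<lambda>y. y \<otimes> u b j'"] P S ub by (simp add: l_distr m_assoc)
    show ?thesis
    proof (cases "j = j'")
      case True
      then have "P \<otimes> u b j = P \<otimes> u b j \<oplus> S \<otimes> u b j" using Pu idem[OF b j(1)] by simp
      \<comment> \<open>Only the total over \<open>a \<noteq> b\<close> is shown to vanish; this is
        enough because \<open>R False b\<close> does not depend on \<open>a\<close>.\<close>
      then have "S \<otimes> u b j = \<zero>" using add.l_cancel_one'[of "P \<otimes> u b j" "S \<otimes> u b j"] P S ub by simp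
      then have "S \<otimes> (u b j \<otimes> R False b) = \<zero>" using S ub R by (simp flip: m_assoc)
      moreover have "P \<otimes> u b j \<otimes> (u b j \<otimes> R True b) = P \<otimes> (u b j \<otimes> R True b)"
        using P ub R by (simp add: m_assoc) (simp add: idem[OF b j(1)] flip: m_assoc[of "u b j" "u b j"])
      ultimately show ?thesis using eq True P ub R by simp
    next
      case False
      have z: "u b j \<otimes> u b j' = \<zero>" by (rule row[OF b j(1,2) False])
      then have "P \<otimes> u b j' = S \<otimes> u b j'" using Pu P S ub by simp
      moreover have "P \<otimes> u b j \<otimes> (u b j' \<otimes> R True b) = \<zero>"
        using P ub R by (simp add: m_assoc) (simp add: z flip: m_assoc[of "u b j" "u b j'"])
      ultimately show ?thesis using eq False P S ub R by (simp flip: m_assoc)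
    qed
  qed
  have "word_sum A n u (j # j' # w) (\<lambda>i. F (pattern i)) =
      (\<Oplus>a\<in>{1..n}. u a j \<otimes> (\<Oplus>b\<in>{1..n}. u b j' \<otimes> R (a = b) b))"
    by (simp add: R_def)
  also have "P \<otimes> \<dots> = (\<Oplus>a\<in>{1..n}. P \<otimes> (u a j \<otimes> (\<Oplus>b\<in>{1..n}. u b j' \<otimes> R (a = b) b)))"
    using P u j R by (intro finsum_rdistr) (auto intro!: finsum_closed)
  also have "\<dots> = (\<Oplus>a\<in>{1..n}. \<Oplus>b\<in>{1..n}. P \<otimes> u a j \<otimes> (u b j' \<otimes> R (a = b) b))"
  proof (rule finsum_cong'[OF refl])
    fix a assume a: "a \<in> {1..n}"
    have "P \<otimes> u a j \<otimes> (\<Oplus>b\<in>{1..n}. u b j' \<otimes> R (a = b) b) =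
        (\<Oplus>b\<in>{1..n}. P \<otimes> u a j \<otimes> (u b j' \<otimes> R (a = b) b))"
      using P u j R a by (intro finsum_rdistr) auto
    moreover have "P \<otimes> (u a j \<otimes> (\<Oplus>b\<in>{1..n}. u b j' \<otimes> R (a = b) b)) =
        P \<otimes> u a j \<otimes> (\<Oplus>b\<in>{1..n}. u b j' \<otimes> R (a = b) b)"
      using P u j R a by (intro m_assoc[symmetric]) (auto intro!: finsum_closed)
    ultimately show "P \<otimes> (u a j \<otimes> (\<Oplus>b\<in>{1..n}. u b j' \<otimes> R (a = b) b)) =
        (\<Oplus>b\<in>{1..n}. P \<otimes> u a j \<otimes> (u b j' \<otimes> R (a = b) b))" by simp
  qed (use P u j R in \<open>auto intro!: finsum_closed\<close>)
  also have "\<dots> = (\<Oplus>b\<in>{1..n}. \<Oplus>a\<in>{1..n}. P \<otimes> u a j \<otimes> (u b j' \<otimes> R (a = b) b))"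
    using P u j R by (intro finsum_swap) auto
  also have "\<dots> = (\<Oplus>b\<in>{1..n}. P \<otimes> (u b j' \<otimes> R (j = j') b))"
    using P u j R inner by (intro finsum_cong') auto
  also have "\<dots> = P \<otimes> (\<Oplus>b\<in>{1..n}. u b j' \<otimes> R (j = j') b)"
    using P u j R by (intro finsum_rdistr[symmetric]) auto
  also have "(\<Oplus>b\<in>{1..n}. u b j' \<otimes> R (j = j') b) =
      word_sum A n u (j' # w) (\<lambda>i. F ((j = j') # pattern i))"
    by (simp add: R_def)
  \<comment> \<open>The comparison already settled is absorbed into \<open>F\<close>, over which the
    induction is general.\<close>
  also have "P \<otimes> \<dots> = F ((j = j') # pattern (j' # w)) \<odot> P"
    using "1.IH"[of "\<lambda>p. F ((j = j') # p)"] j by simp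
  finally show ?case by simp
next
  case ("2_2" j)
  then have j: "j \<in> V" by simp
  have "P \<otimes> word_sum A n u [j] (\<lambda>i. F (pattern i)) = (\<Oplus>a\<in>{1..n}. P \<otimes> (u a j \<otimes> (F [] \<odot> \<one>)))"
    using P u j by (simp, intro finsum_rdistr) auto
  also have "\<dots> = (\<Oplus>a\<in>{1..n}. F [] \<odot> (P \<otimes> u a j))"
    using P u j by (intro finsum_cong') (auto simp: smult_mult_r)
  also have "\<dots> = F [] \<odot> P"
    using P u j by (subst finsum_smult[symmetric]) (auto simp: sum)
  finally show ?case by simp
qed simp

text \<open>A transfer-matrix sum: \<open>f\<close> is summed over all continuations of a walk
  standing at \<open>a\<close>, each step weighted by \<open>t\<close> according to whether the walk
  stays and whether the prescribed pattern asks for agreement.\<close>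

fun walk_sum :: "nat \<Rightarrow> (bool \<Rightarrow> bool \<Rightarrow> complex) \<Rightarrow> (nat list \<Rightarrow> complex) \<Rightarrow> nat \<Rightarrow> bool list \<Rightarrow> complex" where
  "walk_sum n t f a [] = f []"
| "walk_sum n t f a (e # es) = (\<Sum>b\<in>{1..n}. t (a = b) e * walk_sum n t (\<lambda>i. f (b # i)) b es)"

text \<open>The hypothesis on \<open>t\<close> says that a letter between \<open>u a j\<close> and
  \<open>P\<close> collapses to a scalar, as happens for rank one projections. The induction
  hypothesis reduces the tail to a multiple of \<open>u b j' \<otimes> P\<close>, and removing that
  letter yields one factor \<open>t\<close>.\<close>

lemma (in complex_algebra) word_sum_walk:
  assumes P: "P \<in> carrier A"
    and u: "\<And>i j. i \<in> {1..n} \<Longrightarrow> j \<in> V \<Longrightarrow> u i j \<in> carrier A"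
    and t: "\<And>a b j j'. a \<in> {1..n} \<Longrightarrow> b \<in> {1..n} \<Longrightarrow> j \<in> V \<Longrightarrow> j' \<in> V \<Longrightarrow>
      u a j \<otimes> (u b j' \<otimes> P) = t (a = b) (j = j') \<odot> (u a j \<otimes> P)"
    and "w \<in> lists V" "a \<in> {1..n}" "j \<in> V"
  shows "u a j \<otimes> (word_sum A n u w f \<otimes> P) = walk_sum n t f a (pattern (j # w)) \<odot> (u a j \<otimes> P)"
  using assms(4-)
proof (induction w arbitrary: f a j rule: list.induct)
  case Nil
  then show ?case using P u by (simp add: smult_mult_l smult_mult_r)
next
  case (Cons j' w)
  then have j: "j' \<in> V" "w \<in> lists V" "a \<in> {1..n}" "j \<in> V" by simp_all
  define R where "R b = word_sum A n u w (\<lambda>i. f (b # i))" for b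
  have R: "R b \<in> carrier A" for b unfolding R_def by (rule word_sum_closed[OF u j(2)])
  have "word_sum A n u (j' # w) f \<otimes> P = (\<Oplus>b\<in>{1..n}. u b j' \<otimes> R b \<otimes> P)"
    using P u j R by (simp add: R_def[symmetric], intro finsum_ldistr) auto
  then have "u a j \<otimes> (word_sum A n u (j' # w) f \<otimes> P) = (\<Oplus>b\<in>{1..n}. u a j \<otimes> (u b j' \<otimes> R b \<otimes> P))"
    using P u j R by (simp, intro finsum_rdistr) auto
  also have "\<dots> = (\<Oplus>b\<in>{1..n}. (t (a = b) (j = j') * walk_sum n t (\<lambda>i. f (b # i)) b (pattern (j' # w))) \<odot> (u a j \<otimes> P))"
  proof (rule finsum_cong'[OF refl])
    fix b assume b: "b \<in> {1..n}"
    have "u b j' \<otimes> R b \<otimes> P = walk_sum n t (\<lambda>i. f (b # i)) b (pattern (j' # w)) \<odot> (u b j' \<otimes> P)"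
      using P u j R b Cons.IH[OF j(2) b j(1), of "\<lambda>i. f (b # i)"] by (simp add: m_assoc R_def)
    then show "u a j \<otimes> (u b j' \<otimes> R b \<otimes> P) =
        (t (a = b) (j = j') * walk_sum n t (\<lambda>i. f (b # i)) b (pattern (j' # w))) \<odot> (u a j \<otimes> P)"
      using P u j b by (simp add: smult_mult_r t mult.commute flip: smult_assoc)
  qed (use P u j in auto)
  also have "\<dots> = walk_sum n t f a (pattern (j # j' # w)) \<odot> (u a j \<otimes> P)"
    using P u j by (simp add: sum_smult)
  finally show ?case .
qed

text \<open>The first letter has no predecessor; the leading \<open>P\<close> removes it at the
  price of the factor \<open>c\<close>.\<close>

lemma (in complex_algebra) compressed_word_sum_walk:
  assumes P: "P \<in> carrier A"
    and u: "\<And>i j. i \<in> {1..n} \<Longrightarrow> j \<in> V \<Longrightarrow> u i j \<in> carrier A"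
    and t: "\<And>a b j j'. a \<in> {1..n} \<Longrightarrow> b \<in> {1..n} \<Longrightarrow> j \<in> V \<Longrightarrow> j' \<in> V \<Longrightarrow>
      u a j \<otimes> (u b j' \<otimes> P) = t (a = b) (j = j') \<odot> (u a j \<otimes> P)"
    and c: "\<And>a j. a \<in> {1..n} \<Longrightarrow> j \<in> V \<Longrightarrow> P \<otimes> (u a j \<otimes> P) = c \<odot> P"
    and w: "w \<in> lists V" "w \<noteq> []"
  shows "P \<otimes> word_sum A n u w f \<otimes> P =
    (\<Sum>a\<in>{1..n}. walk_sum n t (\<lambda>i. f (a # i)) a (pattern w) * c) \<odot> P"
proof -
  obtain j v where jv: "w = j # v" "j \<in> V" "v \<in> lists V" using w by (cases w) auto
  define R where "R b = word_sum A n u v (\<lambda>i. f (b # i))" for b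
  have R: "R b \<in> carrier A" for b unfolding R_def by (rule word_sum_closed[OF u jv(3)])
  have "P \<otimes> word_sum A n u w f = (\<Oplus>a\<in>{1..n}. P \<otimes> (u a j \<otimes> R a))"
    using P u jv R by (simp add: R_def[symmetric], intro finsum_rdistr) auto
  then have "P \<otimes> word_sum A n u w f \<otimes> P = (\<Oplus>a\<in>{1..n}. P \<otimes> (u a j \<otimes> R a) \<otimes> P)"
    using P u jv R by (simp, intro finsum_ldistr) auto
  also have "\<dots> = (\<Oplus>a\<in>{1..n}. (walk_sum n t (\<lambda>i. f (a # i)) a (pattern w) * c) \<odot> P)"
    using P u jv R word_sum_walk[where u = u and P = P and V = V and t = t, OF P u t jv(3) _ jv(2)]
    by (intro finsum_cong') (auto simp: m_assoc R_def smult_mult_r c smult_assoc)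
  finally show ?thesis using P by (simp add: sum_smult)
qed

section \<open>The C*-algebra of complex matrices\<close>

definition vec_norm :: "'i set \<Rightarrow> ('i \<Rightarrow> complex) \<Rightarrow> real" where
  "vec_norm K \<xi> = L2_set (\<lambda>i. cmod (\<xi> i)) K"

definition mat_apply :: "'i set \<Rightarrow> ('i \<Rightarrow> 'i \<Rightarrow> complex) \<Rightarrow> ('i \<Rightarrow> complex) \<Rightarrow> 'i \<Rightarrow> complex" where
  "mat_apply K M \<xi> i = (\<Sum>j\<in>K. M i j * \<xi> j)"

definition op_norm :: "'i set \<Rightarrow> ('i \<Rightarrow> 'i \<Rightarrow> complex) \<Rightarrow> real" where
  "op_norm K M = (SUP \<xi>\<in>{\<xi>. vec_norm K \<xi> \<le> 1}. vec_norm K (mat_apply K M \<xi>))"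

text \<open>Matrices are functions on the whole index type that vanish off K x K, so that equality
  in the algebra is equality of functions.\<close>

definition matrix_algebra :: "'i set \<Rightarrow> ('i \<Rightarrow> 'i \<Rightarrow> complex) cstar_alg" where
  "matrix_algebra K =
    \<lparr> carrier = {M. \<forall>i j. M i j \<noteq> 0 \<longrightarrow> i \<in> K \<and> j \<in> K},
      mult = (\<lambda>M N i j. \<Sum>l\<in>K. M i l * N l j),
      one = (\<lambda>i j. if i = j \<and> i \<in> K then 1 else 0),
      zero = (\<lambda>i j. 0),
      add = (\<lambda>M N i j. M i j + N i j),
      smult = (\<lambda>a M i j. a * M i j),
      star = (\<lambda>M i j. cnj (M j i)),
      cnorm = op_norm K \<rparr>"

lemma matrix_algebra_simps:
  "carrier (matrix_algebra K) = {M. \<forall>i j. M i j \<noteq> 0 \<longrightarrow> i \<in> K \<and> j \<in> K}"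
  "mult (matrix_algebra K) = (\<lambda>M N i j. \<Sum>l\<in>K. M i l * N l j)"
  "one (matrix_algebra K) = (\<lambda>i j. if i = j \<and> i \<in> K then 1 else 0)"
  "zero (matrix_algebra K) = (\<lambda>i j. 0)"
  "add (matrix_algebra K) = (\<lambda>M N i j. M i j + N i j)"
  "smult (matrix_algebra K) = (\<lambda>a M i j. a * M i j)"
  "star (matrix_algebra K) = (\<lambda>M i j. cnj (M j i))"
  "cnorm (matrix_algebra K) = op_norm K"
  by (simp_all add: matrix_algebra_def)

lemma matrix_zero: "M \<in> carrier (matrix_algebra K) \<Longrightarrow> i \<notin> K \<or> j \<notin> K \<Longrightarrow> M i j = 0"
  by (auto simp: matrix_algebra_simps)

lemma vec_norm_nonneg [simp]: "0 \<le> vec_norm K \<xi>"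
  by (simp add: vec_norm_def)

lemma vec_norm_scale: "vec_norm K (\<lambda>i. a * \<xi> i) = cmod a * vec_norm K \<xi>"
  by (simp add: vec_norm_def norm_mult L2_set_right_distrib)

lemma vec_norm_add: "vec_norm K (\<lambda>i. \<xi> i + \<eta> i) \<le> vec_norm K \<xi> + vec_norm K \<eta>"
proof -
  have "vec_norm K (\<lambda>i. \<xi> i + \<eta> i) \<le> L2_set (\<lambda>i. cmod (\<xi> i) + cmod (\<eta> i)) K"
    unfolding vec_norm_def by (rule L2_set_mono) (auto intro: norm_triangle_ineq)
  also have "\<dots> \<le> vec_norm K \<xi> + vec_norm K \<eta>"
    unfolding vec_norm_def by (rule L2_set_triangle_ineq)
  finally show ?thesis .
qed

lemma mat_apply_scale: "mat_apply K M (\<lambda>i. a * \<xi> i) = (\<lambda>i. a * mat_apply K M \<xi> i)"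
  by (auto simp: mat_apply_def sum_distrib_left algebra_simps)

lemma mat_apply_mult:
  "mat_apply K (M \<otimes>\<^bsub>matrix_algebra K\<^esub> N) \<xi> = mat_apply K M (mat_apply K N \<xi>)"
  by (auto simp: mat_apply_def matrix_algebra_simps fun_eq_iff sum_distrib_left sum_distrib_right mult.assoc
        intro: sum.swap)

section \<open>The operator norm as a complete C*-norm\<close>

context
  fixes K :: "'i set"
  assumes K: "finite K"
begin

lemma star_algebra_matrix: "star_algebra (matrix_algebra K)"
proof (intro star_algebra.intro star_algebra_axioms.intro complex_algebra.intro
    complex_algebra_axioms.intro ringI abelian_groupI monoidI)
  fix M assume M: "M \<in> carrier (matrix_algebra K)"
  show "\<exists>N\<in>carrier (matrix_algebra K). N \<oplus>\<^bsub>matrix_algebra K\<^esub> M = \<zero>\<^bsub>matrix_algebra K\<^esub>"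
    using M by (intro bexI[of _ "\<lambda>i j. - M i j"]) (auto simp: matrix_algebra_simps)
  show "\<one>\<^bsub>matrix_algebra K\<^esub> \<otimes>\<^bsub>matrix_algebra K\<^esub> M = M" "M \<otimes>\<^bsub>matrix_algebra K\<^esub> \<one>\<^bsub>matrix_algebra K\<^esub> = M"
  proof -
    have "(\<Sum>l\<in>K. (if i = l \<and> i \<in> K then 1 else 0) * M l j) = (\<Sum>l\<in>K. if i = l then M l j else 0)"
      "(\<Sum>l\<in>K. M i l * (if l = j \<and> l \<in> K then 1 else 0)) = (\<Sum>l\<in>K. if l = j then M i l else 0)" for i j
      by (auto intro!: sum.cong)
    then show "\<one>\<^bsub>matrix_algebra K\<^esub> \<otimes>\<^bsub>matrix_algebra K\<^esub> M = M" "M \<otimes>\<^bsub>matrix_algebra K\<^esub> \<one>\<^bsub>matrix_algebra K\<^esub> = M"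
      using K matrix_zero[OF M] by (auto simp: matrix_algebra_simps(2,3) fun_eq_iff)
  qed
next
  fix M N L :: "'i \<Rightarrow> 'i \<Rightarrow> complex"
  assume "M \<in> carrier (matrix_algebra K)" "N \<in> carrier (matrix_algebra K)" "L \<in> carrier (matrix_algebra K)"
  show "M \<otimes>\<^bsub>matrix_algebra K\<^esub> N \<otimes>\<^bsub>matrix_algebra K\<^esub> L = M \<otimes>\<^bsub>matrix_algebra K\<^esub> (N \<otimes>\<^bsub>matrix_algebra K\<^esub> L)"
    by (auto simp: matrix_algebra_simps fun_eq_iff sum_distrib_left sum_distrib_right mult.assoc
        intro: sum.swap)
next
  fix M N :: "'i \<Rightarrow> 'i \<Rightarrow> complex"
  assume M: "M \<in> carrier (matrix_algebra K)" and N: "N \<in> carrier (matrix_algebra K)"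
  show "M \<otimes>\<^bsub>matrix_algebra K\<^esub> N \<in> carrier (matrix_algebra K)"
    using matrix_zero[OF M] matrix_zero[OF N]
    by (auto simp: matrix_algebra_simps(1,2)) (metis (no_types, lifting) mult_zero_left mult_zero_right sum.neutral)+
  show "M \<oplus>\<^bsub>matrix_algebra K\<^esub> N \<in> carrier (matrix_algebra K)"
    using M N by (auto simp: matrix_algebra_simps(1,5)) (metis add.right_neutral)+
qed (auto simp: matrix_algebra_simps algebra_simps sum.distrib sum_distrib_left)

text \<open>A crude bound with two uses: it makes the supremum in \<open>op_norm\<close> finite, and
  it shows that entrywise convergence implies convergence in norm.\<close>

lemma norm_mat_apply_entries:
  "vec_norm K (mat_apply K M \<xi>) \<le> (\<Sum>i\<in>K. \<Sum>j\<in>K. cmod (M i j)) * vec_norm K \<xi>"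
proof -
  have "vec_norm K (mat_apply K M \<xi>) \<le> (\<Sum>i\<in>K. cmod (mat_apply K M \<xi> i))"
    unfolding vec_norm_def by (rule L2_set_le_sum) auto
  also have "\<dots> \<le> (\<Sum>i\<in>K. \<Sum>j\<in>K. cmod (M i j) * vec_norm K \<xi>)"
  proof (intro sum_mono)
    fix i assume "i \<in> K"
    have "cmod (mat_apply K M \<xi> i) \<le> (\<Sum>j\<in>K. cmod (M i j * \<xi> j))"
      unfolding mat_apply_def by (rule norm_sum)
    also have "\<dots> \<le> (\<Sum>j\<in>K. cmod (M i j) * vec_norm K \<xi>)"
      using K member_le_L2_set[of K _ "\<lambda>i. cmod (\<xi> i)"]
      by (intro sum_mono) (simp add: norm_mult vec_norm_def mult_left_mono)
    finally show "cmod (mat_apply K M \<xi> i) \<le> (\<Sum>j\<in>K. cmod (M i j) * vec_norm K \<xi>)" .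
  qed
  finally show ?thesis by (simp add: sum_distrib_right)
qed

lemma op_norm_bdd: "bdd_above ((\<lambda>\<xi>. vec_norm K (mat_apply K M \<xi>)) ` {\<xi>. vec_norm K \<xi> \<le> 1})"
proof (rule bdd_aboveI2)
  fix \<xi> assume "\<xi> \<in> {\<xi>. vec_norm K \<xi> \<le> 1}"
  then show "vec_norm K (mat_apply K M \<xi>) \<le> (\<Sum>i\<in>K. \<Sum>j\<in>K. cmod (M i j))"
    using norm_mat_apply_entries[of M \<xi>] mult_left_mono[of "vec_norm K \<xi>" 1 "\<Sum>i\<in>K. \<Sum>j\<in>K. cmod (M i j)"]
    by (simp add: sum_nonneg)
qed

lemma op_norm_upper: "vec_norm K \<xi> \<le> 1 \<Longrightarrow> vec_norm K (mat_apply K M \<xi>) \<le> op_norm K M"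
  unfolding op_norm_def by (rule cSUP_upper[OF _ op_norm_bdd]) simp

lemma op_norm_nonneg: "0 \<le> op_norm K M"
proof -
  have "vec_norm K (\<lambda>i. 0) = 0" using vec_norm_scale[of K 0 "\<lambda>i. 0"] by simp
  then show ?thesis using op_norm_upper[of "\<lambda>i. 0" M] vec_norm_nonneg[of K "mat_apply K M (\<lambda>i. 0)"] by linarith
qed

lemma norm_mat_apply: "vec_norm K (mat_apply K M \<xi>) \<le> op_norm K M * vec_norm K \<xi>"
proof (cases "vec_norm K \<xi> = 0")
  case True
  then show ?thesis using norm_mat_apply_entries[of M \<xi>] by simp
next
  case False
  then have pos: "vec_norm K \<xi> > 0" using vec_norm_nonneg[of K \<xi>] by linarith
  let ?a = "complex_of_real (1 / vec_norm K \<xi>)"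
  have a: "cmod ?a = 1 / vec_norm K \<xi>" using pos by (simp add: norm_divide)
  have "vec_norm K (mat_apply K M (\<lambda>i. ?a * \<xi> i)) \<le> op_norm K M"
    using pos by (intro op_norm_upper) (simp only: vec_norm_scale a, simp)
  then show ?thesis using pos unfolding mat_apply_scale vec_norm_scale a by (simp add: field_simps)
qed

lemma op_norm_least:
  assumes "\<And>\<xi>. vec_norm K (mat_apply K M \<xi>) \<le> c * vec_norm K \<xi>" "0 \<le> c"
  shows "op_norm K M \<le> c"
  unfolding op_norm_def
proof (rule cSUP_least)
  have "vec_norm K (\<lambda>i. 0) = 0" using vec_norm_scale[of K 0 "\<lambda>i. 0"] by simp
  then show "{\<xi>. vec_norm K \<xi> \<le> 1} \<noteq> {}" by (metis (mono_tags) empty_Collect_eq zero_le_one)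
  fix \<xi> assume "\<xi> \<in> {\<xi>. vec_norm K \<xi> \<le> 1}"
  then show "vec_norm K (mat_apply K M \<xi>) \<le> c"
    using assms(1)[of \<xi>] mult_left_mono[of "vec_norm K \<xi>" 1 c] assms(2) by simp
qed

lemma op_norm_le_entries: "op_norm K M \<le> (\<Sum>i\<in>K. \<Sum>j\<in>K. cmod (M i j))"
  by (rule op_norm_least[OF norm_mat_apply_entries]) (simp add: sum_nonneg)

text \<open>Test the operator on the basis vector at \<open>j\<close>. Together with
  \<open>op_norm_le_entries\<close> this identifies norm convergence with entrywise
  convergence.\<close>

lemma entry_le_op_norm:
  assumes "i \<in> K" "j \<in> K"
  shows "cmod (M i j) \<le> op_norm K M"
proof -
  let ?e = "\<lambda>l. if l = j then 1 else 0 :: complex"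
  have "vec_norm K ?e = 1"
    using K assms(2) by (simp add: vec_norm_def L2_set_def if_distrib[of cmod] if_distrib[of "\<lambda>x. x\<^sup>2"] cong: if_cong)
  moreover have "mat_apply K M ?e = (\<lambda>i. M i j)"
    using K assms(2) by (auto simp: mat_apply_def if_distrib[of "\<lambda>x. _ * x"] cong: if_cong)
  moreover have "cmod (M i j) \<le> vec_norm K (\<lambda>i. M i j)"
    unfolding vec_norm_def by (rule member_le_L2_set[OF K assms(1)])
  ultimately show ?thesis using op_norm_upper[of ?e M] by simp
qed

lemma op_norm_mult: "op_norm K (M \<otimes>\<^bsub>matrix_algebra K\<^esub> N) \<le> op_norm K M * op_norm K N"
proof (rule op_norm_least)
  fix \<xi>
  have "vec_norm K (mat_apply K M (mat_apply K N \<xi>)) \<le> op_norm K M * vec_norm K (mat_apply K N \<xi>)"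
    by (rule norm_mat_apply)
  also have "\<dots> \<le> op_norm K M * (op_norm K N * vec_norm K \<xi>)"
    by (intro mult_left_mono norm_mat_apply op_norm_nonneg)
  finally show "vec_norm K (mat_apply K (M \<otimes>\<^bsub>matrix_algebra K\<^esub> N) \<xi>) \<le> op_norm K M * op_norm K N * vec_norm K \<xi>"
    by (simp add: mat_apply_mult)
qed (simp add: op_norm_nonneg)

text \<open>The squared norm of M \<xi> is the inner product of M* M \<xi> with \<xi>, which
  Cauchy-Schwarz bounds by the norm of M* M times the squared norm of \<xi>.\<close>

lemma op_norm_square_le:
  "(op_norm K M)\<^sup>2 \<le> op_norm K (star (matrix_algebra K) M \<otimes>\<^bsub>matrix_algebra K\<^esub> M)"
proof -
  let ?c = "op_norm K (star (matrix_algebra K) M \<otimes>\<^bsub>matrix_algebra K\<^esub> M)"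
  have "(vec_norm K (mat_apply K M \<xi>))\<^sup>2 \<le> ?c * (vec_norm K \<xi>)\<^sup>2" for \<xi>
  proof -
    define y where "y = mat_apply K M \<xi>"
    define z where "z = mat_apply K (star (matrix_algebra K) M) y"
    have "complex_of_real ((vec_norm K y)\<^sup>2) = (\<Sum>i\<in>K. cnj (y i) * y i)"
      by (simp add: vec_norm_def L2_set_def sum_nonneg complex_norm_square mult.commute del: of_real_power)
    also have "\<dots> = (\<Sum>i\<in>K. \<Sum>j\<in>K. cnj (y i) * (M i j * \<xi> j))"
      by (simp add: y_def mat_apply_def sum_distrib_left)
    \<comment> \<open>Exchanging the sums moves \<open>M\<close> to the other side of the inner
      product as its adjoint.\<close>
    also have "\<dots> = (\<Sum>j\<in>K. \<Sum>i\<in>K. cnj (y i) * (M i j * \<xi> j))" by (rule sum.swap)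
    also have "\<dots> = (\<Sum>j\<in>K. cnj (z j) * \<xi> j)"
      by (simp add: z_def mat_apply_def matrix_algebra_simps sum_distrib_right) (simp add: ac_simps)
    finally have "(vec_norm K y)\<^sup>2 = cmod (\<Sum>j\<in>K. cnj (z j) * \<xi> j)"
      by (metis abs_of_nonneg norm_of_real zero_le_power2)
    also have "\<dots> \<le> (\<Sum>j\<in>K. \<bar>cmod (z j)\<bar> * \<bar>cmod (\<xi> j)\<bar>)"
      by (rule order_trans[OF norm_sum]) (simp add: norm_mult)
    also have "\<dots> \<le> vec_norm K z * vec_norm K \<xi>"
      unfolding vec_norm_def by (rule L2_set_mult_ineq)
    also have "z = mat_apply K (star (matrix_algebra K) M \<otimes>\<^bsub>matrix_algebra K\<^esub> M) \<xi>"
      by (simp add: z_def y_def mat_apply_mult)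
    also have "vec_norm K \<dots> * vec_norm K \<xi> \<le> ?c * vec_norm K \<xi> * vec_norm K \<xi>"
      by (intro mult_right_mono norm_mat_apply) simp
    finally show ?thesis by (simp add: y_def power2_eq_square)
  qed
  then have "vec_norm K (mat_apply K M \<xi>) \<le> sqrt ?c * vec_norm K \<xi>" for \<xi>
    using real_sqrt_le_mono[of "(vec_norm K (mat_apply K M \<xi>))\<^sup>2" "?c * (vec_norm K \<xi>)\<^sup>2"]
    by (simp add: real_sqrt_mult)
  then have "op_norm K M \<le> sqrt ?c" by (rule op_norm_least) (simp add: op_norm_nonneg)
  then show ?thesis using op_norm_nonneg by (simp add: real_le_rsqrt sqrt_ge_absD)
qed

lemma cstar_seminorm_matrix: "cstar_seminorm (matrix_algebra K) (op_norm K)"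
  unfolding cstar_seminorm_def
proof (intro conjI ballI allI op_norm_nonneg op_norm_mult)
  fix M N :: "'i \<Rightarrow> 'i \<Rightarrow> complex" and a
  have le: "op_norm K (\<lambda>i j. b * L i j) \<le> cmod b * op_norm K L" for b L
  proof (rule op_norm_least)
    fix \<xi>
    have "mat_apply K (\<lambda>i j. b * L i j) \<xi> = (\<lambda>i. b * mat_apply K L \<xi> i)"
      by (auto simp: mat_apply_def sum_distrib_left mult.assoc)
    then show "vec_norm K (mat_apply K (\<lambda>i j. b * L i j) \<xi>) \<le> cmod b * op_norm K L * vec_norm K \<xi>"
      using mult_left_mono[OF norm_mat_apply[of L \<xi>], of "cmod b"] by (simp add: vec_norm_scale mult.assoc)
  qed (simp add: op_norm_nonneg)
  have "cmod a * op_norm K M \<le> op_norm K (\<lambda>i j. a * M i j)"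
  proof (cases "a = 0")
    case False
    have "op_norm K M \<le> cmod (1 / a) * op_norm K (\<lambda>i j. a * M i j)"
      using le[of "1 / a" "\<lambda>i j. a * M i j"] False by simp
    then show ?thesis using False by (simp add: norm_divide field_simps)
  qed (simp add: op_norm_nonneg)
  with le[of a M] show "op_norm K (a \<odot>\<^bsub>matrix_algebra K\<^esub> M) = cmod a * op_norm K M"
    by (simp add: matrix_algebra_simps)
  show "op_norm K (M \<oplus>\<^bsub>matrix_algebra K\<^esub> N) \<le> op_norm K M + op_norm K N"
  proof (rule op_norm_least)
    fix \<xi>
    have "mat_apply K (M \<oplus>\<^bsub>matrix_algebra K\<^esub> N) \<xi> = (\<lambda>i. mat_apply K M \<xi> i + mat_apply K N \<xi> i)"
      by (auto simp: mat_apply_def matrix_algebra_simps algebra_simps sum.distrib)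
    then show "vec_norm K (mat_apply K (M \<oplus>\<^bsub>matrix_algebra K\<^esub> N) \<xi>) \<le> (op_norm K M + op_norm K N) * vec_norm K \<xi>"
      using vec_norm_add[of K "mat_apply K M \<xi>" "mat_apply K N \<xi>"] norm_mat_apply[of M \<xi>] norm_mat_apply[of N \<xi>]
      by (simp add: distrib_right)
  qed (simp add: op_norm_nonneg)
  have star_star: "star (matrix_algebra K) (star (matrix_algebra K) L) = L" for L
    by (simp add: matrix_algebra_simps)
  \<comment> \<open>The square of the norm of L is at most the norm of L* times that of L.
    Cancelling and exchanging the roles of L and L* shows that both have the same norm.\<close>
  have star: "op_norm K L \<le> op_norm K (star (matrix_algebra K) L)" for L
    using order_trans[OF op_norm_square_le[of L] op_norm_mult[of "star (matrix_algebra K) L" L]]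
      op_norm_nonneg[of L] op_norm_nonneg[of "star (matrix_algebra K) L"]
    by (cases "op_norm K L = 0") (auto simp: power2_eq_square)
  then have "op_norm K (star (matrix_algebra K) M) = op_norm K M"
    using star[of M] star[of "star (matrix_algebra K) M"] star_star[of M] by (intro antisym) simp_all
  then show "op_norm K (star (matrix_algebra K) M \<otimes>\<^bsub>matrix_algebra K\<^esub> M) = (op_norm K M)\<^sup>2"
    using op_norm_square_le[of M] op_norm_mult[of "star (matrix_algebra K) M" M] by (simp add: power2_eq_square)
qed

lemma matrix_minus:
  assumes "N \<in> carrier (matrix_algebra K)"
  shows "M \<ominus>\<^bsub>matrix_algebra K\<^esub> N = (\<lambda>i j. M i j - N i j)"
proof -
  interpret star_algebra "matrix_algebra K" by (rule star_algebra_matrix)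
  show ?thesis using neg_smult[OF assms] by (auto simp: a_minus_def matrix_algebra_simps(5,6) fun_eq_iff)
qed

lemma unital_cstar_algebra_matrix: "unital_cstar_algebra (matrix_algebra K)"
proof (intro unital_cstar_algebra.intro star_algebra_matrix unital_cstar_algebra_axioms.intro)
  show "cstar_seminorm (matrix_algebra K) (cnorm (matrix_algebra K))"
    using cstar_seminorm_matrix by (simp add: matrix_algebra_simps(8))
next
  fix M assume M: "M \<in> carrier (matrix_algebra K)" "cnorm (matrix_algebra K) M = 0"
  have "M i j = 0" for i j
    using entry_le_op_norm[of i j M] M(2) matrix_zero[OF M(1), of i j]
    by (cases "i \<in> K \<and> j \<in> K") (auto simp: matrix_algebra_simps(8))
  then show "M = \<zero>\<^bsub>matrix_algebra K\<^esub>" by (auto simp: matrix_algebra_simps(4))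
next
  fix s assume s: "cauchy_in (matrix_algebra K) (cnorm (matrix_algebra K)) s"
  have c: "s m \<in> carrier (matrix_algebra K)" for m using s by (simp add: cauchy_in_def)
  have "Cauchy (\<lambda>m. s m i j)" for i j
  proof (cases "i \<in> K \<and> j \<in> K")
    case True
    show ?thesis
    proof (rule metric_CauchyI)
      fix e :: real assume "e > 0"
      then obtain N where N: "\<forall>m\<ge>N. \<forall>k\<ge>N. op_norm K (\<lambda>i j. s m i j - s k i j) < e"
        using s by (auto simp: cauchy_in_def matrix_minus[OF c] matrix_algebra_simps(8))
      have "dist (s m i j) (s k i j) < e" if "m \<ge> N" "k \<ge> N" for m k
        using N that entry_le_op_norm[of i j "\<lambda>i j. s m i j - s k i j"] True by (fastforce simp: dist_norm)
      then show "\<exists>N. \<forall>m\<ge>N. \<forall>k\<ge>N. dist (s m i j) (s k i j) < e" by blast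
    qed
  next
    case False
    then have "s m i j = 0" for m using matrix_zero[OF c] by blast
    then show ?thesis by (simp add: Cauchy_def)
  qed
  then have lim: "(\<lambda>m. s m i j) \<longlonglongrightarrow> lim (\<lambda>m. s m i j)" for i j
    using Cauchy_convergent_iff convergent_LIMSEQ_iff by blast
  define L where "L i j = lim (\<lambda>m. s m i j)" for i j
  have "L i j = 0" if "i \<notin> K \<or> j \<notin> K" for i j
    using matrix_zero[OF c that] by (simp add: L_def)
  then have L: "L \<in> carrier (matrix_algebra K)" by (auto simp: matrix_algebra_simps(1))
  have "(\<lambda>m. \<Sum>i\<in>K. \<Sum>j\<in>K. cmod (s m i j - L i j)) \<longlonglongrightarrow> (\<Sum>i\<in>K. \<Sum>j\<in>K. cmod (L i j - L i j))"
    using lim unfolding L_def by (intro tendsto_intros)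
  then have *: "(\<lambda>m. \<Sum>i\<in>K. \<Sum>j\<in>K. cmod (s m i j - L i j)) \<longlonglongrightarrow> 0" by simp
  have "(\<lambda>m. op_norm K (\<lambda>i j. s m i j - L i j)) \<longlonglongrightarrow> 0"
    by (rule tendsto_sandwich[OF _ _ tendsto_const *]) (auto simp: op_norm_nonneg op_norm_le_entries)
  then show "\<exists>x\<in>carrier (matrix_algebra K). (\<lambda>m. cnorm (matrix_algebra K) (s m \<ominus>\<^bsub>matrix_algebra K\<^esub> x)) \<longlonglongrightarrow> 0"
    by (intro bexI[OF _ L]) (simp add: matrix_minus[OF L] matrix_algebra_simps(8))
qed

end

section \<open>A rank one representation of \<open>B_s\<close>\<close>

lemma finsum_matrix:
  assumes "finite I" "finite K" "f \<in> I \<rightarrow> carrier (matrix_algebra K)"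
  shows "(\<Oplus>\<^bsub>matrix_algebra K\<^esub>i\<in>I. f i) = (\<lambda>k l. \<Sum>i\<in>I. f i k l)"
proof -
  interpret D: star_algebra "matrix_algebra K" by (rule star_algebra_matrix[OF assms(2)])
  show ?thesis using assms(1,3)
    by (induction I rule: finite_induct) (auto simp: Pi_def, auto simp: matrix_algebra_simps(4,5))
qed

lemma sum_sum_prod:
  "(\<Sum>k\<in>I. \<Sum>l\<in>J. c * (f k * g l)) = c * ((\<Sum>k\<in>I. f k) * (\<Sum>l\<in>J. g l :: real))"
  by (subst sum_product) (simp only: sum_distrib_left)

text \<open>The operator a b^T on \<open>K\<close>. The vectors are real, so no conjugation
  appears.\<close>

definition rank_one :: "'i set \<Rightarrow> ('i \<Rightarrow> real) \<Rightarrow> ('i \<Rightarrow> real) \<Rightarrow> 'i \<Rightarrow> 'i \<Rightarrow> complex" where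
  "rank_one K a b = (\<lambda>k l. if k \<in> K \<and> l \<in> K then complex_of_real (a k * b l) else 0)"

lemma rank_one_closed: "rank_one K a b \<in> carrier (matrix_algebra K)"
  by (simp add: rank_one_def matrix_algebra_simps)

lemma rank_one_mult:
  "rank_one K a b \<otimes>\<^bsub>matrix_algebra K\<^esub> rank_one K c d =
    complex_of_real (\<Sum>k\<in>K. b k * c k) \<odot>\<^bsub>matrix_algebra K\<^esub> rank_one K a d"
  by (auto simp: rank_one_def matrix_algebra_simps fun_eq_iff sum_distrib_right sum_distrib_left
      intro!: sum.cong)

lemma star_rank_one: "star (matrix_algebra K) (rank_one K a a) = rank_one K a a"
  by (auto simp: rank_one_def matrix_algebra_simps fun_eq_iff)

text \<open>The entries of the projection Q = I - J/n onto the complement of the constant vectors,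
  where J is the all-ones matrix.\<close>

definition deviation :: "nat \<Rightarrow> nat \<Rightarrow> nat \<Rightarrow> real" where
  "deviation n i k = (if i = k then 1 else 0) - 1 / n"

text \<open>
  The Gram matrix \<open>\<langle>a\<^sub>i\<^sub>j, a\<^sub>k\<^sub>l\<rangle>\<close> has to be \<open>1/n\<close> on the diagonal and \<open>0\<close> if exactly one index
  agrees, and \<open>\<Sum>\<^sub>i a\<^sub>i\<^sub>j\<close> must not depend on \<open>j\<close>; giving all remaining entries the same value forces
  \<open>1/(n(n-1))\<close>. In terms of the projection \<open>Q\<close> onto the complement of the constant vectors this matrix is
  \<open>(1 - Q) \<otimes> (1 - Q) + Q \<otimes> Q / (n - 1)\<close>, which the vectors below realize.
\<close>

definition magic_vec :: "nat \<Rightarrow> nat \<Rightarrow> nat \<Rightarrow> nat \<times> nat \<Rightarrow> real" where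
  "magic_vec n i j = (\<lambda>(k, l). 1 / n\<^sup>2 + deviation n i k * deviation n j l / sqrt (n - 1))"

text \<open>A unit vector in the n^2-dimensional space, and the common column sum of the vectors
  \<open>magic_vec n i j\<close>.\<close>

definition const_vec :: "nat \<Rightarrow> nat \<times> nat \<Rightarrow> real" where
  "const_vec n = (\<lambda>_. 1 / n)"

text \<open>This is n times the Gram matrix of the magic vectors. As step weights of
  \<open>walk_sum\<close> these are the probabilities of staying put or of jumping uniformly to one
  of the n - 1 other letters, so with initial weight 1/n the walk sum is the average of the moments
  over the index words with the given pattern.\<close>

definition transition :: "nat \<Rightarrow> bool \<Rightarrow> bool \<Rightarrow> real" where
  "transition n e e' = (if e then if e' then 1 else 0 else if e' then 0 else 1 / (real n - 1))"

abbreviation square :: "nat \<Rightarrow> (nat \<times> nat) set" where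
  "square n \<equiv> {1..n} \<times> {1..n}"

section \<open>Inner products and relations of the rank one family\<close>

context
  fixes n :: nat
  assumes n: "n \<ge> 2"
begin

lemma sum_deviation: "i \<in> {1..n} \<Longrightarrow> (\<Sum>k\<in>{1..n}. deviation n i k) = 0"
  using n by (simp add: deviation_def sum_subtractf)

lemma sum_deviation': "k \<in> {1..n} \<Longrightarrow> (\<Sum>i\<in>{1..n}. deviation n i k) = 0"
  using n by (simp add: deviation_def sum_subtractf)

text \<open>The identity Q^2 = Q for the symmetric matrix Q with entries
  \<open>deviation n i k\<close>.\<close>

lemma sum_deviation_deviation:
  assumes "i \<in> {1..n}" "i' \<in> {1..n}"
  shows "(\<Sum>k\<in>{1..n}. deviation n i k * deviation n i' k) = (if i = i' then 1 else 0) - 1 / n"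
proof -
  have "(\<Sum>k\<in>{1..n}. deviation n i k * deviation n i' k) =
      (\<Sum>k\<in>{1..n}. (if i = k then deviation n i' k else 0) - deviation n i' k * (1 / n))"
    by (intro sum.cong) (auto simp: deviation_def[of n i] algebra_simps)
  also have "\<dots> = (\<Sum>k\<in>{1..n}. (if i = k then deviation n i' k else 0)) - (\<Sum>k\<in>{1..n}. deviation n i' k) * (1 / n)"
    by (simp only: sum_subtractf sum_distrib_right)
  also have "\<dots> = deviation n i' i" using assms by (simp add: sum_deviation)
  finally show ?thesis by (simp add: deviation_def)
qed

text \<open>The mixed terms vanish because the rows of Q sum to zero; what remains is 1/n^2 plus the
  product of two entries of Q divided by n - 1.\<close>

lemma magic_vec_inner:
  assumes "i \<in> {1..n}" "j \<in> {1..n}" "i' \<in> {1..n}" "j' \<in> {1..n}"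
  shows "(\<Sum>k\<in>square n. magic_vec n i j k * magic_vec n i' j' k) = transition n (i = i') (j = j') / n"
proof -
  let ?s = "1 / sqrt (real n - 1)"
  have s: "?s * ?s = 1 / (real n - 1)" using n by (simp add: real_sqrt_mult_self)
  have "(\<Sum>k\<in>square n. magic_vec n i j k * magic_vec n i' j' k) =
      (\<Sum>k\<in>{1..n}. \<Sum>l\<in>{1..n}. 1 / n\<^sup>2 * (1 / n\<^sup>2) + 1 / n\<^sup>2 * ?s * (deviation n i k * deviation n j l)
        + 1 / n\<^sup>2 * ?s * (deviation n i' k * deviation n j' l)
        + ?s * ?s * ((deviation n i k * deviation n i' k) * (deviation n j l * deviation n j' l)))"
    using n unfolding sum.cartesian_product
    by (intro sum.cong) (auto simp: magic_vec_def algebra_simps of_nat_diff)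
  also have "\<dots> = 1 / n\<^sup>2 + ?s * ?s * ((\<Sum>k\<in>{1..n}. deviation n i k * deviation n i' k) * (\<Sum>l\<in>{1..n}. deviation n j l * deviation n j' l))"
    using n assms unfolding sum.distrib sum_sum_prod
    by (simp add: sum_deviation) (simp add: power2_eq_square power4_eq_xxxx)
  also have "\<dots> = transition n (i = i') (j = j') / n"
    unfolding sum_deviation_deviation[OF assms(1,3)] sum_deviation_deviation[OF assms(2,4)] s
    using n by (auto simp: transition_def field_simps power2_eq_square)
  finally show ?thesis .
qed

lemma magic_vec_const:
  assumes "i \<in> {1..n}" "j \<in> {1..n}"
  shows "(\<Sum>k\<in>square n. magic_vec n i j k * const_vec n k) = 1 / n"
proof -
  have "(\<Sum>k\<in>square n. magic_vec n i j k * const_vec n k) =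
      (\<Sum>k\<in>{1..n}. \<Sum>l\<in>{1..n}. 1 / n\<^sup>2 * (1 / n) + 1 / sqrt (n - 1) * (1 / n) * (deviation n i k * deviation n j l))"
    unfolding sum.cartesian_product
    by (intro sum.cong) (auto simp: magic_vec_def const_vec_def algebra_simps add_divide_distrib)
  also have "\<dots> = 1 / n"
    using n assms unfolding sum.distrib sum_sum_prod
    by (simp add: sum_deviation) (simp add: power2_eq_square)
  finally show ?thesis .
qed

lemma const_vec_inner: "(\<Sum>k\<in>square n. const_vec n k * const_vec n k) = 1"
  using n by (simp add: const_vec_def card_cartesian_product)

lemma sum_magic_vec:
  assumes "j \<in> {1..n}" "k \<in> square n"
  shows "(\<Sum>i\<in>{1..n}. magic_vec n i j k) = const_vec n k"
  using n assms
  by (cases k)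
    (simp add: magic_vec_def const_vec_def sum.distrib sum_deviation' power2_eq_square
      flip: sum_divide_distrib sum_distrib_right)

text \<open>The scalar \<open>n\<close> normalizes: the vector has squared norm 1/n.\<close>

abbreviation magic_proj :: "nat \<Rightarrow> nat \<Rightarrow> (nat \<times> nat) \<Rightarrow> (nat \<times> nat) \<Rightarrow> complex" where
  "magic_proj i j \<equiv> of_nat n \<odot>\<^bsub>matrix_algebra (square n)\<^esub> rank_one (square n) (magic_vec n i j) (magic_vec n i j)"

abbreviation const_proj :: "(nat \<times> nat) \<Rightarrow> (nat \<times> nat) \<Rightarrow> complex" where
  "const_proj \<equiv> rank_one (square n) (const_vec n) (const_vec n)"

text \<open>A product of rank one operators is again rank one, up to an inner product computed
  above. The last two parts supply the hypotheses of
  \<open>compressed_word_sum_walk\<close>.\<close>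

lemma magic_relations:
  assumes "i \<in> {1..n}" "j \<in> {1..n}"
  shows "magic_proj i j \<in> carrier (matrix_algebra (square n))"
    and "star (matrix_algebra (square n)) (magic_proj i j) = magic_proj i j"
    and "magic_proj i j \<otimes>\<^bsub>matrix_algebra (square n)\<^esub> magic_proj i j = magic_proj i j"
    and "\<And>i' j'. i' \<in> {1..n} \<Longrightarrow> j' \<in> {1..n} \<Longrightarrow> (i = i') \<noteq> (j = j') \<Longrightarrow>
      magic_proj i j \<otimes>\<^bsub>matrix_algebra (square n)\<^esub> magic_proj i' j' = \<zero>\<^bsub>matrix_algebra (square n)\<^esub>"
    and "magic_proj i j \<otimes>\<^bsub>matrix_algebra (square n)\<^esub> const_proj = rank_one (square n) (magic_vec n i j) (const_vec n)"
    and "\<And>i' j'. i' \<in> {1..n} \<Longrightarrow> j' \<in> {1..n} \<Longrightarrow>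
      magic_proj i j \<otimes>\<^bsub>matrix_algebra (square n)\<^esub> (magic_proj i' j' \<otimes>\<^bsub>matrix_algebra (square n)\<^esub> const_proj) =
      complex_of_real (transition n (i = i') (j = j')) \<odot>\<^bsub>matrix_algebra (square n)\<^esub>
      (magic_proj i j \<otimes>\<^bsub>matrix_algebra (square n)\<^esub> const_proj)"
    and "const_proj \<otimes>\<^bsub>matrix_algebra (square n)\<^esub> (magic_proj i j \<otimes>\<^bsub>matrix_algebra (square n)\<^esub> const_proj) =
      complex_of_real (1 / n) \<odot>\<^bsub>matrix_algebra (square n)\<^esub> const_proj"
proof -
  let ?K = "square n"
  interpret D: unital_cstar_algebra "matrix_algebra ?K" by (rule unital_cstar_algebra_matrix) simp
  note r = rank_one_closed[of ?K]
  have ip: "rank_one ?K a (magic_vec n i j) \<otimes>\<^bsub>matrix_algebra ?K\<^esub> rank_one ?K (magic_vec n i' j') d =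
        complex_of_real (transition n (i = i') (j = j') / n) \<odot>\<^bsub>matrix_algebra ?K\<^esub> rank_one ?K a d"
      "rank_one ?K a (magic_vec n i j) \<otimes>\<^bsub>matrix_algebra ?K\<^esub> rank_one ?K (const_vec n) d =
        complex_of_real (1 / n) \<odot>\<^bsub>matrix_algebra ?K\<^esub> rank_one ?K a d"
      "rank_one ?K a (const_vec n) \<otimes>\<^bsub>matrix_algebra ?K\<^esub> rank_one ?K (magic_vec n i j) d =
        complex_of_real (1 / n) \<odot>\<^bsub>matrix_algebra ?K\<^esub> rank_one ?K a d"
    if "i \<in> {1..n}" "j \<in> {1..n}" "i' \<in> {1..n}" "j' \<in> {1..n}" for i j i' j' a d
    unfolding rank_one_mult using magic_vec_inner[OF that] magic_vec_const[OF that(1,2)]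
    by (simp_all only: mult.commute[of "const_vec n _"])
  show "magic_proj i j \<in> carrier (matrix_algebra ?K)" using r by blast
  show "star (matrix_algebra ?K) (magic_proj i j) = magic_proj i j"
    using r by (simp add: D.star_smult star_rank_one)
  have mm: "magic_proj i j \<otimes>\<^bsub>matrix_algebra ?K\<^esub> magic_proj i' j' = complex_of_real (n * transition n (i = i') (j = j'))
      \<odot>\<^bsub>matrix_algebra ?K\<^esub> rank_one ?K (magic_vec n i j) (magic_vec n i' j')"
    if "i' \<in> {1..n}" "j' \<in> {1..n}" for i' j'
    using r n by (simp add: D.smult_mult_l D.smult_mult_r ip(1)[OF assms that] flip: D.smult_assoc)
  show "magic_proj i j \<otimes>\<^bsub>matrix_algebra ?K\<^esub> magic_proj i j = magic_proj i j"
    using mm[OF assms] by (simp add: transition_def)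
  show "magic_proj i j \<otimes>\<^bsub>matrix_algebra ?K\<^esub> magic_proj i' j' = \<zero>\<^bsub>matrix_algebra ?K\<^esub>"
    if "i' \<in> {1..n}" "j' \<in> {1..n}" "(i = i') \<noteq> (j = j')" for i' j'
    unfolding mm[OF that(1,2)] using that(3) r by (auto simp: transition_def)
  have mP: "magic_proj i j \<otimes>\<^bsub>matrix_algebra ?K\<^esub> const_proj = rank_one ?K (magic_vec n i j) (const_vec n)"
    if "i \<in> {1..n}" "j \<in> {1..n}" for i j
    using r n by (simp add: D.smult_mult_l ip(2)[OF that that] flip: D.smult_assoc)
  show "magic_proj i j \<otimes>\<^bsub>matrix_algebra ?K\<^esub> const_proj = rank_one ?K (magic_vec n i j) (const_vec n)"
    by (rule mP[OF assms])
  show "magic_proj i j \<otimes>\<^bsub>matrix_algebra ?K\<^esub> (magic_proj i' j' \<otimes>\<^bsub>matrix_algebra ?K\<^esub> const_proj) =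
      complex_of_real (transition n (i = i') (j = j')) \<odot>\<^bsub>matrix_algebra ?K\<^esub>
      (magic_proj i j \<otimes>\<^bsub>matrix_algebra ?K\<^esub> const_proj)"
    if "i' \<in> {1..n}" "j' \<in> {1..n}" for i' j'
    unfolding mP[OF assms] mP[OF that]
    using r n by (simp add: D.smult_mult_l ip(1)[OF assms that] flip: D.smult_assoc)
  show "const_proj \<otimes>\<^bsub>matrix_algebra ?K\<^esub> (magic_proj i j \<otimes>\<^bsub>matrix_algebra ?K\<^esub> const_proj) =
      complex_of_real (1 / n) \<odot>\<^bsub>matrix_algebra ?K\<^esub> const_proj"
    unfolding mP[OF assms] by (rule ip(3)[OF assms assms])
qed

text \<open>After multiplication by \<open>const_proj\<close> the summands have right vector
  \<open>const_vec n\<close> and left vectors \<open>magic_vec n i j\<close>. They are linear in the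
  left vector, and the left vectors add up to \<open>const_vec n\<close>.\<close>

lemma magic_column_sum:
  assumes "j \<in> {1..n}"
  shows "(\<Oplus>\<^bsub>matrix_algebra (square n)\<^esub>i\<in>{1..n}. magic_proj i j \<otimes>\<^bsub>matrix_algebra (square n)\<^esub> const_proj) = const_proj"
proof -
  let ?K = "square n"
  interpret D: star_algebra "matrix_algebra ?K" by (rule star_algebra_matrix) simp
  have "(\<Oplus>\<^bsub>matrix_algebra ?K\<^esub>i\<in>{1..n}. magic_proj i j \<otimes>\<^bsub>matrix_algebra ?K\<^esub> const_proj) =
      (\<Oplus>\<^bsub>matrix_algebra ?K\<^esub>i\<in>{1..n}. rank_one ?K (magic_vec n i j) (const_vec n))"
    using assms by (intro D.finsum_cong') (auto simp: rank_one_closed magic_relations(5))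
  also have "\<dots> = (\<lambda>k l. \<Sum>i\<in>{1..n}. rank_one ?K (magic_vec n i j) (const_vec n) k l)"
    by (rule finsum_matrix) (auto simp: rank_one_closed)
  also have "\<dots> = const_proj"
    using sum_magic_vec[OF assms]
    by (auto simp: rank_one_def fun_eq_iff simp flip: of_real_sum sum_distrib_right)
  finally show ?thesis .
qed

lemma B_s_representation:
  "\<exists>h. unital_star_hom (B_s n) (matrix_algebra (square n)) h \<and>
    (\<forall>i\<in>{1..n}. \<forall>j\<in>{1..n}. h (B_s_u n i j) = magic_proj i j) \<and> h (B_s_P n) = const_proj"
proof -
  let ?D = "matrix_algebra (square n)"
  interpret D: unital_cstar_algebra ?D by (rule unital_cstar_algebra_matrix) simp
  interpret B: bounded_presentation "B_s_gens n" "B_s_rels n" by (rule bounded_presentation_B_s)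
  define b where "b g = (case g of Ugen i j \<Rightarrow> magic_proj i j | Pgen \<Rightarrow> const_proj)" for g
  have bc: "b \<in> B_s_gens n \<rightarrow> carrier ?D"
    using rank_one_closed[of "square n"] by (auto simp: b_def B_s_gens_def)
  have Ug: "Ugen i j \<in> B_s_gens n" if "i \<in> {1..n}" "j \<in> {1..n}" for i j
    using that by (simp add: B_s_gens_def)
  have Pg: "Pgen \<in> B_s_gens n" by (simp add: B_s_gens_def)
  have proj: "b g \<otimes>\<^bsub>?D\<^esub> b g = b g \<and> star ?D (b g) = b g" if g: "g \<in> B_s_gens n" for g
  proof (cases g)
    case (Ugen i j)
    then show ?thesis using g magic_relations(2,3)[of i j] by (auto simp: b_def B_s_gens_def)
  next
    case Pgen
    then show ?thesis
      by (simp add: b_def star_rank_one rank_one_mult const_vec_inner rank_one_closed)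
  qed
  note ev = D.star_poly_eval_simps[OF bc] D.star_poly_eval_gen[OF bc]
  have "star_poly_eval ?D b l = star_poly_eval ?D b r" if lr: "(l, r) \<in> B_s_rels n" for l r
    using lr unfolding B_s_rels_def Let_def projection_relations_def
  proof (elim UnE CollectE exE conjE Pair_inject)
    fix g assume "l = free_gen g \<otimes>\<^bsub>free_star (B_s_gens n)\<^esub> free_gen g" "r = free_gen g" "g \<in> B_s_gens n"
    then show ?thesis using proj by (simp add: ev)
  next
    fix g assume "l = star (free_star (B_s_gens n)) (free_gen g)" "r = free_gen g" "g \<in> B_s_gens n"
    then show ?thesis using proj by (simp add: ev)
  next
    fix i k m
    assume "l = free_gen (Ugen i k) \<otimes>\<^bsub>free_star (B_s_gens n)\<^esub> free_gen (Ugen i m)"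
      "r = \<zero>\<^bsub>free_star (B_s_gens n)\<^esub>" "i \<in> {1..n}" "k \<in> {1..n}" "m \<in> {1..n}" "k \<noteq> m"
    then show ?thesis using magic_relations(4)[of i k i m] by (simp add: ev Ug b_def)
  next
    fix i k m
    assume "l = free_gen (Ugen k i) \<otimes>\<^bsub>free_star (B_s_gens n)\<^esub> free_gen (Ugen m i)"
      "r = \<zero>\<^bsub>free_star (B_s_gens n)\<^esub>" "i \<in> {1..n}" "k \<in> {1..n}" "m \<in> {1..n}" "k \<noteq> m"
    then show ?thesis using magic_relations(4)[of k i m i] by (simp add: ev Ug b_def)
  next
    fix i
    assume "l = (\<Oplus>\<^bsub>free_star (B_s_gens n)\<^esub>k\<in>{1..n}. free_gen (Ugen k i) \<otimes>\<^bsub>free_star (B_s_gens n)\<^esub> free_gen Pgen)"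
      "r = free_gen Pgen" "i \<in> {1..n}"
    then show ?thesis
      using magic_column_sum[of i] ev(6)[of "{1..n}" "\<lambda>k. Ugen k i" Pgen] Ug[of _ i] Pg
      by (simp add: ev(7)[OF Pg]) (simp add: b_def)
  qed
  then have "\<exists>h. unital_star_hom (universal_cstar (B_s_gens n) (B_s_rels n)) ?D h \<and>
      (\<forall>g\<in>B_s_gens n. h (universal_gen (B_s_gens n) (B_s_rels n) g) = b g)"
    using bc by (intro B.universal_property D.unital_cstar_algebra_axioms) auto
  then obtain h where h: "unital_star_hom (B_s n) ?D h"
    "\<forall>g\<in>B_s_gens n. h (universal_gen (B_s_gens n) (B_s_rels n) g) = b g"
    unfolding B_s_def by blast
  have "h (B_s_u n i j) = magic_proj i j" if "i \<in> {1..n}" "j \<in> {1..n}" for i j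
    using h(2) Ug[OF that] by (auto simp: B_s_u_def b_def)
  moreover have "h (B_s_P n) = const_proj" using h(2) Pg by (auto simp: B_s_P_def b_def)
  ultimately show ?thesis using h(1) by blast
qed

text \<open>Apply the representation to the exchangeability identity of a word. Both sides become
  multiples of \<open>const_proj\<close>, and the coefficient on the right is a walk sum that sees
  the word only through its pattern.\<close>

lemma boolean_exchangeable_pattern:
  assumes "nc_probability_space A \<phi>" and x: "\<forall>i\<in>{1..n}. x i \<in> carrier A"
    and ex: "boolean_exchangeable A \<phi> n x"
  shows "\<exists>F. \<forall>w\<in>lists {1..n}. w \<noteq> [] \<longrightarrow> joint_distribution A \<phi> x (monomial w) = F (pattern w)"
proof -
  let ?D = "matrix_algebra (square n)"
  let ?m = "\<lambda>w. joint_distribution A \<phi> x (monomial w)"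
  let ?F = "\<lambda>p. \<Sum>a\<in>{1..n}. walk_sum n (\<lambda>e e'. complex_of_real (transition n e e')) (\<lambda>i. ?m (a # i)) a p
      * complex_of_real (1 / n)"
  interpret D: unital_cstar_algebra ?D by (rule unital_cstar_algebra_matrix) simp
  interpret B: bounded_presentation "B_s_gens n" "B_s_rels n" by (rule bounded_presentation_B_s)
  obtain h where h: "unital_star_hom (B_s n) ?D h"
    and hu: "\<And>i j. i \<in> {1..n} \<Longrightarrow> j \<in> {1..n} \<Longrightarrow> h (B_s_u n i j) = magic_proj i j" and hP: "h (B_s_P n) = const_proj"
    using B_s_representation by blast
  interpret Bs: unital_cstar_algebra "B_s n" unfolding B_s_def by (rule B.unital_cstar_algebra_universal)
  have uc: "B_s_u n i j \<in> carrier (B_s n)" if "i \<in> {1..n}" "j \<in> {1..n}" for i j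
    unfolding B_s_def B_s_u_def by (rule B.universal_gen_closed) (use that in \<open>simp add: B_s_gens_def\<close>)
  have Pc: "B_s_P n \<in> carrier (B_s n)"
    unfolding B_s_def B_s_P_def by (rule B.universal_gen_closed) (simp add: B_s_gens_def)
  have UPc: "magic_proj i j \<in> carrier ?D" "const_proj \<in> carrier ?D" for i j by (auto simp: rank_one_closed)
  have "?m w = ?F (pattern w)" if w: "w \<in> lists {1..n}" "w \<noteq> []" for w
  proof -
    let ?T = "word_sum (B_s n) n (B_s_u n) w ?m"
    have "?m w \<odot>\<^bsub>B_s n\<^esub> B_s_P n = B_s_P n \<otimes>\<^bsub>B_s n\<^esub> ?T \<otimes>\<^bsub>B_s n\<^esub> B_s_P n"
      using ex monomial_closed[OF w(1)] Bs.tensor_id_coaction_monomial[of n "{1..n}" "B_s_u n", OF uc w(1)]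
      by (simp add: boolean_exchangeable_def Let_def)
    then have "h (?m w \<odot>\<^bsub>B_s n\<^esub> B_s_P n) = h (B_s_P n \<otimes>\<^bsub>B_s n\<^esub> ?T \<otimes>\<^bsub>B_s n\<^esub> B_s_P n)" by simp
    moreover have "h ?T = word_sum ?D n (\<lambda>i j. h (B_s_u n i j)) w ?m"
      by (rule star_hom_word_sum[OF Bs.star_algebra_axioms D.star_algebra_axioms h uc w(1)])
    moreover have "\<dots> = word_sum ?D n magic_proj w ?m"
      by (rule D.word_sum_cong[OF w(1)]) (auto simp: hu UPc)
    moreover have "?T \<in> carrier (B_s n)" by (rule Bs.word_sum_closed[of n "{1..n}" "B_s_u n", OF uc w(1)])
    ultimately have "?m w \<odot>\<^bsub>?D\<^esub> const_proj = const_proj \<otimes>\<^bsub>?D\<^esub> word_sum ?D n magic_proj w ?m \<otimes>\<^bsub>?D\<^esub> const_proj"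
      using h Pc hP by (simp add: unital_star_hom_def)
    also have "\<dots> = ?F (pattern w) \<odot>\<^bsub>?D\<^esub> const_proj"
      using UPc magic_relations(6) magic_relations(7) w
      by (intro D.compressed_word_sum_walk[where V = "{1..n}" and u = magic_proj and P = const_proj
            and t = "\<lambda>e e'. complex_of_real (transition n e e')"]) blast+
    \<comment> \<open>Comparing one entry of \<open>const_proj\<close>, whose value 1/n^2 is
      nonzero, leaves an equation between scalars.\<close>
    finally have "(?m w \<odot>\<^bsub>?D\<^esub> const_proj) (1, 1) (1, 1) = (?F (pattern w) \<odot>\<^bsub>?D\<^esub> const_proj) (1, 1) (1, 1)" by simp
    then show ?thesis using n by (simp add: matrix_algebra_simps(6) rank_one_def const_vec_def)
  qed
  then show ?thesis by (intro exI[of _ ?F]) blast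
qed

end

section \<open>Boolean spreadability\<close>

text \<open>The relations in the form required by \<open>projection_word_sum_pattern\<close>. The
  case i' = i of the order relation makes the projections in one row orthogonal, and taking adjoints
  moves \<open>P\<close> to the left in the column sums.\<close>

lemma B_i_relations:
  shows "unital_cstar_algebra (B_i n k)"
    and "B_i_P n k \<in> carrier (B_i n k)"
    and "B_i_P n k \<otimes>\<^bsub>B_i n k\<^esub> B_i_P n k = B_i_P n k"
    and "i \<in> {1..n} \<Longrightarrow> j \<in> {1..k} \<Longrightarrow> B_i_u n k i j \<in> carrier (B_i n k)"
    and "i \<in> {1..n} \<Longrightarrow> j \<in> {1..k} \<Longrightarrow> B_i_u n k i j \<otimes>\<^bsub>B_i n k\<^esub> B_i_u n k i j = B_i_u n k i j"
    and "i \<in> {1..n} \<Longrightarrow> j \<in> {1..k} \<Longrightarrow> j' \<in> {1..k} \<Longrightarrow> j \<noteq> j' \<Longrightarrow>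
      B_i_u n k i j \<otimes>\<^bsub>B_i n k\<^esub> B_i_u n k i j' = \<zero>\<^bsub>B_i n k\<^esub>"
    and "j \<in> {1..k} \<Longrightarrow> (\<Oplus>\<^bsub>B_i n k\<^esub>i\<in>{1..n}. B_i_P n k \<otimes>\<^bsub>B_i n k\<^esub> B_i_u n k i j) = B_i_P n k"
proof -
  interpret B: bounded_presentation "B_i_gens n k" "B_i_rels n k" by (rule bounded_presentation_B_i)
  show "unital_cstar_algebra (B_i n k)" unfolding B_i_def by (rule B.unital_cstar_algebra_universal)
  then interpret C: unital_cstar_algebra "B_i n k" .
  note folds = B_i_def[symmetric] B_i_P_def[symmetric] B_i_u_def[symmetric]
  have Pg: "Pgen \<in> B_i_gens n k" by (simp add: B_i_gens_def)
  have Ug: "Ugen i j \<in> B_i_gens n k" if "i \<in> {1..n}" "j \<in> {1..k}" for i j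
    using that by (simp add: B_i_gens_def)
  note Pc = B.universal_gen_closed[OF Pg, unfolded folds]
  note uc = B.universal_gen_closed[OF Ug, unfolded folds]
  show "B_i_P n k \<in> carrier (B_i n k)" by (rule Pc)
  show "B_i_P n k \<otimes>\<^bsub>B_i n k\<^esub> B_i_P n k = B_i_P n k"
    by (rule B.universal_gen_projection(1)[OF Pg, unfolded folds])
  show "B_i_u n k i j \<in> carrier (B_i n k)" "B_i_u n k i j \<otimes>\<^bsub>B_i n k\<^esub> B_i_u n k i j = B_i_u n k i j"
    if "i \<in> {1..n}" "j \<in> {1..k}"
    using uc[OF that] B.universal_gen_projection(1)[OF Ug[OF that], unfolded folds] by auto
  have us: "star (B_i n k) (B_i_u n k i j) = B_i_u n k i j" if "i \<in> {1..n}" "j \<in> {1..k}" for i j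
    using B.universal_gen_projection(2)[OF Ug[OF that], unfolded folds] .
  have Ps: "star (B_i n k) (B_i_P n k) = B_i_P n k"
    using B.universal_gen_projection(2)[OF Pg, unfolded folds] .
  have lt: "B_i_u n k i j \<otimes>\<^bsub>B_i n k\<^esub> B_i_u n k i j' = \<zero>\<^bsub>B_i n k\<^esub>"
    if "i \<in> {1..n}" "j \<in> {1..k}" "j' \<in> {1..k}" "j < j'" for i j j'
  proof -
    have "(free_gen (Ugen i j) \<otimes>\<^bsub>B.F\<^esub> free_gen (Ugen i j'), \<zero>\<^bsub>B.F\<^esub>) \<in> B_i_rels n k"
      unfolding B_i_rels_def Let_def using that by blast
    from B.universal_relations[OF this] show ?thesis
      unfolding B_i_def B_i_u_def using that by (simp add: B.universal_gen_eval Ug)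
  qed
  show "B_i_u n k i j \<otimes>\<^bsub>B_i n k\<^esub> B_i_u n k i j' = \<zero>\<^bsub>B_i n k\<^esub>"
    if "i \<in> {1..n}" "j \<in> {1..k}" "j' \<in> {1..k}" "j \<noteq> j'"
  proof (cases "j < j'")
    case False
    then have "star (B_i n k) (B_i_u n k i j' \<otimes>\<^bsub>B_i n k\<^esub> B_i_u n k i j) = star (B_i n k) \<zero>\<^bsub>B_i n k\<^esub>"
      using lt[of i j' j] that by simp
    then show ?thesis using that uc us by (simp add: C.star_mult)
  qed (use lt that in blast)
  show "(\<Oplus>\<^bsub>B_i n k\<^esub>i\<in>{1..n}. B_i_P n k \<otimes>\<^bsub>B_i n k\<^esub> B_i_u n k i j) = B_i_P n k" if j: "j \<in> {1..k}"
  proof -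
    have "(\<Oplus>\<^bsub>B.F\<^esub>i\<in>{1..n}. free_gen (Ugen i j) \<otimes>\<^bsub>B.F\<^esub> free_gen Pgen, free_gen Pgen) \<in> B_i_rels n k"
      unfolding B_i_rels_def Let_def using j by blast
    from B.universal_relations[OF this]
    have "(\<Oplus>\<^bsub>B_i n k\<^esub>i\<in>{1..n}. B_i_u n k i j \<otimes>\<^bsub>B_i n k\<^esub> B_i_P n k) = B_i_P n k"
      unfolding B_i_def B_i_u_def B_i_P_def
      using B.universal_gen_eval(6)[of "{1..n}" "\<lambda>i. Ugen i j" Pgen] Ug[OF _ j] Pg
      by (simp add: B.universal_gen_eval(7)[OF Pg])
    then have "star (B_i n k) (\<Oplus>\<^bsub>B_i n k\<^esub>i\<in>{1..n}. B_i_u n k i j \<otimes>\<^bsub>B_i n k\<^esub> B_i_P n k) = B_i_P n k"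
      using Ps by simp
    moreover have "star (B_i n k) (\<Oplus>\<^bsub>B_i n k\<^esub>i\<in>{1..n}. B_i_u n k i j \<otimes>\<^bsub>B_i n k\<^esub> B_i_P n k) =
        (\<Oplus>\<^bsub>B_i n k\<^esub>i\<in>{1..n}. star (B_i n k) (B_i_u n k i j \<otimes>\<^bsub>B_i n k\<^esub> B_i_P n k))"
      using uc j Pc by (intro C.star_finsum) auto
    moreover have "\<dots> = (\<Oplus>\<^bsub>B_i n k\<^esub>i\<in>{1..n}. B_i_P n k \<otimes>\<^bsub>B_i n k\<^esub> B_i_u n k i j)"
      using uc us Ps j Pc by (intro C.finsum_cong') (auto simp: C.star_mult)
    ultimately show ?thesis by simp
  qed
qed

lemma boolean_exchangeable_imp_spreadable:
  assumes A: "nc_probability_space A \<phi>" and x: "\<forall>i\<in>{1..n}. x i \<in> carrier A"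
    and ex: "boolean_exchangeable A \<phi> n x"
  shows "boolean_spreadable A \<phi> n x"
  unfolding boolean_spreadable_def Let_def
proof (intro ballI)
  fix k p assume k: "k \<in> {1..<n}" and p: "p \<in> carrier (nc_polynomials {1..k})"
  \<comment> \<open>A \<open>k\<close> with 1 \<le> k < n exists only if n \<ge> 2, so the division
    by n - 1 in the representation makes sense.\<close>
  then have n: "n \<ge> 2" and V: "{1..k} \<subseteq> {1..n}" by auto
  let ?m = "\<lambda>w. joint_distribution A \<phi> x (monomial w)"
  obtain F where F: "\<And>w. w \<in> lists {1..n} \<Longrightarrow> w \<noteq> [] \<Longrightarrow> ?m w = F (pattern w)"
    using boolean_exchangeable_pattern[OF n A x ex] by blast
  interpret nc_probability_space A \<phi> by fact
  note B = B_i_relations[where n = n and k = k]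
  interpret C: unital_cstar_algebra "B_i n k" by (rule B(1))
  show "joint_distribution A \<phi> x p \<odot>\<^bsub>B_i n k\<^esub> B_i_P n k =
    B_i_P n k \<otimes>\<^bsub>B_i n k\<^esub> tensor_id (B_i n k) (joint_distribution A \<phi> x) (coaction n (B_i n k) (B_i_u n k) p)
      \<otimes>\<^bsub>B_i n k\<^esub> B_i_P n k"
  proof (rule coaction_identity_of_words[OF x C.complex_algebra_axioms V B(4,2) _ p])
    fix w assume w: "w \<in> lists {1..k}"
    show "?m w \<odot>\<^bsub>B_i n k\<^esub> B_i_P n k =
      B_i_P n k \<otimes>\<^bsub>B_i n k\<^esub> word_sum (B_i n k) n (B_i_u n k) w ?m \<otimes>\<^bsub>B_i n k\<^esub> B_i_P n k"
    proof (cases "w = []")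
      case True
      then show ?thesis using B(2,3) by (simp add: C.smult_mult_l C.smult_mult_r)
    next
      case False
      have "word_sum (B_i n k) n (B_i_u n k) w ?m =
          word_sum (B_i n k) n (B_i_u n k) w (\<lambda>i. F (pattern i))"
        using False by (intro C.word_sum_cong[OF w] B(4) F) auto
      then have "B_i_P n k \<otimes>\<^bsub>B_i n k\<^esub> word_sum (B_i n k) n (B_i_u n k) w ?m = F (pattern w) \<odot>\<^bsub>B_i n k\<^esub> B_i_P n k"
        using C.projection_word_sum_pattern[where V = "{1..k}" and F = F, OF B(2,4,5,6,7) w False] by simp
      moreover have "?m w = F (pattern w)" using F[OF _ False] w lists_mono[OF V] by blast
      ultimately show ?thesis using B(2,3) by (simp add: C.smult_mult_l)
    qed
  qed
qed

section \<open>Projections that sum to one\<close>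

context complex_algebra
begin

context
  fixes q a
  assumes q: "q \<in> carrier A" and a: "a \<in> carrier A"
    and qq: "q \<otimes> q = q" and qa: "q \<otimes> a = a" and aq: "a \<otimes> q = a"
begin

text \<open>Polynomials of degree at most three in \<open>a\<close> inside the corner of the
  idempotent \<open>q\<close>, which takes the place of the unit. Identities in the algebra then
  follow by comparing complex coefficients.\<close>

definition cubic :: "complex \<Rightarrow> complex \<Rightarrow> complex \<Rightarrow> complex \<Rightarrow> 'a" where
  "cubic c0 c1 c2 c3 = c0 \<odot> q \<oplus> (c1 \<odot> a \<oplus> (c2 \<odot> (a \<otimes> a) \<oplus> c3 \<odot> (a \<otimes> (a \<otimes> a))))"

lemma cubic_closed [simp]: "cubic c0 c1 c2 c3 \<in> carrier A"
  using q a by (simp add: cubic_def)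

lemma cubic_add:
  "cubic c0 c1 c2 c3 \<oplus> cubic d0 d1 d2 d3 = cubic (c0 + d0) (c1 + d1) (c2 + d2) (c3 + d3)"
  using q a by (simp add: cubic_def smult_l_distr a_ac)

lemma cubic_smult: "z \<odot> cubic c0 c1 c2 c3 = cubic (z * c0) (z * c1) (z * c2) (z * c3)"
  using q a by (simp add: cubic_def smult_r_distr smult_assoc)

lemma linear_cubic: "q \<oplus> z \<odot> a = cubic 1 z 0 0"
  using q a by (simp add: cubic_def)

lemma linear_mult_cubic:
  "(q \<oplus> z \<odot> a) \<otimes> cubic c0 c1 c2 0 = cubic c0 (c1 + z * c0) (c2 + z * c1) (z * c2)"
proof -
  have "q \<otimes> (a \<otimes> a) = a \<otimes> a" using q a qa by (simp flip: m_assoc)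
  then have "q \<otimes> cubic c0 c1 c2 0 = cubic c0 c1 c2 0"
    using q a by (simp add: cubic_def r_distr smult_mult_r qq qa)
  moreover have "a \<otimes> cubic c0 c1 c2 0 = cubic 0 c0 c1 c2"
    using q a by (simp add: cubic_def r_distr smult_mult_r aq)
  ultimately have "(q \<oplus> z \<odot> a) \<otimes> cubic c0 c1 c2 0 = cubic c0 c1 c2 0 \<oplus> z \<odot> cubic 0 c0 c1 c2"
    using q a by (simp add: l_distr smult_mult_l)
  then show ?thesis by (simp add: cubic_smult cubic_add)
qed

lemma linear_cube:
  "(q \<oplus> z \<odot> a) \<otimes> ((q \<oplus> z \<odot> a) \<otimes> (q \<oplus> z \<odot> a)) = cubic 1 (3 * z) (3 * z\<^sup>2) (z ^ 3)"
proof -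
  have "(q \<oplus> z \<odot> a) \<otimes> (q \<oplus> z \<odot> a) = cubic 1 (2 * z) (z\<^sup>2) 0"
    using linear_mult_cubic[of z 1 z 0] by (simp add: linear_cubic power2_eq_square)
  then show ?thesis
    using linear_mult_cubic[of z 1 "2 * z" "z\<^sup>2"] by (simp add: algebra_simps power2_eq_square power3_eq_cube)
qed

text \<open>
  A convex combination of the cubes \<open>(q + wza)\<^sup>3\<close> whose weights are chosen such that the average of \<open>z\<close> is
  \<open>1/2\<close> and the averages of \<open>z\<^sup>2\<close> and \<open>z\<^sup>3\<close> vanish; all \<open>z\<close> lie in the convex hull of \<open>\<plusminus>1, \<plusminus>\<i>\<close>.
\<close>

lemma three_halves:
  "q \<oplus> (3 / 2 * w) \<odot> a =
    (1 / 6) \<odot> cubic 1 (3 * w) (3 * w\<^sup>2) (w ^ 3) \<oplus>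
    ((1 / 3) \<odot> cubic 1 (3 * (w * (1 + \<i>) / 2)) (3 * (w * (1 + \<i>) / 2)\<^sup>2) ((w * (1 + \<i>) / 2) ^ 3) \<oplus>
    ((1 / 3) \<odot> cubic 1 (3 * (w * (1 - \<i>) / 2)) (3 * (w * (1 - \<i>) / 2)\<^sup>2) ((w * (1 - \<i>) / 2) ^ 3) \<oplus>
    ((1 / 12) \<odot> cubic 1 (3 * (w * \<i>)) (3 * (w * \<i>)\<^sup>2) ((w * \<i>) ^ 3) \<oplus>
     (1 / 12) \<odot> cubic 1 (3 * (w * - \<i>)) (3 * (w * - \<i>)\<^sup>2) ((w * - \<i>) ^ 3))))"
proof -
  have i2: "(1 + \<i>)\<^sup>2 = 2 * \<i>" "(1 - \<i>)\<^sup>2 = - 2 * \<i>" by (simp_all add: power2_eq_square algebra_simps)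
  have i3: "(1 + \<i>) ^ 3 = - 2 + 2 * \<i>" "(1 - \<i>) ^ 3 = - 2 - 2 * \<i>"
    by (simp_all add: power3_eq_cube algebra_simps)
  show ?thesis
    unfolding linear_cubic cubic_smult cubic_add
    by (rule arg_cong4[of _ _ _ _ _ _ _ _ cubic])
      (simp_all add: power_mult_distrib power_divide i2 i3, (simp add: field_simps)+)
qed

end

end

section \<open>Contractions and the orthogonality of projections with sum one\<close>

context unital_cstar_algebra
begin

context
  fixes q
  assumes q: "q \<in> carrier A" and qq: "q \<otimes> q = q"
begin

text \<open>Cubes and convex combinations of contractions are contractions.
  \<open>three_halves\<close> writes the element as a convex combination of cubes of elements
  \<open>q \<oplus> z \<odot> a\<close>, which are contractions because each z is one of the four
  given directions or a midpoint of two of them.\<close>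

lemma contraction_three_halves:
  assumes a: "a \<in> carrier A" and qa: "q \<otimes> a = a" and aq: "a \<otimes> q = a"
    and b: "\<And>w. w \<in> {1, - 1, \<i>, - \<i>} \<Longrightarrow> cnorm A (q \<oplus> w \<odot> a) \<le> 1"
    and w: "w \<in> {1, - 1, \<i>, - \<i>}"
  shows "cnorm A (q \<oplus> w \<odot> ((3 / 2) \<odot> a)) \<le> 1"
proof -
  note cb = q a qq qa aq
  let ?C = "\<lambda>z. cubic q a 1 (3 * z) (3 * z\<^sup>2) (z ^ 3)"
  have cl: "q \<oplus> z \<odot> a \<in> carrier A" "?C z \<in> carrier A" for z
    using q a cubic_closed[OF cb] by auto
  have cube: "cnorm A (?C z) \<le> 1" if "cnorm A (q \<oplus> z \<odot> a) \<le> 1" for z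
  proof -
    have "cnorm A (?C z) \<le> cnorm A (q \<oplus> z \<odot> a) * (cnorm A (q \<oplus> z \<odot> a) * cnorm A (q \<oplus> z \<odot> a))"
      unfolding linear_cube[OF cb, symmetric] using cl(1)[of z]
      by (intro order_trans[OF sn_mult] mult_left_mono sn_mult) auto
    also have "\<dots> \<le> 1 * (1 * 1)" using that cl(1)[of z] by (intro mult_mono) auto
    finally show ?thesis by simp
  qed
  have mid: "cnorm A (q \<oplus> ((z + z') / 2) \<odot> a) \<le> 1"
    if "cnorm A (q \<oplus> z \<odot> a) \<le> 1" "cnorm A (q \<oplus> z' \<odot> a) \<le> 1" for z z'
  proof -
    have "q \<oplus> ((z + z') / 2) \<odot> a = (1 / 2) \<odot> (q \<oplus> z \<odot> a) \<oplus> (1 / 2) \<odot> (q \<oplus> z' \<odot> a)"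
      unfolding linear_cubic[OF cb] cubic_smult[OF cb] cubic_add[OF cb] by (simp add: add_divide_distrib)
    then have "cnorm A (q \<oplus> ((z + z') / 2) \<odot> a) \<le>
        cnorm A ((1 / 2) \<odot> (q \<oplus> z \<odot> a)) + cnorm A ((1 / 2) \<odot> (q \<oplus> z' \<odot> a))"
      using cl(1) sn_add by simp
    also have "\<dots> \<le> 1" using that cl(1) by (simp add: sn_smult norm_divide)
    finally show ?thesis .
  qed
  have wi: "w * \<i> \<in> {1, - 1, \<i>, - \<i>}" "w * - \<i> \<in> {1, - 1, \<i>, - \<i>}" using w by auto
  \<comment> \<open>The points w(1 + \<i>)/2 and w(1 - \<i>)/2 are the midpoints of w with w\<i> and
    with -w\<i>.\<close>
  have m1: "cnorm A (q \<oplus> (w * (1 + \<i>) / 2) \<odot> a) \<le> 1"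
    using mid[OF b[OF w] b[OF wi(1)]] by (simp add: algebra_simps)
  have m2: "cnorm A (q \<oplus> (w * (1 - \<i>) / 2) \<odot> a) \<le> 1"
    using mid[OF b[OF w] b[OF wi(2)]] by (simp add: algebra_simps)
  have scaled: "cnorm A (of_real t \<odot> ?C z) \<le> t" if "cnorm A (q \<oplus> z \<odot> a) \<le> 1" "t \<ge> 0" for t z
    using cube[OF that(1)] that(2) cl(2) by (simp add: sn_smult mult_left_le)
  have tri: "cnorm A (x \<oplus> y) \<le> s + t"
    if "x \<in> carrier A" "y \<in> carrier A" "cnorm A x \<le> s" "cnorm A y \<le> t" for x y s t
    using sn_add[OF that(1,2)] that(3,4) by linarith
  let ?S = "of_real (1 / 6) \<odot> ?C w \<oplus> (of_real (1 / 3) \<odot> ?C (w * (1 + \<i>) / 2) \<oplus>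
      (of_real (1 / 3) \<odot> ?C (w * (1 - \<i>) / 2) \<oplus>
      (of_real (1 / 12) \<odot> ?C (w * \<i>) \<oplus> of_real (1 / 12) \<odot> ?C (w * - \<i>))))"
  have "q \<oplus> w \<odot> ((3 / 2) \<odot> a) = q \<oplus> (3 / 2 * w) \<odot> a"
    using smult_assoc[OF a, of w "3 / 2"] by (simp add: mult.commute)
  then have S: "q \<oplus> w \<odot> ((3 / 2) \<odot> a) = ?S"
    using three_halves[OF cb, of w] by simp
  have "cnorm A ?S \<le> 1 / 6 + (1 / 3 + (1 / 3 + (1 / 12 + 1 / 12)))"
    by (intro tri scaled b w wi m1 m2 a_closed smult_closed cl(2)) auto
  then show ?thesis unfolding S by (rule order_trans) simp
qed

text \<open>By the preceding lemma the assumption passes from \<open>a\<close> to \<open>(3/2)\<^sup>m a\<close>, so these elements stay bounded.\<close>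

lemma contraction_zero:
  assumes "a \<in> carrier A" "q \<otimes> a = a" "a \<otimes> q = a"
    and "\<And>w. w \<in> {1, - 1, \<i>, - \<i>} \<Longrightarrow> cnorm A (q \<oplus> w \<odot> a) \<le> 1"
  shows "a = \<zero>"
proof (rule ccontr)
  assume "a \<noteq> \<zero>"
  then have pos: "cnorm A a > 0" using norm_definite[OF assms(1)] sn_nonneg[OF assms(1)] by fastforce
  have iter: "cnorm A (q \<oplus> w \<odot> ((3 / 2) ^ m \<odot> a)) \<le> 1" if "w \<in> {1, - 1, \<i>, - \<i>}" for w m
    using that
  proof (induction m arbitrary: w)
    case 0
    then show ?case using assms by simp
  next
    case (Suc m)
    have "cnorm A (q \<oplus> w \<odot> ((3 / 2) \<odot> ((3 / 2) ^ m \<odot> a))) \<le> 1"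
      using assms(1-3) q Suc by (intro contraction_three_halves) (auto simp: smult_mult_l smult_mult_r)
    moreover have "(3 / 2) \<odot> ((3 / 2) ^ m \<odot> a) = (3 / 2) ^ Suc m \<odot> a"
      using smult_assoc[OF assms(1), of "3 / 2" "(3 / 2) ^ m"] by simp
    ultimately show ?case by (simp only:)
  qed
  \<comment> \<open>With this \<open>m\<close>, the norm of \<open>(3 / 2) ^ m \<odot> a\<close>
    exceeds the bound 1 + \<open>cnorm A q\<close> left by the contraction estimate.\<close>
  obtain m where m: "(1 + cnorm A q) / cnorm A a < (3 / 2) ^ m"
    using real_arch_pow[of "3 / 2"] by auto
  have "(3 / 2 :: complex) ^ m \<odot> a = (q \<oplus> 1 \<odot> ((3 / 2) ^ m \<odot> a)) \<oplus> \<ominus> q"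
    using q assms(1) by (simp add: a_comm[of q] a_assoc r_neg)
  then have "cnorm A ((3 / 2 :: complex) ^ m \<odot> a) \<le> 1 + cnorm A q"
    using sn_add[of "q \<oplus> 1 \<odot> ((3 / 2) ^ m \<odot> a)" "\<ominus> q"] iter[of 1 m] q assms(1) by simp
  then have "(3 / 2) ^ m * cnorm A a \<le> 1 + cnorm A q"
    using assms(1) by (simp add: sn_smult norm_power norm_divide)
  then show False using m pos by (simp add: field_simps)
qed

end

lemma projection_norm_le: assumes "projection p" shows "cnorm A p \<le> 1"
proof (cases "cnorm A p = 0")
  case False
  have "(cnorm A p)\<^sup>2 = cnorm A p" using sn_cstar[of p] assms by (simp add: projection_def)
  then show ?thesis using False by (simp add: power2_eq_square)
qed simp

text \<open>The hypothesis \<open>t \<otimes> s = t\<close> is the order relation t \<le> s of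
  projections; its adjoint gives the other product.\<close>

lemma projection_diff:
  assumes "projection s" "projection t" "t \<otimes> s = t"
  shows "projection (s \<ominus> t)"
proof -
  have c: "s \<in> carrier A" "t \<in> carrier A" using assms by (auto simp: projection_def)
  have "star A (t \<otimes> s) = star A t" using assms(3) by simp
  then have st: "s \<otimes> t = t" using assms(1,2) c by (simp add: star_mult projection_def)
  have "(s \<ominus> t) \<otimes> (s \<ominus> t) = s \<ominus> t"
    using c assms st
    by (simp add: a_minus_def l_distr r_distr l_minus r_minus projection_def a_assoc r_neg)
  then show ?thesis using c assms by (simp add: projection_def star_minus)
qed

text \<open>Put q = \<open>p j\<close> and r = \<open>p i\<close>, and let e be the sum of the other
  projections. Then x = q r q is positive, while compressing the total sum by q shows that -x = q e
  q is positive too; hence x = 0. Positivity is expressed through norms: for a = x/N, the elements q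
  + a, q - a, q + \<i> a and q - \<i> a are contractions, and \<open>contraction_zero\<close>
  applies.\<close>

lemma sum_one_orthogonal:
  assumes I: "finite I" and p: "\<And>i. i \<in> I \<Longrightarrow> projection (p i)" and sum: "(\<Oplus>i\<in>I. p i) = \<one>"
    and ij: "i \<in> I" "j \<in> I" "i \<noteq> j"
  shows "p i \<otimes> p j = \<zero>"
proof -
  define J where "J = I - {i, j}"
  define e where "e = (\<Oplus>l\<in>J. p l)"
  \<comment> \<open>The summand 1 keeps \<open>N\<close> positive when no other projections
    remain.\<close>
  define N where "N = real (card J) + 1"
  let ?q = "p j" and ?r = "p i"
  have pc: "p l \<in> carrier A" if "l \<in> I" for l using p[OF that] by (simp add: projection_def)
  have J: "finite J" "J \<subseteq> I" using I by (auto simp: J_def)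
  have c: "?q \<in> carrier A" "?r \<in> carrier A" using pc ij by auto
  have pq: "?q \<otimes> ?q = ?q" "star A ?q = ?q" "?r \<otimes> ?r = ?r" "star A ?r = ?r"
    using p[of i] p[of j] ij by (auto simp: projection_def)
  have ec: "e \<in> carrier A" unfolding e_def using J pc by (intro finsum_closed) auto
  have I_eq: "insert j (insert i J) = I" and new: "i \<notin> J" "j \<notin> insert i J"
    using ij by (auto simp: J_def)
  have pJ: "p \<in> J \<rightarrow> carrier A" using J pc by auto
  have "(\<Oplus>l\<in>insert i J. p l) = ?r \<oplus> e"
    unfolding e_def by (rule finsum_insert[OF J(1) new(1) pJ c(2)])
  moreover have "(\<Oplus>l\<in>insert j (insert i J). p l) = ?q \<oplus> (\<Oplus>l\<in>insert i J. p l)"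
    using J pJ c by (intro finsum_insert new(2)) auto
  ultimately have one: "?q \<oplus> (?r \<oplus> e) = \<one>" using sum I_eq by simp
  \<comment> \<open>Sum the contractions \<open>\<one> \<ominus> p l\<close> over \<open>K\<close>.
    For \<open>K = J\<close> this is the norm form of e \<ge> 0.\<close>
  have "cnorm A (of_real (card K) \<odot> \<one> \<ominus> (\<Oplus>l\<in>K. p l)) \<le> card K" if "finite K" "K \<subseteq> I" for K
    using that
  proof (induction K rule: finite_induct)
    case empty
    then show ?case by (simp add: a_minus_def)
  next
    case (insert l K)
    have s: "(\<Oplus>l\<in>K. p l) \<in> carrier A" "p l \<in> carrier A" using insert pc by (auto intro!: finsum_closed)
    have "(\<Oplus>l\<in>insert l K. p l) = p l \<oplus> (\<Oplus>l\<in>K. p l)"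
      using insert pc s by (intro finsum_insert) auto
    then have "of_real (card (insert l K)) \<odot> \<one> \<ominus> (\<Oplus>l\<in>insert l K. p l) =
        (\<one> \<oplus> of_real (card K) \<odot> \<one>) \<ominus> (p l \<oplus> (\<Oplus>l\<in>K. p l))"
      using insert by (simp add: smult_l_distr)
    also have "\<dots> = (\<one> \<ominus> p l) \<oplus> (of_real (card K) \<odot> \<one> \<ominus> (\<Oplus>l\<in>K. p l))"
      using s by (intro add_diff) auto
    finally have "cnorm A (of_real (card (insert l K)) \<odot> \<one> \<ominus> (\<Oplus>l\<in>insert l K. p l)) \<le>
        cnorm A (\<one> \<ominus> p l) + cnorm A (of_real (card K) \<odot> \<one> \<ominus> (\<Oplus>l\<in>K. p l))"
      using s sn_add by simp
    also have "cnorm A (\<one> \<ominus> p l) \<le> 1"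
      using s p[of l] insert by (intro projection_norm_le projection_diff) (auto simp: projection_def)
    finally show ?case using insert by simp
  qed
  from this[OF J] have eJ: "cnorm A (of_real (card J) \<odot> \<one> \<ominus> e) \<le> card J" unfolding e_def .
  define x where "x = ?q \<otimes> ?r \<otimes> ?q"
  have xc: "x \<in> carrier A" using c by (simp add: x_def)
  have qx: "?q \<otimes> x = x" "x \<otimes> ?q = x"
    using c pq by (simp_all add: x_def m_assoc) (simp add: m_assoc[symmetric])
  have sx: "star A x = x" using c pq by (simp add: x_def star_mult m_assoc)
  have "?q \<otimes> (?q \<oplus> (?r \<oplus> e)) \<otimes> ?q = ?q" unfolding one using c pq by simp
  then have "?q \<oplus> (x \<oplus> ?q \<otimes> e \<otimes> ?q) = ?q"
    using c ec pq by (simp add: x_def r_distr l_distr)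
  then have "x \<oplus> ?q \<otimes> e \<otimes> ?q = \<zero>"
    using add.r_cancel_one'[of ?q "x \<oplus> ?q \<otimes> e \<otimes> ?q"] add.l_cancel_one'[of ?q "x \<oplus> ?q \<otimes> e \<otimes> ?q"] c ec xc by simp
  then have qeq: "\<ominus> (?q \<otimes> e \<otimes> ?q) = x"
    using c ec xc by (intro minus_equality) auto
  have q1: "cnorm A ?q \<le> 1" using p ij by (intro projection_norm_le) auto
  have compress: "cnorm A (?q \<otimes> y \<otimes> ?q) \<le> t" if "y \<in> carrier A" "cnorm A y \<le> t" for y t
  proof -
    have "cnorm A (?q \<otimes> y \<otimes> ?q) \<le> cnorm A ?q * cnorm A y * cnorm A ?q"
      using c that by (intro order_trans[OF sn_mult] mult_right_mono sn_mult) auto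
    also have "\<dots> \<le> 1 * t * 1"
      using q1 c that order_trans[OF sn_nonneg[OF that(1)] that(2)] by (intro mult_mono) auto
    finally show ?thesis by simp
  qed
  have N: "N \<ge> 1" by (simp add: N_def)
  have Nq: "cnorm A (of_real N \<odot> ?q \<oplus> x) \<le> N"
  proof -
    have "cnorm A ((of_real (card J) \<odot> \<one> \<ominus> e) \<oplus> \<one>) \<le> N"
      using sn_add[of "of_real (card J) \<odot> \<one> \<ominus> e" \<one>] eJ ec projection_norm_le[of \<one>]
      by (simp add: projection_def N_def)
    then have "cnorm A (?q \<otimes> ((of_real (card J) \<odot> \<one> \<ominus> e) \<oplus> \<one>) \<otimes> ?q) \<le> N"
      using ec by (intro compress) auto
    also have "?q \<otimes> ((of_real (card J) \<odot> \<one> \<ominus> e) \<oplus> \<one>) \<otimes> ?q = of_real N \<odot> ?q \<oplus> x"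
      using c ec xc pq qeq
      by (simp add: a_minus_def r_distr l_distr r_minus l_minus smult_mult_l smult_mult_r N_def smult_l_distr a_ac)
    finally show ?thesis .
  qed
  have xq: "cnorm A (?q \<oplus> (-1) \<odot> x) \<le> 1"
  proof -
    have "cnorm A (?q \<otimes> (\<one> \<ominus> ?r) \<otimes> ?q) \<le> 1"
      using c p[OF ij(1)] by (intro compress projection_norm_le projection_diff) (auto simp: projection_def)
    also have "?q \<otimes> (\<one> \<ominus> ?r) \<otimes> ?q = ?q \<oplus> (-1) \<odot> x"
      using c pq xc by (simp add: a_minus_def r_distr l_distr r_minus l_minus neg_smult x_def)
    finally show ?thesis .
  qed
  \<comment> \<open>The bounds on \<open>N q + x\<close> and \<open>q - x\<close> say that \<open>x\<close> is both negative and positive.\<close>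
  define a where "a = of_real (1 / N) \<odot> x"
  have ac: "a \<in> carrier A" "?q \<otimes> a = a" "a \<otimes> ?q = a" "star A a = a"
    using xc c qx sx by (auto simp: a_def smult_mult_l smult_mult_r star_smult)
  note cb = c(1) ac(1) pq(1) ac(2,3)
  have a1: "cnorm A (?q \<oplus> 1 \<odot> a) \<le> 1"
  proof -
    have "?q \<oplus> 1 \<odot> a = of_real (1 / N) \<odot> (of_real N \<odot> ?q \<oplus> x)"
      using N c xc ac by (simp add: a_def smult_r_distr flip: smult_assoc)
    then show ?thesis using Nq N c xc by (simp add: sn_smult norm_divide field_simps)
  qed
  have a2: "cnorm A (?q \<oplus> (-1) \<odot> a) \<le> 1"
  proof -
    \<comment> \<open>The element q - a is the convex combination of q and q - x with weights 1 -
      1/N and 1/N.\<close>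
    have "?q = of_real (1 - 1 / N) \<odot> ?q \<oplus> of_real (1 / N) \<odot> ?q"
      using c by (simp flip: smult_l_distr)
    then have "?q \<oplus> (-1) \<odot> a = of_real (1 - 1 / N) \<odot> ?q \<oplus> of_real (1 / N) \<odot> ?q \<oplus> (-1) \<odot> a" by simp
    also have "\<dots> = of_real (1 - 1 / N) \<odot> ?q \<oplus> of_real (1 / N) \<odot> (?q \<oplus> (-1) \<odot> x)"
      using c xc by (simp add: a_def smult_r_distr a_assoc flip: smult_assoc)
    finally have "cnorm A (?q \<oplus> (-1) \<odot> a) \<le>
        cnorm A (of_real (1 - 1 / N) \<odot> ?q) + cnorm A (of_real (1 / N) \<odot> (?q \<oplus> (-1) \<odot> x))"
      using c xc sn_add by simp
    also have "\<dots> \<le> (1 - 1 / N) * 1 + 1 / N * 1"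
      using N c xc q1 xq unfolding sn_smult[OF c(1)] sn_smult[OF a_closed[OF c(1) smult_closed[OF xc]]] norm_of_real
      by (intro add_mono mult_mono) auto
    finally show ?thesis by simp
  qed
  have a3: "cnorm A (?q \<oplus> \<i> \<odot> a) \<le> 1"
  proof -
    have sq: "cnorm A ((?q \<oplus> w \<odot> a) \<otimes> (?q \<oplus> w \<odot> a)) \<le> 1" if "cnorm A (?q \<oplus> w \<odot> a) \<le> 1" for w
    proof -
      have "cnorm A ((?q \<oplus> w \<odot> a) \<otimes> (?q \<oplus> w \<odot> a)) \<le> cnorm A (?q \<oplus> w \<odot> a) * cnorm A (?q \<oplus> w \<odot> a)"
        using c ac by (intro sn_mult) auto
      also have "\<dots> \<le> 1 * 1" using that c ac by (intro mult_mono) auto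
      finally show ?thesis by simp
    qed
    have lm: "(?q \<oplus> w \<odot> a) \<otimes> (?q \<oplus> z \<odot> a) = cubic ?q a 1 (w + z) (w * z) 0" for w z
      using linear_mult_cubic[OF cb, of w 1 z 0] by (simp add: linear_cubic[OF cb] add.commute)
    \<comment> \<open>As a is self-adjoint, this product is q + a^2, the average of the squares of
      the contractions q + a and q - a. The C*-identity then bounds the norm of q + \<i> a.\<close>
    have "star A (?q \<oplus> \<i> \<odot> a) \<otimes> (?q \<oplus> \<i> \<odot> a) = (?q \<oplus> (- \<i>) \<odot> a) \<otimes> (?q \<oplus> \<i> \<odot> a)"
      using c ac pq by (simp add: star_add star_smult)
    also have "\<dots> = of_real (1 / 2) \<odot> ((?q \<oplus> 1 \<odot> a) \<otimes> (?q \<oplus> 1 \<odot> a)) \<oplus>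
        of_real (1 / 2) \<odot> ((?q \<oplus> (-1) \<odot> a) \<otimes> (?q \<oplus> (-1) \<odot> a))"
      unfolding lm cubic_smult[OF cb] cubic_add[OF cb] by simp
    finally have e: "star A (?q \<oplus> \<i> \<odot> a) \<otimes> (?q \<oplus> \<i> \<odot> a) = \<dots>" .
    have "(cnorm A (?q \<oplus> \<i> \<odot> a))\<^sup>2 = cnorm A (star A (?q \<oplus> \<i> \<odot> a) \<otimes> (?q \<oplus> \<i> \<odot> a))"
      using c ac by (intro sn_cstar[symmetric]) auto
    also have "\<dots> \<le> cnorm A (of_real (1 / 2) \<odot> ((?q \<oplus> 1 \<odot> a) \<otimes> (?q \<oplus> 1 \<odot> a))) +
        cnorm A (of_real (1 / 2) \<odot> ((?q \<oplus> (-1) \<odot> a) \<otimes> (?q \<oplus> (-1) \<odot> a)))"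
      unfolding e using c ac by (intro sn_add) auto
    also have "\<dots> \<le> 1 / 2 * 1 + 1 / 2 * 1"
      using sq[OF a1] sq[OF a2] c ac by (intro add_mono) (simp_all add: sn_smult norm_divide)
    finally show ?thesis using c ac by (simp add: abs_square_le_1)
  qed
  have a4: "cnorm A (?q \<oplus> (- \<i>) \<odot> a) \<le> 1"
    using a3 sn_star[of "?q \<oplus> \<i> \<odot> a"] c ac pq by (simp add: star_add star_smult)
  have "a = \<zero>"
    using a1 a2 a3 a4 by (intro contraction_zero[OF c(1) pq(1) ac(1-3)]) auto
  moreover have "x = of_real N \<odot> a" using N xc by (simp add: a_def flip: smult_assoc)
  ultimately have "x = \<zero>" by simp
  \<comment> \<open>Since x = y* y for y = r q, the C*-identity turns x = 0 into r q = 0.\<close>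
  moreover have "star A (?r \<otimes> ?q) \<otimes> (?r \<otimes> ?q) = x"
    using c pq by (simp add: star_mult x_def m_assoc) (simp add: m_assoc[symmetric])
  ultimately have "(cnorm A (?r \<otimes> ?q))\<^sup>2 = 0" using sn_cstar[of "?r \<otimes> ?q"] c by simp
  then show ?thesis using c by (intro norm_definite) auto
qed

end

section \<open>Completing an increasing family to a magic square\<close>

context unital_cstar_algebra
begin

context
  fixes n k :: nat and u :: "nat \<Rightarrow> nat \<Rightarrow> 'a"
  assumes kn: "k \<le> n"
    and proj: "\<And>i j. i \<in> {1..n} \<Longrightarrow> j \<in> {1..k} \<Longrightarrow> projection (u i j)"
    and col: "\<And>j. j \<in> {1..k} \<Longrightarrow> (\<Oplus>i\<in>{1..n}. u i j) = \<one>"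
    and incr: "\<And>i i' j j'. i \<in> {1..n} \<Longrightarrow> i' \<in> {1..n} \<Longrightarrow> j \<in> {1..k} \<Longrightarrow> j' \<in> {1..k} \<Longrightarrow>
      j < j' \<Longrightarrow> i' \<le> i \<Longrightarrow> u i j \<otimes> u i' j' = \<zero>"
begin

text \<open>The event \<open>X\<^sub>p \<le> r\<close>, with the conventions \<open>X\<^sub>0 = 0\<close> and \<open>X\<^bsub>k+1\<^esub> = \<infinity>\<close>.\<close>

definition cumulative :: "nat \<Rightarrow> nat \<Rightarrow> 'a" where
  "cumulative p r = (if p = 0 then \<one> else if p > k then \<zero> else \<Oplus>i\<in>{1..r}. u i p)"

lemma u_closed: "i \<in> {1..n} \<Longrightarrow> j \<in> {1..k} \<Longrightarrow> u i j \<in> carrier A"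
  using proj projection_closed by blast

text \<open>Each column sums to one, so its projections are orthogonal by
  \<open>sum_one_orthogonal\<close> and its partial sums are projections.\<close>

lemma cumulative_projection: "r \<le> n \<Longrightarrow> projection (cumulative p r)"
  using proj[of _ p] sum_one_orthogonal[of "{1..n}" "\<lambda>i. u i p"] col[of p]
  by (auto simp: cumulative_def projection_def[of \<one>] projection_def[of \<zero>] intro!: projection_finsum)

lemma cumulative_closed: "r \<le> n \<Longrightarrow> cumulative p r \<in> carrier A"
  using cumulative_projection projection_closed by blast

text \<open>X_{p+1} \<le> r forces X_p \<le> r - 1. The order relations annihilate the product of
  the left factor with the tail X_p \<ge> r of column p, and this tail and the right factor sum to
  one.\<close>

lemma cumulative_chain:
  assumes "r \<in> {1..n}"
  shows "cumulative (Suc p) r \<otimes> cumulative p (r - 1) = cumulative (Suc p) r"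
proof (cases "p = 0 \<or> p \<ge> k")
  \<comment> \<open>By the boundary conventions the right factor is one or the left factor is
    zero.\<close>
  case True
  then show ?thesis
    using assms cumulative_closed[of r "Suc p"] cumulative_closed[of "r - 1" p] by (auto simp: cumulative_def)
next
  case False
  then have p: "p \<in> {1..k}" "Suc p \<in> {1..k}" by auto
  let ?S = "cumulative (Suc p) r" and ?e = "\<Oplus>i\<in>{r..n}. u i p"
  have S: "?S = (\<Oplus>i\<in>{1..r}. u i (Suc p))" "cumulative p (r - 1) = (\<Oplus>i\<in>{1..r - 1}. u i p)"
    using p by (auto simp: cumulative_def)
  have c: "?S \<in> carrier A" "cumulative p (r - 1) \<in> carrier A" using assms by (auto intro!: cumulative_closed)
  have e: "?e \<in> carrier A" using p u_closed assms by (auto intro!: finsum_closed)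
  have "{1..n} = {1..r - 1} \<union> {r..n}" using assms by auto
  then have "(\<Oplus>i\<in>{1..n}. u i p) = cumulative p (r - 1) \<oplus> ?e"
    unfolding S using p u_closed assms by (auto intro!: finsum_Un_disjoint)
  then have one: "cumulative p (r - 1) \<oplus> ?e = \<one>" using col[OF p(1)] by simp
  have "?S \<otimes> ?e = (\<Oplus>i\<in>{1..r}. u i (Suc p) \<otimes> ?e)"
    unfolding S using p u_closed assms e by (intro finsum_ldistr) auto
  also have "\<dots> = (\<Oplus>i\<in>{1..r}. \<zero>)"
  proof (rule finsum_cong'[OF refl])
    fix i assume i: "i \<in> {1..r}"
    have "u i (Suc p) \<otimes> ?e = (\<Oplus>l\<in>{r..n}. u i (Suc p) \<otimes> u l p)"
      using p u_closed assms i by (intro finsum_rdistr) auto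
    also have "\<dots> = (\<Oplus>l\<in>{r..n}. \<zero>)"
    proof (rule finsum_cong'[OF refl])
      fix l assume l: "l \<in> {r..n}"
      have il: "l \<in> {1..n}" "i \<in> {1..n}" "i \<le> l" using assms i l by auto
      \<comment> \<open>The order relation has the smaller column on the left; adjoints exchange the
        factors.\<close>
      show "u i (Suc p) \<otimes> u l p = \<zero>"
        by (rule projection_orthogonal_sym[OF proj[OF il(1) p(1)] proj[OF il(2) p(2)]
              incr[OF il(1,2) p lessI il(3)]])
    qed simp
    finally show "u i (Suc p) \<otimes> ?e = \<zero>" by simp
  qed simp
  finally have z: "?S \<otimes> ?e = \<zero>" by simp
  have "?S = ?S \<otimes> (cumulative p (r - 1) \<oplus> ?e)" unfolding one using c by simp
  also have "\<dots> = ?S \<otimes> cumulative p (r - 1)" using c e z by (simp add: r_distr)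
  finally show ?thesis ..
qed

text \<open>X_p \<ge> p, obtained by descending along \<open>cumulative_chain\<close> to r =
  0.\<close>

lemma cumulative_eq_zero: "r < p \<Longrightarrow> r \<le> n \<Longrightarrow> cumulative p r = \<zero>"
proof (induction p arbitrary: r)
  case (Suc p)
  show ?case
  proof (cases "r = 0")
    case True
    then show ?thesis by (simp add: cumulative_def)
  next
    case False
    then have "cumulative p (r - 1) = \<zero>" using Suc by (intro Suc.IH) auto
    then show ?thesis
      using cumulative_chain[of r p] cumulative_closed[of r "Suc p"] False Suc.prems by simp
  qed
qed simp

text \<open>X_p \<le> n - (k - p), since k - p further values must fit above it. The chain is
  climbed up to r = n, where a whole column sums to one.\<close>

lemma cumulative_eq_one:
  assumes "p \<le> k" "r \<le> n" "n + p \<le> r + k"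
  shows "cumulative p r = \<one>"
  using assms
proof (induction "n - r" arbitrary: p r)
  case 0
  then have "r = n" by simp
  then show ?case using 0 col[of p] by (auto simp: cumulative_def)
next
  case (Suc d)
  then have "cumulative (Suc p) (Suc r) = \<one>" by (intro Suc.hyps(1)) auto
  then show ?case using cumulative_chain[of "Suc r" p] cumulative_closed[of r p] Suc by simp
qed

text \<open>The event \<open>X\<^sub>p < r < X\<^bsub>p+1\<^esub>\<close>, that is, \<open>r\<close> is the \<open>(r - p)\<close>-th element of the complement.\<close>

definition gap :: "nat \<Rightarrow> nat \<Rightarrow> 'a" where
  "gap p r = cumulative p (r - 1) \<ominus> cumulative (Suc p) r"

lemma gap_projection: "r \<in> {1..n} \<Longrightarrow> projection (gap p r)"
  unfolding gap_def by (rule projection_diff[OF cumulative_projection cumulative_projection cumulative_chain]) auto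

lemma gap_closed: "r \<in> {1..n} \<Longrightarrow> gap p r \<in> carrier A"
  using gap_projection projection_closed by blast

text \<open>Exactly p of the values lie below r in this event, and k - p above. This is impossible
  if fewer than p positions lie below r or fewer than k - p above.\<close>

lemma gap_eq_zero:
  assumes "r \<in> {1..n}" "p \<le> k" "r \<le> p \<or> n < k + r - p"
  shows "gap p r = \<zero>"
  using assms(3)
proof
  assume "r \<le> p"
  then show ?thesis
    using assms(1) cumulative_eq_zero[of "r - 1" p] cumulative_eq_zero[of r "Suc p"]
    by (auto simp: gap_def a_minus_def)
next
  assume "n < k + r - p"
  then have "cumulative p (r - 1) = \<one>" "cumulative (Suc p) r = \<one>"
    using assms(1,2) by (auto intro!: cumulative_eq_one)
  then show ?thesis by (simp add: gap_def a_minus_def r_neg)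
qed

text \<open>For j > k the entry is the event that i is the (j - k)-th element of the complement:
  exactly i - (j - k) of the values X_1, ..., X_k lie below i and none equals i. It is zero if that
  number is not between 0 and k.\<close>

definition completion :: "nat \<Rightarrow> nat \<Rightarrow> 'a" where
  "completion i j = (if j \<le> k then u i j
     else if j - k \<le> i \<and> i - (j - k) \<le> k then gap (i - (j - k)) i else \<zero>)"

lemma completion_projection: "i \<in> {1..n} \<Longrightarrow> j \<in> {1..n} \<Longrightarrow> projection (completion i j)"
  using proj[of i j] gap_projection[of i "i - (j - k)"]
  by (auto simp: completion_def projection_def[of \<zero>])

lemma completion_closed: "i \<in> {1..n} \<Longrightarrow> j \<in> {1..n} \<Longrightarrow> completion i j \<in> carrier A"
  using completion_projection projection_closed by blast

text \<open>In a new column, the row m + p with m = j - k contributes \<open>cumulative p (m + p -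
  1) \<ominus> cumulative (Suc p) (m + p)\<close>. The sum telescopes to \<open>cumulative 0\<close>
  minus \<open>cumulative (Suc k)\<close>, that is, one minus zero.\<close>

lemma completion_column:
  assumes j: "j \<in> {1..n}"
  shows "(\<Oplus>i\<in>{1..n}. completion i j) = \<one>"
proof (cases "j \<le> k")
  case True
  then show ?thesis using col[of j] j by (simp add: completion_def)
next
  case False
  define m where "m = j - k"
  have m: "1 \<le> m" "m + k \<le> n" using False j by (auto simp: m_def)
  have im: "(\<lambda>p. p + m) ` {..k} = {m..m + k}"
    by (auto simp: image_iff) (metis add.commute add_le_cancel_left atMost_iff le_Suc_ex)
  have "(\<Oplus>i\<in>{1..n}. completion i j) = (\<Oplus>i\<in>{m..m + k}. gap (i - m) i)"
    using m False j completion_closed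
    by (intro add.finprod_mono_neutral_cong_right) (auto simp: completion_def m_def intro!: gap_closed)
  also have "\<dots> = (\<Oplus>p\<in>{..k}. gap (p + m - m) (p + m))"
    unfolding im[symmetric] using m by (intro finsum_reindex) (auto intro!: gap_closed inj_onI)
  also have "\<dots> = (\<Oplus>p\<in>{..k}. cumulative p (m + p - 1) \<ominus> cumulative (Suc p) (m + Suc p - 1))"
    using m by (intro finsum_cong') (auto simp: gap_def add.commute intro!: minus_closed cumulative_closed)
  also have "\<dots> = cumulative 0 (m + 0 - 1) \<ominus> cumulative (Suc k) (m + Suc k - 1)"
    using m by (intro finsum_telescope cumulative_closed) auto
  also have "\<dots> = \<one>" by (simp add: cumulative_def a_minus_def)
  finally show ?thesis .
qed

text \<open>The events that exactly p of the values are at most r have telescoping differences as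
  projections. Each splits into X_p = r, found in the first k columns, and \<open>gap p r\<close>,
  found in a new column.\<close>

lemma completion_row:
  assumes r: "r \<in> {1..n}"
  shows "(\<Oplus>j\<in>{1..n}. completion r j) = \<one>"
proof -
  have im: "(\<lambda>p. k + r - p) ` {..k} = {r..k + r}"
  proof (intro equalityI subsetI)
    fix j assume "j \<in> {r..k + r}"
    then show "j \<in> (\<lambda>p. k + r - p) ` {..k}" by (intro image_eqI[of _ _ "k + r - j"]) auto
  qed auto
  have inj: "inj_on (\<lambda>p. k + r - p) {..k}" by (auto intro!: inj_onI)
  \<comment> \<open>Under j = k + r - p, the range 0..k of p becomes r..k + r; indices in this range
    outside the new columns k + 1..n carry zero gaps.\<close>
  have outside: "gap (k + r - j) r = \<zero>" if "j \<in> {r..k + r} - {k + 1..n}" for j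
    using that by (intro gap_eq_zero[OF r]) auto
  have inside: "completion r j = (if j \<in> {r..k + r} then gap (k + r - j) r else \<zero>)"
    if "j \<in> {k + 1..n}" for j
  proof -
    have "r - (j - k) = k + r - j" "j - k \<le> r \<longleftrightarrow> j \<le> k + r" "k + r - j \<le> k \<longleftrightarrow> r \<le> j" "\<not> j \<le> k"
      using that by auto
    then show ?thesis by (auto simp: completion_def)
  qed
  have "{1..n} = {1..k} \<union> {k + 1..n}" using kn by auto
  then have "(\<Oplus>j\<in>{1..n}. completion r j) = (\<Oplus>j\<in>{1..k}. completion r j) \<oplus> (\<Oplus>j\<in>{k + 1..n}. completion r j)"
    using completion_closed[OF r] kn by (auto intro!: finsum_Un_disjoint)
  also have "(\<Oplus>j\<in>{1..k}. completion r j) = (\<Oplus>j\<in>{1..k}. u r j)"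
    using r u_closed by (intro finsum_cong') (auto simp: completion_def)
  \<comment> \<open>Padding with zero at p = 0 aligns this sum with that of the gaps.\<close>
  also have "\<dots> = (\<Oplus>p\<in>{..k}. if p = 0 then \<zero> else u r p)"
    using r u_closed by (intro add.finprod_mono_neutral_cong_left) auto
  also have "(\<Oplus>j\<in>{k + 1..n}. completion r j) = (\<Oplus>j\<in>{r..k + r}. gap (k + r - j) r)"
    using r gap_closed[OF r] outside completion_closed[OF r]
    by (intro add.finprod_mono_neutral_cong) (auto simp: inside)
  also have "\<dots> = (\<Oplus>p\<in>{..k}. gap (k + r - (k + r - p)) r)"
    unfolding im[symmetric] using gap_closed[OF r] by (intro finsum_reindex inj) auto
  also have "\<dots> = (\<Oplus>p\<in>{..k}. gap p r)"
    using gap_closed[OF r] by (intro finsum_cong') auto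
  also have "(\<Oplus>p\<in>{..k}. if p = 0 then \<zero> else u r p) \<oplus> (\<Oplus>p\<in>{..k}. gap p r) =
      (\<Oplus>p\<in>{..k}. (if p = 0 then \<zero> else u r p) \<oplus> gap p r)"
    using r u_closed gap_closed[OF r] by (intro finsum_addf[symmetric]) auto
  also have "\<dots> = (\<Oplus>p\<in>{..k}. cumulative p r \<ominus> cumulative (Suc p) r)"
  proof (rule finsum_cong'[OF refl])
    fix p assume p: "p \<in> {..k}"
    have c: "cumulative p (r - 1) \<in> carrier A" "cumulative (Suc p) r \<in> carrier A"
      using r by (auto intro!: cumulative_closed)
    have "cumulative p r = (if p = 0 then \<zero> else u r p) \<oplus> cumulative p (r - 1)"
    proof (cases "p = 0")
      case False
      have "{1..r} = insert r {1..r - 1}" using r by auto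
      then show ?thesis
        using False p r u_closed by (auto simp: cumulative_def intro!: finsum_insert)
    qed (simp add: cumulative_def)
    then show "(if p = 0 then \<zero> else u r p) \<oplus> gap p r = cumulative p r \<ominus> cumulative (Suc p) r"
      using c u_closed[OF r, of p] p by (auto simp: gap_def a_minus_def a_assoc)
  qed (use r in \<open>auto intro!: minus_closed cumulative_closed\<close>)
  also have "\<dots> = cumulative 0 r \<ominus> cumulative (Suc k) r"
    using r by (intro finsum_telescope cumulative_closed) auto
  also have "\<dots> = \<one>" by (simp add: cumulative_def a_minus_def)
  finally show ?thesis .
qed

text \<open>Rows and columns of the completed matrix sum to one, so products within a row or a
  column vanish by \<open>sum_one_orthogonal\<close>, and the universal property of
  \<open>A_s\<close> applies.\<close>

lemma A_s_hom:
  "\<exists>h. unital_star_hom (A_s n) A h \<and> (\<forall>i\<in>{1..n}. \<forall>j\<in>{1..k}. h (A_s_u n i j) = u i j)"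
proof -
  interpret B: bounded_presentation "A_s_gens n" "A_s_rels n" by (rule bounded_presentation_A_s)
  define b where "b g = (case g of Ugen i j \<Rightarrow> completion i j | Pgen \<Rightarrow> \<one>)" for g
  have bc: "b \<in> A_s_gens n \<rightarrow> carrier A"
    using completion_closed by (auto simp: b_def A_s_gens_def)
  have Ug: "Ugen i j \<in> A_s_gens n" if "i \<in> {1..n}" "j \<in> {1..n}" for i j
    using that by (simp add: A_s_gens_def)
  have bproj: "b g \<otimes> b g = b g \<and> star A (b g) = b g" if g: "g \<in> A_s_gens n" for g
    using g completion_projection by (auto simp: b_def A_s_gens_def projection_def)
  note ev = star_poly_eval_simps[OF bc] star_poly_eval_gen[OF bc]
  have "star_poly_eval A b l = star_poly_eval A b r" if lr: "(l, r) \<in> A_s_rels n" for l r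
    using lr unfolding A_s_rels_def Let_def projection_relations_def
  proof (elim UnE CollectE exE conjE Pair_inject)
    fix g assume "l = free_gen g \<otimes>\<^bsub>free_star (A_s_gens n)\<^esub> free_gen g" "r = free_gen g" "g \<in> A_s_gens n"
    then show ?thesis using bproj by (simp add: ev)
  next
    fix g assume "l = star (free_star (A_s_gens n)) (free_gen g)" "r = free_gen g" "g \<in> A_s_gens n"
    then show ?thesis using bproj by (simp add: ev)
  next
    fix i j m
    assume "l = free_gen (Ugen i j) \<otimes>\<^bsub>free_star (A_s_gens n)\<^esub> free_gen (Ugen i m)"
      "r = \<zero>\<^bsub>free_star (A_s_gens n)\<^esub>" "i \<in> {1..n}" "j \<in> {1..n}" "m \<in> {1..n}" "j \<noteq> m"
    then show ?thesis
      using sum_one_orthogonal[of "{1..n}" "completion i" j m] completion_projection[of i] completion_row[of i]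
      by (simp add: ev Ug b_def)
  next
    fix i j m
    assume "l = free_gen (Ugen j i) \<otimes>\<^bsub>free_star (A_s_gens n)\<^esub> free_gen (Ugen m i)"
      "r = \<zero>\<^bsub>free_star (A_s_gens n)\<^esub>" "i \<in> {1..n}" "j \<in> {1..n}" "m \<in> {1..n}" "j \<noteq> m"
    then show ?thesis
      using sum_one_orthogonal[of "{1..n}" "\<lambda>l. completion l i" j m] completion_projection[of _ i]
        completion_column[of i]
      by (simp add: ev Ug b_def)
  next
    fix i
    assume "l = (\<Oplus>\<^bsub>free_star (A_s_gens n)\<^esub>j\<in>{1..n}. free_gen (Ugen i j))"
      "r = \<one>\<^bsub>free_star (A_s_gens n)\<^esub>" "i \<in> {1..n}"
    then show ?thesis
      using completion_row[of i] ev(5)[of "{1..n}" "\<lambda>j. Ugen i j"] Ug[of i] by (simp add: ev(2) b_def)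
  next
    fix i
    assume "l = (\<Oplus>\<^bsub>free_star (A_s_gens n)\<^esub>j\<in>{1..n}. free_gen (Ugen j i))"
      "r = \<one>\<^bsub>free_star (A_s_gens n)\<^esub>" "i \<in> {1..n}"
    then show ?thesis
      using completion_column[of i] ev(5)[of "{1..n}" "\<lambda>j. Ugen j i"] Ug[of _ i] by (simp add: ev(2) b_def)
  qed
  then have "\<exists>h. unital_star_hom (universal_cstar (A_s_gens n) (A_s_rels n)) A h \<and>
      (\<forall>g\<in>A_s_gens n. h (universal_gen (A_s_gens n) (A_s_rels n) g) = b g)"
    using bc by (intro B.universal_property unital_cstar_algebra_axioms) auto
  then obtain h where h: "unital_star_hom (A_s n) A h"
    "\<forall>g\<in>A_s_gens n. h (universal_gen (A_s_gens n) (A_s_rels n) g) = b g"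
    unfolding A_s_def by blast
  have "h (A_s_u n i j) = u i j" if "i \<in> {1..n}" "j \<in> {1..k}" for i j
    using h(2) Ug[of i j] that kn by (auto simp: A_s_u_def b_def completion_def)
  then show ?thesis using h(1) by blast
qed

end

end

section \<open>Quantum spreadability\<close>

lemma A_i_relations:
  shows "unital_cstar_algebra (A_i n k)"
    and "i \<in> {1..n} \<Longrightarrow> j \<in> {1..k} \<Longrightarrow> star_algebra.projection (A_i n k) (A_i_u n k i j)"
    and "j \<in> {1..k} \<Longrightarrow> (\<Oplus>\<^bsub>A_i n k\<^esub>i\<in>{1..n}. A_i_u n k i j) = \<one>\<^bsub>A_i n k\<^esub>"
    and "i \<in> {1..n} \<Longrightarrow> i' \<in> {1..n} \<Longrightarrow> j \<in> {1..k} \<Longrightarrow> j' \<in> {1..k} \<Longrightarrow> j < j' \<Longrightarrow> i' \<le> i \<Longrightarrow>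
      A_i_u n k i j \<otimes>\<^bsub>A_i n k\<^esub> A_i_u n k i' j' = \<zero>\<^bsub>A_i n k\<^esub>"
proof -
  interpret B: bounded_presentation "A_i_gens n k" "A_i_rels n k" by (rule bounded_presentation_A_i)
  show C: "unital_cstar_algebra (A_i n k)" unfolding A_i_def by (rule B.unital_cstar_algebra_universal)
  then interpret C: unital_cstar_algebra "A_i n k" .
  have Ug: "Ugen i j \<in> A_i_gens n k" if "i \<in> {1..n}" "j \<in> {1..k}" for i j
    using that by (simp add: A_i_gens_def)
  show "C.projection (A_i_u n k i j)" if "i \<in> {1..n}" "j \<in> {1..k}"
    unfolding C.projection_def unfolding A_i_def A_i_u_def
    using B.universal_gen_closed[OF Ug[OF that]] B.universal_gen_projection[OF Ug[OF that]] by blast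
  show "(\<Oplus>\<^bsub>A_i n k\<^esub>i\<in>{1..n}. A_i_u n k i j) = \<one>\<^bsub>A_i n k\<^esub>" if j: "j \<in> {1..k}"
  proof -
    have "(\<Oplus>\<^bsub>B.F\<^esub>i\<in>{1..n}. free_gen (Ugen i j), \<one>\<^bsub>B.F\<^esub>) \<in> A_i_rels n k"
      unfolding A_i_rels_def Let_def using j by blast
    from B.universal_relations[OF this] show ?thesis
      unfolding A_i_def A_i_u_def
      using B.universal_gen_eval(5)[of "{1..n}" "\<lambda>i. Ugen i j"] Ug[OF _ j]
      by (simp add: B.universal_gen_eval(2))
  qed
  show "A_i_u n k i j \<otimes>\<^bsub>A_i n k\<^esub> A_i_u n k i' j' = \<zero>\<^bsub>A_i n k\<^esub>"
    if "i \<in> {1..n}" "i' \<in> {1..n}" "j \<in> {1..k}" "j' \<in> {1..k}" "j < j'" "i' \<le> i"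
  proof -
    have "(free_gen (Ugen i j) \<otimes>\<^bsub>B.F\<^esub> free_gen (Ugen i' j'), \<zero>\<^bsub>B.F\<^esub>) \<in> A_i_rels n k"
      unfolding A_i_rels_def Let_def using that by blast
    from B.universal_relations[OF this] show ?thesis
      unfolding A_i_def A_i_u_def using that by (simp add: B.universal_gen_eval Ug)
  qed
qed

lemma quantum_exchangeable_imp_spreadable:
  assumes A: "nc_probability_space A \<phi>" and x: "\<forall>i\<in>{1..n}. x i \<in> carrier A"
    and ex: "quantum_exchangeable A \<phi> n x"
  shows "quantum_spreadable A \<phi> n x"
  unfolding quantum_spreadable_def Let_def
proof (intro ballI)
  fix k p assume "k \<in> {1..<n}" and p: "p \<in> carrier (nc_polynomials {1..k})"
  then have kn: "k \<le> n" and V: "{1..k} \<subseteq> {1..n}" by auto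
  let ?m = "\<lambda>w. joint_distribution A \<phi> x (monomial w)"
  interpret nc_probability_space A \<phi> by fact
  note R = A_i_relations[where n = n and k = k]
  interpret C: unital_cstar_algebra "A_i n k" by (rule R(1))
  interpret B: bounded_presentation "A_s_gens n" "A_s_rels n" by (rule bounded_presentation_A_s)
  interpret As: unital_cstar_algebra "A_s n" unfolding A_s_def by (rule B.unital_cstar_algebra_universal)
  obtain h where h: "unital_star_hom (A_s n) (A_i n k) h"
    and hu: "\<And>i j. i \<in> {1..n} \<Longrightarrow> j \<in> {1..k} \<Longrightarrow> h (A_s_u n i j) = A_i_u n k i j"
    using C.A_s_hom[where u = "A_i_u n k", OF kn R(2-4)] by blast
  have sc: "A_s_u n i j \<in> carrier (A_s n)" if "i \<in> {1..n}" "j \<in> {1..n}" for i j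
    unfolding A_s_def A_s_u_def by (rule B.universal_gen_closed) (use that in \<open>simp add: A_s_gens_def\<close>)
  have uc: "A_i_u n k i j \<in> carrier (A_i n k)" if "i \<in> {1..n}" "j \<in> {1..k}" for i j
    using R(2)[OF that] by (rule C.projection_closed)
  \<comment> \<open>Padding by units brings the identity into the form of
    \<open>coaction_identity_of_words\<close> with the unit as \<open>Q\<close>.\<close>
  have "joint_distribution A \<phi> x p \<odot>\<^bsub>A_i n k\<^esub> \<one>\<^bsub>A_i n k\<^esub> =
    \<one>\<^bsub>A_i n k\<^esub> \<otimes>\<^bsub>A_i n k\<^esub> tensor_id (A_i n k) (joint_distribution A \<phi> x) (coaction n (A_i n k) (A_i_u n k) p)
      \<otimes>\<^bsub>A_i n k\<^esub> \<one>\<^bsub>A_i n k\<^esub>"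
  proof (rule coaction_identity_of_words[OF x C.complex_algebra_axioms V uc C.one_closed _ p])
    fix w assume w: "w \<in> lists {1..k}"
    have w': "w \<in> lists {1..n}" using w lists_mono[OF V] by blast
    let ?T = "word_sum (A_s n) n (A_s_u n) w ?m"
    have "?m w \<odot>\<^bsub>A_s n\<^esub> \<one>\<^bsub>A_s n\<^esub> = ?T"
      using ex monomial_closed[OF w'] As.tensor_id_coaction_monomial[of n "{1..n}" "A_s_u n", OF sc w']
      by (simp add: quantum_exchangeable_def Let_def)
    then have "h (?m w \<odot>\<^bsub>A_s n\<^esub> \<one>\<^bsub>A_s n\<^esub>) = h ?T" by simp
    moreover have "h ?T = word_sum (A_i n k) n (\<lambda>i j. h (A_s_u n i j)) w ?m"
      by (rule star_hom_word_sum[OF As.star_algebra_axioms C.star_algebra_axioms h sc w'])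
    \<comment> \<open>A word over 1..k involves only the first k columns, whose images under
      \<open>h\<close> are known.\<close>
    moreover have "word_sum (A_i n k) n (\<lambda>i j. h (A_s_u n i j)) w ?m = word_sum (A_i n k) n (A_i_u n k) w ?m"
      by (rule C.word_sum_cong[OF w]) (auto simp: hu uc)
    moreover have "h (?m w \<odot>\<^bsub>A_s n\<^esub> \<one>\<^bsub>A_s n\<^esub>) = ?m w \<odot>\<^bsub>A_i n k\<^esub> \<one>\<^bsub>A_i n k\<^esub>"
      using h by (simp add: unital_star_hom_def)
    ultimately show "?m w \<odot>\<^bsub>A_i n k\<^esub> \<one>\<^bsub>A_i n k\<^esub> =
        \<one>\<^bsub>A_i n k\<^esub> \<otimes>\<^bsub>A_i n k\<^esub> word_sum (A_i n k) n (A_i_u n k) w ?m \<otimes>\<^bsub>A_i n k\<^esub> \<one>\<^bsub>A_i n k\<^esub>"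
      using C.word_sum_closed[of n "{1..k}" "A_i_u n k", OF uc w] by simp
  qed
  then show "joint_distribution A \<phi> x p \<odot>\<^bsub>A_i n k\<^esub> \<one>\<^bsub>A_i n k\<^esub> =
      tensor_id (A_i n k) (joint_distribution A \<phi> x) (coaction n (A_i n k) (A_i_u n k) p)"
    using C.tensor_id_coaction_closed[of n "{1..k}" "A_i_u n k", OF uc p] by simp
qed

theorem corollary4p8:
  fixes A :: "(complex, 'a) module"
    and \<phi> :: "'a \<Rightarrow> complex"
    and x :: "nat \<Rightarrow> 'a"
    and n :: nat
  assumes "nc_probability_space A \<phi>"
    and "\<forall>i\<in>{1..n}. x i \<in> carrier A"
  shows "(boolean_exchangeable A \<phi> n x \<longrightarrow> boolean_spreadable A \<phi> n x) \<and>
         (quantum_exchangeable A \<phi> n x \<longrightarrow> quantum_spreadable A \<phi> n x)"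
  using assms boolean_exchangeable_imp_spreadable quantum_exchangeable_imp_spreadable by blast

end
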